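(* Let $n,d\in\mathbb{N}$, $\varepsilon\in[0,1)$, let $\Sigma\in\mathbb{R}^{d\times d}$ be symmetric positive definite, $\Theta=\mathbb{R}^d$, and for $\theta\in\Theta$ let $$\mathcal{P}_\theta:=\Bigl\{R^{\otimes n}: R\in\mathcal{Q}(\mathbb{R}^d),\ R=(1-\varepsilon)P+\varepsilon Q,\ \mathbb{E}_P(X)=\theta,\ \mathrm{Cov}_P(X)=\Sigma,\ Q\in\mathcal{Q}(\mathbb{R}^d)\Bigr\}.$$ There exists a universal constant $c>0$ such that if $e^{-cn(1-300\varepsilon)}\le\delta\le1/4$, then, for the loss $L(\theta,\theta')=\|\theta-\theta'\|_2^2$, $$\mathcal{M}(\delta,\mathcal{P}_\Theta,\|\cdot\|_2^2)\asymp\frac{\mathrm{tr}(\Sigma)}{n}+\|\Sigma\|_{\mathrm{op}}\varepsilon+\frac{\|\Sigma\|_{\mathrm{op}}\log(1/\delta)}{n}.$$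
   Context: $\mathcal{Q}(\mathbb{R}^d)$ is the set of Borel probability measures on $\mathbb{R}^d$; in the definition of $\mathcal{P}_\theta$, $P\in\mathcal{Q}(\mathbb{R}^d)$ and $X\sim P$. For a pseudo-metric space $\Theta$ of parameters (with its Borel $\sigma$-algebra), a family $\mathcal{P}_\Theta=\{\mathcal{P}_\theta:\theta\in\Theta\}$ where each $\mathcal{P}_\theta$ is a set of probability measures on a measurable space $\mathcal{X}$, and a loss $L:\Theta\times\Theta\to[0,\infty)$, the minimax $(1-\delta)$th quantile is $$\mathcal{M}(\delta,\mathcal{P}_\Theta,L):=\inf_{\hat\theta}\sup_{\theta\in\Theta}\sup_{P_\theta\in\mathcal{P}_\theta}\inf\{r\in[0,\infty):P_\theta\{L(\hat\theta,\theta)\le r\}\ge1-\delta\},$$ where the first infimum is over all measurable functions $\hat\theta:\mathcal{X}\to\Theta$ (which may depend on $\delta$). Here $\mathcal{X}=(\mathbb{R}^d)^n$. The notation $\mathcal{M}(\delta,\mathcal{P}_\Theta,\|\cdot\|_2^2)$ refers to the loss $L(\theta,\theta')=\|\theta-\theta'\|_2^2$. $\|\cdot\|_{\mathrm{op}}$ is the operator (spectral) norm. $a\asymp b$ means that there are universal constants $c_1,c_2>0$ (not depending on any of the parameters, here $n,d,\varepsilon,\delta,\Sigma$) with $c_1b\le a\le c_2b$. *)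

theory Defs
  imports "HOL-Probability.Probability"
begin

(* The dimension d is quantified inside the statement (constants must not depend on it), so it
   cannot be a type: a vector of \<real>\<^sup>d is an element of {..<d} \<rightarrow>\<^sub>E UNIV, a d x d matrix is a
   function of two indices of which only the entries with i, j < d are ever used. *)

definition l2norm :: "nat \<Rightarrow> (nat \<Rightarrow> real) \<Rightarrow> real" where
  "l2norm d x = L2_set x {..<d}"

definition sq_loss :: "nat \<Rightarrow> (nat \<Rightarrow> real) \<Rightarrow> (nat \<Rightarrow> real) \<Rightarrow> real" where
  "sq_loss d \<theta> \<theta>' = (l2norm d (\<lambda>i. \<theta> i - \<theta>' i))\<^sup>2"

definition mat_vec :: "nat \<Rightarrow> (nat \<Rightarrow> nat \<Rightarrow> real) \<Rightarrow> (nat \<Rightarrow> real) \<Rightarrow> nat \<Rightarrow> real" where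
  "mat_vec d A x = (\<lambda>i. \<Sum>j<d. A i j * x j)"

definition sym_pos_def :: "nat \<Rightarrow> (nat \<Rightarrow> nat \<Rightarrow> real) \<Rightarrow> bool" where
  "sym_pos_def d A \<longleftrightarrow>
     (\<forall>i<d. \<forall>j<d. A i j = A j i) \<and>
     (\<forall>x. (\<exists>i<d. x i \<noteq> 0) \<longrightarrow> (\<Sum>i<d. x i * mat_vec d A x i) > 0)"

definition mat_trace :: "nat \<Rightarrow> (nat \<Rightarrow> nat \<Rightarrow> real) \<Rightarrow> real" where
  "mat_trace d A = (\<Sum>i<d. A i i)"

definition op_norm :: "nat \<Rightarrow> (nat \<Rightarrow> nat \<Rightarrow> real) \<Rightarrow> real" where
  "op_norm d A = Sup {l2norm d (mat_vec d A x) | x. l2norm d x \<le> 1}"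

(* \<real>\<^sup>d as a measurable space; for finitely many factors the product \<sigma>-algebra is the Borel one. *)
definition euclid :: "nat \<Rightarrow> (nat \<Rightarrow> real) measure" where
  "euclid d = (\<Pi>\<^sub>M i\<in>{..<d}. borel)"

definition prob_measures :: "nat \<Rightarrow> (nat \<Rightarrow> real) measure set" where
  "prob_measures d = space (prob_algebra (euclid d))"

(* Integrability is part of "the mean is m" and "the covariance is A": the Bochner integral of a
   non-integrable function is 0 by convention. *)
definition has_mean :: "nat \<Rightarrow> (nat \<Rightarrow> real) measure \<Rightarrow> (nat \<Rightarrow> real) \<Rightarrow> bool" where
  "has_mean d P m \<longleftrightarrow> (\<forall>i<d. integrable P (\<lambda>x. x i) \<and> (\<integral>x. x i \<partial>P) = m i)"

definition has_cov :: "nat \<Rightarrow> (nat \<Rightarrow> real) measure \<Rightarrow> (nat \<Rightarrow> nat \<Rightarrow> real) \<Rightarrow> bool" where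
  "has_cov d P A \<longleftrightarrow> (\<exists>m. has_mean d P m \<and>
     (\<forall>i<d. \<forall>j<d. integrable P (\<lambda>x. (x i - m i) * (x j - m j)) \<and>
        (\<integral>x. (x i - m i) * (x j - m j) \<partial>P) = A i j))"

definition is_mixture ::
  "real \<Rightarrow> 'a measure \<Rightarrow> 'a measure \<Rightarrow> 'a measure \<Rightarrow> bool" where
  "is_mixture \<epsilon> R P Q \<longleftrightarrow>
     (\<forall>B\<in>sets R. measure R B = (1 - \<epsilon>) * measure P B + \<epsilon> * measure Q B)"

definition contaminated_family ::
  "nat \<Rightarrow> nat \<Rightarrow> real \<Rightarrow> (nat \<Rightarrow> nat \<Rightarrow> real) \<Rightarrow> (nat \<Rightarrow> real) \<Rightarrow> (nat \<Rightarrow> nat \<Rightarrow> real) measure set"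
where
  "contaminated_family n d \<epsilon> \<Sigma> \<theta> =
     {(\<Pi>\<^sub>M k\<in>{..<n}. R) | R. R \<in> prob_measures d \<and>
        (\<exists>P\<in>prob_measures d. \<exists>Q\<in>prob_measures d.
           is_mixture \<epsilon> R P Q \<and> has_mean d P \<theta> \<and> has_cov d P \<Sigma>)}"

(* X is the sample space and T the parameter space with its Borel \<sigma>-algebra; only their spaces and
   \<sigma>-algebras matter. Values are extended, so that an unbounded supremum is \<infinity>. *)
definition minimax_quantile ::
  "'x measure \<Rightarrow> 't measure \<Rightarrow> real \<Rightarrow> ('t \<Rightarrow> 'x measure set) \<Rightarrow> ('t \<Rightarrow> 't \<Rightarrow> real) \<Rightarrow> ennreal"
where
  "minimax_quantile X T \<delta> \<P> L =
     (INF \<theta>h \<in> X \<rightarrow>\<^sub>M T. SUP \<theta> \<in> space T. SUP P \<in> \<P> \<theta>.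
        Inf {ennreal r | r. 0 \<le> r \<and> measure P {x \<in> space X. L (\<theta>h x) \<theta> \<le> r} \<ge> 1 - \<delta>})"

end

theory Submission imports Defs begin

text \<open>
  Upper bound: a median-of-means estimator with \<open>K\<close> of order \<open>ln (1 / \<delta>) + \<epsilon> n\<close> blocks, so that a block
  is free of contamination with probability at least \<open>99/100\<close>. That for every direction \<open>v\<close> fewer than
  half of the block means are far from the true mean along \<open>v\<close> follows from a PAC-Bayes argument:
  \<open>v\<close> is replaced by a Gaussian perturbation \<open>v + u\<close> with covariance of order \<open>1 / K\<close>, whose relative
  entropy with respect to the law of \<open>u\<close> is of order \<open>K\<close> for every unit \<open>v\<close>, and the perturbation turns
  the operator norm of \<open>\<Sigma>\<close> into that norm plus \<open>tr \<Sigma> / K\<close>.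

  Lower bound: the sample is a sum of independent rare jumps \<open>\<plusminus>s\<close> along the (rescaled) eigenvectors of \<open>\<Sigma>\<close>.
  As long as a jump has not been observed its sign is unknown. Flipping all unobserved signs gives the trace term,
  flipping the sign of the top eigenvector gives the term in \<open>ln (1 / \<delta>)\<close>, and hiding it by
  contamination gives the term in \<open>\<epsilon>\<close>.
\<close>

section \<open>Symmetric positive semidefinite matrices\<close>

text \<open>The constants may not depend on the dimension, so a net of directions is too expensive,
  and with two moments only Chebyshev's inequality is available for a single block. For an
  unnormalised direction \<open>u\<close> it bounds the tail by
  \<open>m * qform d A u / t\<^sup>2 + m * \<epsilon>\<close>, where \<open>m\<close> is the block
  length. This is quadratic in \<open>u\<close>, so its Gaussian average is explicit, and uniformity
  in the direction costs only an entropy that does not see the dimension. As \<open>m\<close> is of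
  order \<open>n / K\<close>, the squared error \<open>op_norm d A / m\<close> of a block yields the
  term in \<epsilon> and the logarithmic term together. There cannot be more blocks than
  observations: this is where the lower limit on \<delta> enters, and together with \<delta> \<le>
  1/4 it forces \<epsilon> < 1/300. In the lower bound the laws for all sign patterns are images of
  one random activity pattern. Orthogonality of the eigenvectors makes the squared distances caused
  by separate flips add up, so all unseen coordinates can be charged at once.\<close>

definition dotp :: "nat \<Rightarrow> (nat \<Rightarrow> real) \<Rightarrow> (nat \<Rightarrow> real) \<Rightarrow> real" where
  "dotp d x y = (\<Sum>i<d. x i * y i)"

definition qform :: "nat \<Rightarrow> (nat \<Rightarrow> nat \<Rightarrow> real) \<Rightarrow> (nat \<Rightarrow> real) \<Rightarrow> real" where
  "qform d A x = dotp d x (mat_vec d A x)"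

definition sym_psd :: "nat \<Rightarrow> (nat \<Rightarrow> nat \<Rightarrow> real) \<Rightarrow> bool" where
  "sym_psd d A \<longleftrightarrow> (\<forall>i<d. \<forall>j<d. A i j = A j i) \<and> (\<forall>x. 0 \<le> qform d A x)"

lemma dotp_commute: "dotp d x y = dotp d y x"
  by (simp add: dotp_def mult.commute)

lemma dotp_add_left: "dotp d (\<lambda>i. x i + y i) z = dotp d x z + dotp d y z"
  by (simp add: dotp_def algebra_simps sum.distrib)

lemma dotp_add_right: "dotp d z (\<lambda>i. x i + y i) = dotp d z x + dotp d z y"
  by (simp add: dotp_def algebra_simps sum.distrib)

lemma dotp_diff_left: "dotp d (\<lambda>i. x i - y i) z = dotp d x z - dotp d y z"
  by (simp add: dotp_def algebra_simps sum_subtractf)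

lemma dotp_diff_right: "dotp d z (\<lambda>i. x i - y i) = dotp d z x - dotp d z y"
  by (simp add: dotp_def algebra_simps sum_subtractf)

lemma dotp_scale_left: "dotp d (\<lambda>i. c * x i) z = c * dotp d x z"
  by (simp add: dotp_def sum_distrib_left algebra_simps)

lemma dotp_scale_right: "dotp d z (\<lambda>i. c * x i) = c * dotp d z x"
  by (simp add: dotp_def sum_distrib_left algebra_simps)

lemma dotp_sum_left: "dotp d (\<lambda>i. \<Sum>k\<in>K. f k i) z = (\<Sum>k\<in>K. dotp d (f k) z)"
  unfolding dotp_def sum_distrib_right by (rule sum.swap)

lemma dotp_sum_right: "dotp d z (\<lambda>i. \<Sum>k\<in>K. f k i) = (\<Sum>k\<in>K. dotp d z (f k))"
  using dotp_sum_left[where f=f and z=z and K=K and d=d] by (simp add: dotp_commute)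

lemma dotp_cong: "(\<And>i. i < d \<Longrightarrow> x i = x' i) \<Longrightarrow> (\<And>i. i < d \<Longrightarrow> y i = y' i) \<Longrightarrow> dotp d x y = dotp d x' y'"
  by (simp add: dotp_def)

lemma dotp_self_nonneg [simp]: "0 \<le> dotp d x x"
  by (simp add: dotp_def sum_nonneg)

lemma dotp_self_eq_0: "dotp d x x = 0 \<Longrightarrow> i < d \<Longrightarrow> x i = 0"
  by (simp add: dotp_def sum_nonneg_eq_0_iff)

lemma dotp_unit: "i < d \<Longrightarrow> dotp d (\<lambda>j. if j = i then 1 else 0) x = x i"
  by (simp add: dotp_def of_bool_def if_distrib[where f="\<lambda>a. a * _"] cong: if_cong)

lemma l2norm_nonneg [simp]: "0 \<le> l2norm d x"
  by (simp add: l2norm_def)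

lemma l2norm_sq: "(l2norm d x)\<^sup>2 = dotp d x x"
  by (simp add: l2norm_def L2_set_def dotp_def sum_nonneg power2_eq_square)

lemma dotp_le_l2norm: "\<bar>dotp d x y\<bar> \<le> l2norm d x * l2norm d y"
proof -
  have "\<bar>dotp d x y\<bar> \<le> (\<Sum>i<d. \<bar>x i\<bar> * \<bar>y i\<bar>)"
    unfolding dotp_def by (rule order_trans[OF sum_abs]) (simp add: abs_mult)
  then show ?thesis
    unfolding l2norm_def using L2_set_mult_ineq[of x y "{..<d}"] by linarith
qed

lemma l2norm_scale: "l2norm d (\<lambda>i. c * x i) = \<bar>c\<bar> * l2norm d x"
proof -
  have "(l2norm d (\<lambda>i. c * x i))\<^sup>2 = (\<bar>c\<bar> * l2norm d x)\<^sup>2"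
    by (simp add: l2norm_sq power_mult_distrib dotp_scale_left dotp_scale_right) (simp add: power2_eq_square)
  then show ?thesis by (rule power2_eq_imp_eq) simp_all
qed

lemma l2norm_triangle: "l2norm d (\<lambda>i. x i + y i) \<le> l2norm d x + l2norm d y"
  unfolding l2norm_def by (rule L2_set_triangle_ineq)

lemma sq_loss_eq: "sq_loss d x y = dotp d (\<lambda>i. x i - y i) (\<lambda>i. x i - y i)"
  by (simp add: sq_loss_def l2norm_sq)

lemma mat_vec_add_scale: "mat_vec d A (\<lambda>i. x i + t * y i) = (\<lambda>i. mat_vec d A x i + t * mat_vec d A y i)"
  by (simp add: mat_vec_def algebra_simps sum.distrib sum_distrib_left)

lemma dotp_mat_vec_commute:
  assumes "\<forall>i<d. \<forall>j<d. A i j = A j i"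
  shows "dotp d x (mat_vec d A y) = dotp d y (mat_vec d A x)"
proof -
  have "dotp d x (mat_vec d A y) = (\<Sum>i<d. \<Sum>j<d. x i * A i j * y j)"
    by (simp add: dotp_def mat_vec_def sum_distrib_left mult.assoc)
  also have "\<dots> = (\<Sum>j<d. \<Sum>i<d. x i * A i j * y j)" by (rule sum.swap)
  also have "\<dots> = (\<Sum>j<d. \<Sum>i<d. y j * (A j i * x i))"
    using assms by (intro sum.cong refl) (simp add: mult.commute mult.left_commute)
  finally show ?thesis by (simp add: dotp_def mat_vec_def sum_distrib_left)
qed

lemma qform_add_scale:
  assumes "\<forall>i<d. \<forall>j<d. A i j = A j i"
  shows "qform d A (\<lambda>i. x i + t * y i) = qform d A x + 2 * t * dotp d y (mat_vec d A x) + t\<^sup>2 * qform d A y"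
  using dotp_mat_vec_commute[OF assms, of x y]
  by (simp add: qform_def mat_vec_add_scale dotp_add_left dotp_add_right dotp_scale_left
      dotp_scale_right algebra_simps power2_eq_square)

lemma qform_scale: "qform d A (\<lambda>i. c * x i) = c\<^sup>2 * qform d A x"
  using mat_vec_add_scale[of d A "\<lambda>_. 0" c x]
  by (simp add: qform_def dotp_scale_left dotp_scale_right power2_eq_square mat_vec_def)

text \<open>If the \<open>i\<close>-th entry \<open>b\<close> of the product were nonzero, a small
  step from \<open>x\<close> along the \<open>i\<close>-th unit vector, against the sign of
  \<open>b\<close>, would make the form negative.\<close>

lemma sym_psd_kernel:
  assumes A: "sym_psd d A" and x: "qform d A x = 0" and i: "i < d"
  shows "mat_vec d A x i = 0"
proof -
  define y where "y = (\<lambda>j. if j = i then 1 else (0::real))"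
  define b where "b = dotp d y (mat_vec d A x)"
  define c where "c = qform d A y"
  have s: "\<forall>i<d. \<forall>j<d. A i j = A j i" and nn: "\<And>x. 0 \<le> qform d A x"
    using A by (auto simp: sym_psd_def)
  have c: "0 \<le> c" using nn c_def by simp
  \<comment> \<open>The denominator \<open>c + 1\<close> in place of the optimal \<open>c\<close>
    also covers \<open>c = 0\<close>.\<close>
  define t where "t = - b / (c + 1)"
  have bt: "b = - (t * (c + 1))" using c by (simp add: t_def)
  have "0 \<le> 2 * t * b + t\<^sup>2 * c"
    using nn[of "\<lambda>j. x j + t * y j"] x unfolding qform_add_scale[OF s] b_def c_def by simp
  also have "\<dots> = - (t\<^sup>2 * (c + 2))"
    unfolding bt by (simp add: power2_eq_square algebra_simps)
  finally have "t = 0" using c by (simp add: mult_le_0_iff)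
  then have "b = 0" by (simp add: bt)
  then show ?thesis using dotp_unit[OF i, of "mat_vec d A x"] by (simp add: b_def y_def)
qed

lemma sym_psd_eq_0:
  assumes A: "sym_psd d A" and x: "\<And>x. dotp d x x = 1 \<Longrightarrow> qform d A x = 0" and ij: "i < d" "j < d"
  shows "A i j = 0"
proof -
  define y where "y = (\<lambda>k. if k = j then 1 else (0::real))"
  have "dotp d y y = 1" using dotp_unit[OF ij(2), of y] by (simp add: y_def)
  then have "mat_vec d A y i = 0" using sym_psd_kernel[OF A x ij(1)] by simp
  moreover have "mat_vec d A y i = A i j"
    using dotp_unit[OF ij(2), of "A i"] by (simp add: mat_vec_def y_def dotp_def mult.commute)
  ultimately show ?thesis by simp
qed

lemma sphere_attains_max:
  assumes "d \<ge> 1"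
  obtains e where "dotp d e e = 1" and "\<And>x. dotp d x x = 1 \<Longrightarrow> qform d A x \<le> qform d A e"
proof -
  \<comment> \<open>Vectors are functions on all naturals, so the coordinates from \<open>d\<close>
    on are pinned to 0; then the cube is compact by Tychonoff's theorem.\<close>
  define C where "C = (PiE UNIV (\<lambda>i::nat. if i < d then {-1..1::real} else {0}))"
  define S where "S = C \<inter> {x. dotp d x x = 1}"
  have ct: "continuous_on UNIV (\<lambda>x. dotp d x x)" "continuous_on UNIV (qform d A)"
    unfolding qform_def dotp_def mat_vec_def by (intro continuous_intros continuous_on_product_coordinates)+
  have "compactin (product_topology (\<lambda>i. euclidean) UNIV) C"
    unfolding C_def compactin_PiE by auto
  then have "compact C" by (simp add: euclidean_product_topology)
  moreover have "closed {x. dotp d x x = 1}"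
    using continuous_closed_preimage_constant[OF ct(1) closed_UNIV, of 1] by simp
  ultimately have "compact S" unfolding S_def by (rule compact_Int_closed)
  moreover have "(\<lambda>i. if i = 0 then 1 else 0) \<in> S"
    using assms dotp_unit[of 0 d] by (auto simp: S_def C_def PiE_def extensional_def)
  ultimately obtain e where e: "e \<in> S" "\<And>y. y \<in> S \<Longrightarrow> qform d A y \<le> qform d A e"
    using continuous_attains_sup[of S "qform d A"] continuous_on_subset[OF ct(2)] by blast
  show thesis
  proof
    show "dotp d e e = 1" using e by (simp add: S_def)
    fix x assume x: "dotp d x x = 1"
    define x' where "x' = (\<lambda>i. if i < d then x i else 0)"
    have "dotp d x' x' = 1" "qform d A x' = qform d A x"
      using x by (auto simp: x'_def dotp_def qform_def mat_vec_def)
    moreover have "x' i \<in> {-1..1}" if "i < d" for i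
    proof -
      have "(x i)\<^sup>2 \<le> dotp d x x" unfolding dotp_def power2_eq_square
        by (rule member_le_sum) (use that in auto)
      then have "\<bar>x i\<bar> \<le> 1" using x by (simp add: abs_square_le_1)
      then show ?thesis using that by (auto simp: x'_def)
    qed
    ultimately have "x' \<in> S" by (auto simp: S_def C_def x'_def)
    then show "qform d A x \<le> qform d A e" using e(2)[of x'] \<open>qform d A x' = qform d A x\<close> by simp
  qed
qed

lemma mat_vec_rank_one_diff:
  "mat_vec d (\<lambda>i j. A i j - a i * a j) x = (\<lambda>i. mat_vec d A x i - dotp d a x * a i)"
proof -
  have "mat_vec d (\<lambda>i j. A i j - a i * a j) x = (\<lambda>i. mat_vec d A x i - a i * dotp d a x)"
    by (simp add: mat_vec_def dotp_def left_diff_distrib sum_subtractf sum_distrib_left mult.assoc)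
  then show ?thesis by (simp add: mult.commute)
qed

lemma qform_rank_one_diff:
  "qform d (\<lambda>i j. A i j - a i * a j) x = qform d A x - (dotp d a x)\<^sup>2"
  unfolding qform_def mat_vec_rank_one_diff
  by (simp add: dotp_diff_right dotp_scale_right power2_eq_square dotp_commute)

text \<open>A maximiser \<open>e\<close> of the form on the unit sphere, with value
  \<open>l\<close>, is an eigenvector, because \<open>l\<close> times the identity minus
  \<open>A\<close> is positive semidefinite and its form vanishes at \<open>e\<close>. The vector
  \<open>a\<close> is \<open>e\<close> scaled by \<open>sqrt l\<close>. The form of the deflated
  matrix at \<open>x\<close> is that of \<open>A\<close> at \<open>x\<close> minus its component
  along \<open>e\<close>, hence nonnegative.\<close>

lemma sym_psd_deflate:
  assumes A: "sym_psd d A" and d: "d \<ge> 1"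
  obtains a where "sym_psd d (\<lambda>i j. A i j - a i * a j)"
    and "\<And>i. i < d \<Longrightarrow> mat_vec d A a i = dotp d a a * a i"
    and "dotp d a a > 0 \<or> (\<forall>i<d. \<forall>j<d. A i j = 0)"
proof -
  have s: "\<forall>i<d. \<forall>j<d. A i j = A j i" and nn: "\<And>x. 0 \<le> qform d A x"
    using A by (auto simp: sym_psd_def)
  obtain e where e: "dotp d e e = 1" and emax: "\<And>x. dotp d x x = 1 \<Longrightarrow> qform d A x \<le> qform d A e"
    using sphere_attains_max[OF d] by blast
  define l where "l = qform d A e"
  have l0: "0 \<le> l" using nn l_def by simp
  have le: "qform d A x \<le> l * dotp d x x" for x
  proof (cases "dotp d x x = 0")
    case True
    then have "qform d A x = 0" using dotp_self_eq_0[OF True] by (simp add: qform_def dotp_def)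
    then show ?thesis using True by simp
  next
    case False
    then have p: "dotp d x x > 0" using dotp_self_nonneg[of d x] by linarith
    define c where "c = 1 / sqrt (dotp d x x)"
    have c2: "c\<^sup>2 = 1 / dotp d x x" using p by (simp add: c_def power_divide)
    have "dotp d (\<lambda>i. c * x i) (\<lambda>i. c * x i) = c\<^sup>2 * dotp d x x"
      by (simp add: dotp_scale_left dotp_scale_right power2_eq_square)
    then have "qform d A (\<lambda>i. c * x i) \<le> l" using emax p c2 l_def by simp
    then have "qform d A x / dotp d x x \<le> l" by (simp add: qform_scale c2)
    then show ?thesis using p by (simp add: field_simps)
  qed
  define B where "B = (\<lambda>i j. (if i = j then l else 0) - A i j)"
  have mB: "mat_vec d B x i = l * x i - mat_vec d A x i" if "i < d" for x i
    using that by (simp add: mat_vec_def B_def left_diff_distrib sum_subtractf if_distrib[where f="\<lambda>a. a * _"] cong: if_cong)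
  have qB: "qform d B x = l * dotp d x x - qform d A x" for x
  proof -
    have "qform d B x = dotp d x (\<lambda>i. l * x i - mat_vec d A x i)"
      unfolding qform_def by (rule dotp_cong) (simp_all add: mB)
    then show ?thesis by (simp add: dotp_diff_right dotp_scale_right qform_def)
  qed
  have "sym_psd d B" unfolding sym_psd_def using qB le s by (auto simp: B_def)
  moreover have "qform d B e = 0" using qB e l_def by simp
  ultimately have Ae: "mat_vec d A e i = l * e i" if "i < d" for i
    using sym_psd_kernel[of d B e i] mB[of i e] that by simp
  define a where "a = (\<lambda>i. sqrt l * e i)"
  have aa: "dotp d a a = l" using l0 e by (simp add: a_def dotp_scale_left dotp_scale_right)
  have Ma: "mat_vec d A a i = dotp d a a * a i" if "i < d" for i
    using mat_vec_add_scale[of d A "\<lambda>_. 0" "sqrt l" e] Ae[OF that] aa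
    by (simp add: a_def mat_vec_def)
  have "0 \<le> qform d (\<lambda>i j. A i j - a i * a j) x" for x
  proof -
    define t where "t = dotp d e x"
    have "0 \<le> qform d A (\<lambda>i. x i + (- t) * e i)" by (rule nn)
    also have "\<dots> = qform d A x + 2 * (- t) * dotp d e (mat_vec d A x) + t\<^sup>2 * l"
      unfolding qform_add_scale[OF s] by (simp add: l_def)
    also have "dotp d e (mat_vec d A x) = dotp d x (mat_vec d A e)"
      by (rule dotp_mat_vec_commute[OF s])
    also have "dotp d x (mat_vec d A e) = dotp d x (\<lambda>i. l * e i)"
      by (rule dotp_cong) (simp_all add: Ae)
    also have "\<dots> = l * t" by (simp add: dotp_scale_right t_def dotp_commute)
    finally have "0 \<le> qform d A x - l * t\<^sup>2" by (simp add: power2_eq_square algebra_simps)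
    moreover have "(dotp d a x)\<^sup>2 = l * t\<^sup>2"
      using l0 by (simp add: a_def dotp_scale_left t_def power_mult_distrib)
    ultimately show ?thesis by (simp add: qform_rank_one_diff)
  qed
  then have "sym_psd d (\<lambda>i j. A i j - a i * a j)"
    using s by (auto simp: sym_psd_def)
  moreover have "dotp d a a > 0 \<or> (\<forall>i<d. \<forall>j<d. A i j = 0)"
  proof (cases "l = 0")
    case True
    have "qform d A x = 0" for x using le[of x] nn[of x] True by simp
    then show ?thesis using sym_psd_eq_0[OF A] by blast
  qed (use aa l0 in auto)
  ultimately show thesis using that Ma by blast
qed

lemma bessel:
  fixes N :: nat
  assumes orth: "\<And>k l. k < N \<Longrightarrow> l < N \<Longrightarrow> k \<noteq> l \<Longrightarrow> dotp d (e k) (e l) = 0"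
    and unit: "\<And>k. k < N \<Longrightarrow> dotp d (e k) (e k) = (1::real)"
  shows "(\<Sum>k<N. (dotp d (e k) x)\<^sup>2) \<le> dotp d x x"
proof -
  define p where "p = (\<lambda>i. \<Sum>k<N. dotp d (e k) x * e k i)"
  have ep: "dotp d (e k) p = dotp d (e k) x" if "k < N" for k
  proof -
    have "dotp d (e k) p = (\<Sum>l<N. dotp d (e l) x * dotp d (e k) (e l))"
      unfolding p_def by (simp add: dotp_sum_right dotp_scale_right)
    also have "\<dots> = (\<Sum>l<N. if l = k then dotp d (e k) x else 0)"
      using orth unit that by (intro sum.cong) auto
    also have "\<dots> = dotp d (e k) x" using that by (simp add: sum.delta)
    finally show ?thesis .
  qed
  have px: "dotp d p y = (\<Sum>k<N. dotp d (e k) x * dotp d (e k) y)" for y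
    unfolding p_def by (simp add: dotp_sum_left dotp_scale_left)
  have "0 \<le> dotp d (\<lambda>i. x i - p i) (\<lambda>i. x i - p i)" by simp
  also have "\<dots> = dotp d x x - 2 * dotp d p x + dotp d p p"
    by (simp add: dotp_diff_left dotp_diff_right dotp_commute)
  also have "dotp d p p = dotp d p x" using ep px[of p] px[of x] by simp
  finally show ?thesis using px[of x] by (simp add: power2_eq_square)
qed

text \<open>Double counting of the squared entries: the vectors contribute 1 each, and Bessel's
  inequality for a unit vector bounds what each of the \<open>d\<close> coordinates receives by
  1.\<close>

lemma orthonormal_card_le:
  fixes N :: nat
  assumes orth: "\<And>k l. k < N \<Longrightarrow> l < N \<Longrightarrow> k \<noteq> l \<Longrightarrow> dotp d (e k) (e l) = 0"
    and unit: "\<And>k. k < N \<Longrightarrow> dotp d (e k) (e k) = (1::real)"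
  shows "N \<le> d"
proof -
  have "real N = (\<Sum>k<N. dotp d (e k) (e k))" using unit by simp
  also have "\<dots> = (\<Sum>i<d. \<Sum>k<N. (e k i)\<^sup>2)"
    unfolding dotp_def power2_eq_square by (rule sum.swap)
  also have "\<dots> \<le> (\<Sum>i<d. 1)"
  proof (rule sum_mono)
    fix i assume i: "i \<in> {..<d}"
    show "(\<Sum>k<N. (e k i)\<^sup>2) \<le> 1"
      using bessel[of N d e "\<lambda>j. if j = i then 1 else 0"] orth unit dotp_unit[of i d] i
      by (simp add: dotp_commute)
  qed
  finally show ?thesis by simp
qed

text \<open>A spectral theorem: the \<open>a k\<close> are eigenvectors scaled by the square roots of their eigenvalues.\<close>

lemma sym_psd_orthogonal_decomposition:
  assumes A: "sym_psd d A"
  obtains N :: nat and a where "\<And>k l. k < N \<Longrightarrow> l < N \<Longrightarrow> k \<noteq> l \<Longrightarrow> dotp d (a k) (a l) = 0"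
    and "\<And>i j. i < d \<Longrightarrow> j < d \<Longrightarrow> A i j = (\<Sum>k<N. a k i * a k j)"
proof (cases "d = 0")
  case True
  then show thesis using that[of 0] by simp
next
  case False
  define res where "res = (\<lambda>N (a::nat \<Rightarrow> nat \<Rightarrow> real) i j. A i j - (\<Sum>k<N. a k i * a k j))"
  define ortho where "ortho = (\<lambda>N (a::nat \<Rightarrow> nat \<Rightarrow> real). \<forall>k<N. \<forall>l<N. k \<noteq> l \<longrightarrow> dotp d (a k) (a l) = 0)"
  \<comment> \<open>Repeated deflation. That the residual annihilates the vectors found so far is
    carried along to make the next one orthogonal to them. The disjunction records that a zero
    vector appears only once the residual is zero.\<close>
  have step: "\<exists>a. ortho N a \<and> sym_psd d (res N a) \<and> (\<forall>k<N. \<forall>i<d. mat_vec d (res N a) (a k) i = 0) \<and>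
      ((\<forall>k<N. dotp d (a k) (a k) > 0) \<or> (\<forall>i<d. \<forall>j<d. res N a i j = 0))" for N
  proof (induction N)
    case 0
    then show ?case using A by (auto simp: res_def ortho_def)
  next
    case (Suc N)
    then obtain a where a: "ortho N a" "sym_psd d (res N a)"
      "\<And>k i. k < N \<Longrightarrow> i < d \<Longrightarrow> mat_vec d (res N a) (a k) i = 0"
      "(\<forall>k<N. dotp d (a k) (a k) > 0) \<or> (\<forall>i<d. \<forall>j<d. res N a i j = 0)" by blast
    obtain b where b: "sym_psd d (\<lambda>i j. res N a i j - b i * b j)"
      "\<And>i. i < d \<Longrightarrow> mat_vec d (res N a) b i = dotp d b b * b i"
      "dotp d b b > 0 \<or> (\<forall>i<d. \<forall>j<d. res N a i j = 0)"
    proof (rule sym_psd_deflate[OF a(2)])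
      show "1 \<le> d" using False by simp
    qed (rule that)
    define a' where "a' = a(N := b)"
    have res': "res (Suc N) a' = (\<lambda>i j. res N a i j - b i * b j)"
      by (auto simp: res_def a'_def fun_eq_iff)
    have mv: "mat_vec d (res (Suc N) a') x i = mat_vec d (res N a) x i - dotp d b x * b i" for x i
      unfolding res' mat_vec_rank_one_diff by simp
    have b0: "b i = 0" if "dotp d b b = 0" "i < d" for i
      using that dotp_self_eq_0 by blast
    \<comment> \<open>An eigenvector of the symmetric residual for a nonzero eigenvalue is
      orthogonal to its kernel, which contains \<open>a k\<close>.\<close>
    have ba: "dotp d b (a k) = 0" if k: "k < N" for k
    proof (cases "dotp d b b = 0")
      case True
      then show ?thesis using b0[OF True] by (simp add: dotp_def)
    next
      case False
      have "dotp d (a k) (mat_vec d (res N a) b) = dotp d (a k) (\<lambda>i. dotp d b b * b i)"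
        by (rule dotp_cong) (simp_all add: b(2))
      then have "dotp d b b * dotp d b (a k) = dotp d (a k) (mat_vec d (res N a) b)"
        by (simp add: dotp_scale_right dotp_commute[of d "a k" b])
      also have "\<dots> = dotp d b (mat_vec d (res N a) (a k))"
        by (rule dotp_mat_vec_commute) (use a(2) in \<open>simp add: sym_psd_def\<close>)
      also have "\<dots> = 0" using a(3)[OF k] by (simp add: dotp_def)
      finally show ?thesis using False by simp
    qed
    have "ortho (Suc N) a'"
      using a(1) ba by (auto simp: ortho_def a'_def less_Suc_eq dotp_commute)
    moreover have "\<forall>k<Suc N. \<forall>i<d. mat_vec d (res (Suc N) a') (a' k) i = 0"
      unfolding mv using a(3) b(2) ba by (auto simp: a'_def less_Suc_eq)
    moreover have "(\<forall>k<Suc N. dotp d (a' k) (a' k) > 0) \<or> (\<forall>i<d. \<forall>j<d. res (Suc N) a' i j = 0)"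
    proof (cases "dotp d b b > 0")
      case True
      show ?thesis
      proof (cases "\<forall>k<N. dotp d (a k) (a k) > 0")
        case True
        then show ?thesis using \<open>dotp d b b > 0\<close> by (auto simp: a'_def less_Suc_eq)
      next
        case False
        then have z: "\<forall>i<d. \<forall>j<d. res N a i j = 0" using a(4) by blast
        have "mat_vec d (res N a) b i = 0" if "i < d" for i using z that by (simp add: mat_vec_def)
        then have "b i = 0" if "i < d" for i using b(2) that True by fastforce
        then show ?thesis using z unfolding res' by simp
      qed
    next
      case False
      then have "dotp d b b = 0" using dotp_self_nonneg[of d b] by linarith
      then show ?thesis using b(3) b0 unfolding res' by auto
    qed
    ultimately show ?case using b(1) res' by (intro exI[of _ a']) auto
  qed
  obtain a where a: "ortho (Suc d) a"
    "(\<forall>k<Suc d. dotp d (a k) (a k) > 0) \<or> (\<forall>i<d. \<forall>j<d. res (Suc d) a i j = 0)"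
    using step[of "Suc d"] by blast
  \<comment> \<open>There is no room for \<open>Suc d\<close> nonzero orthogonal vectors, so the
    residual has vanished by then.\<close>
  have "\<not> (\<forall>k<Suc d. dotp d (a k) (a k) > 0)"
  proof
    assume pos: "\<forall>k<Suc d. dotp d (a k) (a k) > 0"
    define e where "e = (\<lambda>k i. (1 / sqrt (dotp d (a k) (a k))) * a k i)"
    have "dotp d (e k) (e l) = (1 / sqrt (dotp d (a k) (a k))) * (1 / sqrt (dotp d (a l) (a l))) * dotp d (a k) (a l)" for k l
      unfolding e_def dotp_scale_left dotp_scale_right by simp
    then have "Suc d \<le> d"
      using a(1) pos by (intro orthonormal_card_le[of "Suc d" d e]) (auto simp: ortho_def simp del: real_sqrt_mult)
    then show False by simp
  qed
  then have "\<forall>i<d. \<forall>j<d. res (Suc d) a i j = 0" using a(2) by blast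
  then show thesis using that[of "Suc d" a] a(1) by (auto simp: res_def ortho_def)
qed

section \<open>Operator norm, trace and minimax quantiles\<close>

text \<open>\<open>Sup\<close> on the reals is informative only for bounded sets. The bound is the
  Frobenius norm, by the Cauchy-Schwarz inequality in each row.\<close>

lemma bdd_above_op_norm: "bdd_above {l2norm d (mat_vec d A x) | x. l2norm d x \<le> 1}"
proof (rule bdd_aboveI, safe)
  fix x assume x: "l2norm d x \<le> 1"
  have "l2norm d (mat_vec d A x) = L2_set (\<lambda>i. \<bar>dotp d (A i) x\<bar>) {..<d}"
    by (simp add: l2norm_def L2_set_def mat_vec_def dotp_def)
  also have "\<dots> \<le> L2_set (\<lambda>i. l2norm d (A i)) {..<d}"
  proof (rule L2_set_mono)
    fix i
    have "\<bar>dotp d (A i) x\<bar> \<le> l2norm d (A i) * l2norm d x" by (rule dotp_le_l2norm)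
    also have "\<dots> \<le> l2norm d (A i)" using x by (simp add: mult_left_le)
    finally show "\<bar>dotp d (A i) x\<bar> \<le> l2norm d (A i)" .
  qed simp
  finally show "l2norm d (mat_vec d A x) \<le> L2_set (\<lambda>i. l2norm d (A i)) {..<d}" .
qed

lemma l2norm_mat_vec_le_op_norm: "l2norm d x \<le> 1 \<Longrightarrow> l2norm d (mat_vec d A x) \<le> op_norm d A"
  unfolding op_norm_def by (rule cSup_upper[OF _ bdd_above_op_norm]) auto

lemma op_norm_nonneg: "0 \<le> op_norm d A"
proof -
  have "l2norm d (mat_vec d A (\<lambda>_. 0)) \<le> op_norm d A"
    by (rule l2norm_mat_vec_le_op_norm) (simp add: l2norm_def L2_set_def)
  then show ?thesis using l2norm_nonneg order_trans by blast
qed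

lemma qform_le_op_norm:
  assumes "l2norm d x \<le> 1"
  shows "qform d A x \<le> op_norm d A"
proof -
  have "qform d A x \<le> l2norm d x * l2norm d (mat_vec d A x)"
    unfolding qform_def using dotp_le_l2norm abs_le_D1 by blast
  also have "\<dots> \<le> 1 * op_norm d A"
    using assms l2norm_mat_vec_le_op_norm[OF assms] by (intro mult_mono) auto
  finally show ?thesis by simp
qed

lemma sym_pos_def_imp_sym_psd: "sym_pos_def d A \<Longrightarrow> sym_psd d A"
  unfolding sym_psd_def
proof (intro conjI allI)
  fix x assume A: "sym_pos_def d A"
  show "0 \<le> qform d A x"
  proof (cases "\<exists>i<d. x i \<noteq> 0")
    case True
    then show ?thesis using A unfolding sym_pos_def_def qform_def dotp_def by (metis less_imp_le)
  next
    case False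
    then show ?thesis by (simp add: qform_def dotp_def)
  qed
qed (simp add: sym_pos_def_def)

lemma mat_trace_pos:
  assumes A: "sym_pos_def d A" and d: "d \<ge> 1"
  shows "0 < mat_trace d A"
  unfolding mat_trace_def
proof (rule sum_pos)
  fix i assume i: "i \<in> {..<d}"
  define y where "y = (\<lambda>j. if j = i then 1 else (0::real))"
  have "\<exists>i<d. y i \<noteq> 0" using i by (auto simp: y_def)
  then have "0 < dotp d y (mat_vec d A y)" using A by (simp add: sym_pos_def_def dotp_def)
  also have "\<dots> = mat_vec d A y i" using dotp_unit[of i d] i by (simp add: y_def)
  also have "\<dots> = A i i"
    using dotp_unit[of i d "A i"] i by (simp add: mat_vec_def y_def dotp_def mult.commute)
  finally show "0 < A i i" .
qed (use d in \<open>auto simp: lessThan_empty_iff bot_nat_def\<close>)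

context
  fixes d N :: nat and A :: "nat \<Rightarrow> nat \<Rightarrow> real" and a :: "nat \<Rightarrow> nat \<Rightarrow> real"
  assumes orth: "\<And>k l. k < N \<Longrightarrow> l < N \<Longrightarrow> k \<noteq> l \<Longrightarrow> dotp d (a k) (a l) = 0"
    and dec: "\<And>i j. i < d \<Longrightarrow> j < d \<Longrightarrow> A i j = (\<Sum>k<N. a k i * a k j)"
begin

lemma mat_trace_decomposition: "mat_trace d A = (\<Sum>k<N. dotp d (a k) (a k))"
  using dec by (simp add: mat_trace_def dotp_def sum.swap[of _ "{..<d}" "{..<N}"])

lemma mat_vec_decomposition:
  assumes "i < d" shows "mat_vec d A x i = (\<Sum>k<N. dotp d (a k) x * a k i)"
proof -
  have "mat_vec d A x i = (\<Sum>j<d. \<Sum>k<N. a k i * a k j * x j)"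
    using dec assms by (simp add: mat_vec_def sum_distrib_right)
  also have "\<dots> = (\<Sum>k<N. \<Sum>j<d. a k i * a k j * x j)" by (rule sum.swap)
  also have "\<dots> = (\<Sum>k<N. a k i * dotp d (a k) x)"
    by (simp add: dotp_def sum_distrib_left mult.assoc)
  finally show ?thesis by (simp add: mult.commute)
qed

lemma dotp_orthogonal_sum:
  assumes K: "K \<subseteq> {..<N}"
  shows "dotp d (\<lambda>i. \<Sum>k\<in>K. c k * a k i) (\<lambda>i. \<Sum>k\<in>K. c k * a k i) = (\<Sum>k\<in>K. (c k)\<^sup>2 * dotp d (a k) (a k))"
proof -
  have fin: "finite K" using K finite_subset by blast
  have "(\<Sum>l\<in>K. c k * (c l * dotp d (a k) (a l))) = (\<Sum>l\<in>K. if l = k then (c k)\<^sup>2 * dotp d (a k) (a k) else 0)"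
    if "k \<in> K" for k
    using that K orth by (intro sum.cong) (auto simp: power2_eq_square subset_iff)
  then show ?thesis
    using fin by (simp add: dotp_sum_left dotp_sum_right dotp_scale_left dotp_scale_right sum_distrib_left
        cong: sum.cong)
qed

text \<open>With \<open>u\<close> the norm of the image of \<open>x\<close>, orthogonality gives
  that \<open>u\<^sup>2\<close> is at most \<open>max 0 L\<close> times the form at
  \<open>x\<close>, and the form is at most \<open>u\<close>; one factor \<open>u\<close> cancels.
  The maximum with 0 covers \<open>N = 0\<close>, where \<open>L\<close> is unconstrained.\<close>

lemma op_norm_le_decomposition:
  assumes L: "\<And>k. k < N \<Longrightarrow> dotp d (a k) (a k) \<le> L"
  shows "op_norm d A \<le> max 0 L"
  unfolding op_norm_def
proof (rule cSup_least)
  have "l2norm d (\<lambda>_. 0) \<le> 1" by (simp add: l2norm_def L2_set_def)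
  then show "{l2norm d (mat_vec d A x) |x. l2norm d x \<le> 1} \<noteq> {}" by blast
next
  fix y assume "y \<in> {l2norm d (mat_vec d A x) |x. l2norm d x \<le> 1}"
  then obtain x where y: "y = l2norm d (mat_vec d A x)" and x: "l2norm d x \<le> 1" by blast
  define u where "u = l2norm d (mat_vec d A x)"
  have "u\<^sup>2 = dotp d (\<lambda>i. \<Sum>k<N. dotp d (a k) x * a k i) (\<lambda>i. \<Sum>k<N. dotp d (a k) x * a k i)"
    unfolding u_def l2norm_sq by (rule dotp_cong) (simp_all add: mat_vec_decomposition)
  also have "\<dots> = (\<Sum>k<N. (dotp d (a k) x)\<^sup>2 * dotp d (a k) (a k))"
    by (rule dotp_orthogonal_sum) simp
  also have "\<dots> \<le> (\<Sum>k<N. (dotp d (a k) x)\<^sup>2 * max 0 L)"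
    using L by (intro sum_mono mult_left_mono) (auto simp: max.coboundedI2)
  also have "\<dots> = max 0 L * (\<Sum>k<N. (dotp d (a k) x)\<^sup>2)" by (simp add: sum_distrib_left mult.commute)
  also have "(\<Sum>k<N. (dotp d (a k) x)\<^sup>2) = qform d A x"
  proof -
    have "qform d A x = dotp d x (\<lambda>i. \<Sum>k<N. dotp d (a k) x * a k i)"
      unfolding qform_def by (rule dotp_cong) (simp_all add: mat_vec_decomposition)
    then show ?thesis by (simp add: dotp_sum_right dotp_scale_right power2_eq_square dotp_commute)
  qed
  also have "qform d A x \<le> l2norm d x * u"
    unfolding qform_def u_def using dotp_le_l2norm abs_le_D1 by blast
  also have "l2norm d x * u \<le> u" using x by (simp add: mult_left_le_one_le u_def)
  finally have "u * u \<le> max 0 L * u" by (simp add: power2_eq_square mult_left_mono)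
  moreover have "0 \<le> u" by (simp add: u_def)
  ultimately have "u \<le> max 0 L" by (cases "u = 0") (auto simp: mult_le_cancel_right)
  then show "y \<le> max 0 L" by (simp add: y u_def)
qed

end

text \<open>The squared lengths of the \<open>a k\<close> are the eigenvalues, and a positive trace
  ensures that there is a largest one. It supplies the coordinate whose sign is hidden in the two
  lower bounds that involve the operator norm.\<close>

lemma top_component_exists:
  fixes N :: nat
  assumes orth: "\<And>k l. k < N \<Longrightarrow> l < N \<Longrightarrow> k \<noteq> l \<Longrightarrow> dotp d (a k) (a l) = 0"
    and dec: "\<And>i j. i < d \<Longrightarrow> j < d \<Longrightarrow> A i j = (\<Sum>k<N. a k i * a k j)"
    and pos: "0 < mat_trace d A"
  obtains k where "k < N" "op_norm d A \<le> dotp d (a k) (a k)"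
proof -
  have "N \<noteq> 0" using pos mat_trace_decomposition[OF orth dec] by (cases N) auto
  define L where "L = Max ((\<lambda>k. dotp d (a k) (a k)) ` {..<N})"
  have "L \<in> (\<lambda>k. dotp d (a k) (a k)) ` {..<N}"
    unfolding L_def using \<open>N \<noteq> 0\<close> by (intro Max_in) auto
  then obtain k where k: "k < N" "L = dotp d (a k) (a k)" by auto
  have "op_norm d A \<le> max 0 L"
    using orth dec by (rule op_norm_le_decomposition) (auto simp: L_def)
  then show thesis using k that by (metis dotp_self_nonneg max.absorb2)
qed

section \<open>Measurability in the sample space, and how minimax quantiles are bounded from either
  side\<close>

lemma space_euclid: "space (euclid d) = ({..<d} \<rightarrow>\<^sub>E UNIV)"
  by (simp add: euclid_def space_PiM)

lemma measurable_euclid_component [measurable]: "i < d \<Longrightarrow> (\<lambda>x. x i) \<in> borel_measurable (euclid d)"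
  unfolding euclid_def by (rule measurable_component_singleton) simp

lemma measurable_dotp:
  assumes "\<And>i. i < d \<Longrightarrow> (\<lambda>x. f x i) \<in> borel_measurable M" "\<And>i. i < d \<Longrightarrow> (\<lambda>x. g x i) \<in> borel_measurable M"
  shows "(\<lambda>x. dotp d (f x) (g x)) \<in> borel_measurable M"
  unfolding dotp_def using assms by (intro borel_measurable_sum borel_measurable_times) auto

lemma measurable_sq_loss:
  assumes "h \<in> X \<rightarrow>\<^sub>M euclid d"
  shows "(\<lambda>x. sq_loss d (h x) \<theta>) \<in> borel_measurable X"
  unfolding sq_loss_eq
  by (intro measurable_dotp borel_measurable_diff measurable_compose[OF assms] measurable_euclid_component) auto

text \<open>A radius \<open>r < v\<close> is not admissible for the quantile, since the event of
  loss at most \<open>r\<close> lies inside the event of loss below \<open>v\<close>, which is too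
  unlikely.\<close>

lemma minimax_quantile_ge:
  assumes "\<And>h. h \<in> X \<rightarrow>\<^sub>M T \<Longrightarrow> \<exists>\<theta>\<in>space T. \<exists>P\<in>\<P> \<theta>. finite_measure P \<and>
      {x \<in> space X. L (h x) \<theta> < v} \<in> sets P \<and> measure P {x \<in> space X. L (h x) \<theta> < v} < 1 - \<delta>"
  shows "ennreal v \<le> minimax_quantile X T \<delta> \<P> L"
  unfolding minimax_quantile_def
proof (rule INF_greatest)
  fix h assume "h \<in> X \<rightarrow>\<^sub>M T"
  then obtain \<theta> P where *: "\<theta> \<in> space T" "P \<in> \<P> \<theta>" and P: "finite_measure P"
    "{x \<in> space X. L (h x) \<theta> < v} \<in> sets P" "measure P {x \<in> space X. L (h x) \<theta> < v} < 1 - \<delta>"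
    using assms by blast
  have "ennreal v \<le> Inf {ennreal r | r. 0 \<le> r \<and> measure P {x \<in> space X. L (h x) \<theta> \<le> r} \<ge> 1 - \<delta>}"
  proof (rule Inf_greatest, safe)
    fix r assume r: "0 \<le> r" "measure P {x \<in> space X. L (h x) \<theta> \<le> r} \<ge> 1 - \<delta>"
    have "v \<le> r"
    proof (rule ccontr)
      assume "\<not> v \<le> r"
      then have "measure P {x \<in> space X. L (h x) \<theta> \<le> r} \<le> measure P {x \<in> space X. L (h x) \<theta> < v}"
        by (intro finite_measure.finite_measure_mono[OF P(1) _ P(2)]) auto
      then show False using r P by linarith
    qed
    then show "ennreal v \<le> ennreal r" by (rule ennreal_leI)
  qed
  also have "\<dots> \<le> (SUP P \<in> \<P> \<theta>. Inf {ennreal r | r. 0 \<le> r \<and> measure P {x \<in> space X. L (h x) \<theta> \<le> r} \<ge> 1 - \<delta>})"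
    by (rule SUP_upper) (rule *)
  also have "\<dots> \<le> (SUP \<theta> \<in> space T. SUP P \<in> \<P> \<theta>. Inf {ennreal r | r. 0 \<le> r \<and> measure P {x \<in> space X. L (h x) \<theta> \<le> r} \<ge> 1 - \<delta>})"
    by (rule SUP_upper) (rule *)
  finally show "ennreal v \<le> \<dots>" .
qed

lemma minimax_quantile_le:
  assumes "h \<in> X \<rightarrow>\<^sub>M T" "0 \<le> v"
    and "\<And>\<theta> P. \<theta> \<in> space T \<Longrightarrow> P \<in> \<P> \<theta> \<Longrightarrow> 1 - \<delta> \<le> measure P {x \<in> space X. L (h x) \<theta> \<le> v}"
  shows "minimax_quantile X T \<delta> \<P> L \<le> ennreal v"
  unfolding minimax_quantile_def using assms
  by (intro INF_lower2[of h] SUP_least Inf_lower) auto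

text \<open>Allows the sample laws of the lower bounds to be studied on a discrete product space.
  The two measures agree on rectangles.\<close>

lemma PiM_distr_pmf:
  assumes f: "\<And>x. f x \<in> space M"
  shows "(\<Pi>\<^sub>M k\<in>{..<n::nat}. distr (measure_pmf H) M f) =
    distr (measure_pmf (Pi_pmf {..<n} dflt (\<lambda>_. H))) (\<Pi>\<^sub>M k\<in>{..<n}. M) (\<lambda>B. \<lambda>k\<in>{..<n}. f (B k))"
proof -
  let ?D = "distr (measure_pmf H) M f"
  let ?F = "\<lambda>B. \<lambda>k\<in>{..<n}. f (B k)"
  have fm: "f \<in> measure_pmf H \<rightarrow>\<^sub>M M" using f by auto
  interpret D: prob_space ?D by (rule measure_pmf.prob_space_distr[OF fm])
  interpret product_prob_space "\<lambda>_. ?D" "{..<n}" by standard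
  have Fm: "?F \<in> measure_pmf (Pi_pmf {..<n} dflt (\<lambda>_. H)) \<rightarrow>\<^sub>M (\<Pi>\<^sub>M k\<in>{..<n}. M)"
    using f by (auto simp: space_PiM)
  have s: "sets (\<Pi>\<^sub>M k\<in>{..<n}. M) = sets (\<Pi>\<^sub>M k\<in>{..<n}. ?D)" by (rule sets_PiM_cong) auto
  show ?thesis
  proof (rule PiM_eqI[symmetric])
    fix S assume S: "\<And>i. i \<in> {..<n} \<Longrightarrow> S i \<in> sets ?D"
    have SE: "Pi\<^sub>E {..<n} S \<in> sets (\<Pi>\<^sub>M k\<in>{..<n}. M)"
      using S by (intro sets_PiM_I_finite) auto
    have "emeasure (distr (measure_pmf (Pi_pmf {..<n} dflt (\<lambda>_. H))) (\<Pi>\<^sub>M k\<in>{..<n}. M) ?F) (Pi\<^sub>E {..<n} S)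
        = emeasure (measure_pmf (Pi_pmf {..<n} dflt (\<lambda>_. H))) (Pi {..<n} (\<lambda>k. f -` S k))"
      by (subst emeasure_distr[OF Fm SE]) (auto intro!: arg_cong[where f="emeasure _"])
    also have "\<dots> = ennreal (\<Prod>k<n. measure_pmf.prob H (f -` S k))"
      by (simp add: measure_pmf.emeasure_eq_measure measure_Pi_pmf_Pi)
    also have "\<dots> = (\<Prod>k<n. emeasure ?D (S k))"
      using S fm by (subst prod_ennreal[symmetric])
        (auto simp: measure_pmf.emeasure_eq_measure emeasure_distr intro!: prod.cong)
    finally show "emeasure (distr (measure_pmf (Pi_pmf {..<n} dflt (\<lambda>_. H))) (\<Pi>\<^sub>M k\<in>{..<n}. M) ?F) (Pi\<^sub>E {..<n} S)
        = (\<Prod>k\<in>{..<n}. emeasure ?D (S k))" .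
  qed (use s in auto)
qed

section \<open>Lower bounds from sparse models\<close>

text \<open>The restriction to \<open>{..<d}\<close> makes the combination a point of
  \<open>space (euclid d)\<close>.\<close>

definition lincomb :: "nat \<Rightarrow> nat \<Rightarrow> (nat \<Rightarrow> nat \<Rightarrow> real) \<Rightarrow> (nat \<Rightarrow> real) \<Rightarrow> nat \<Rightarrow> real" where
  "lincomb d N a w = (\<lambda>i\<in>{..<d}. \<Sum>k<N. w k * a k i)"

lemma lincomb_in_space [simp]: "lincomb d N a w \<in> space (euclid d)"
  by (auto simp: lincomb_def space_euclid)

lemma measurable_lincomb_pmf: "(\<lambda>x. lincomb d N a (g x)) \<in> measure_pmf H \<rightarrow>\<^sub>M euclid d"
  by auto

lemma distr_pmf_in_prob_measures:
  "f \<in> measure_pmf H \<rightarrow>\<^sub>M euclid d \<Longrightarrow> distr (measure_pmf H) (euclid d) f \<in> prob_measures d"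
  by (auto simp: prob_measures_def space_prob_algebra measure_pmf.prob_space_distr)

lemma finite_set_Pi_pmf:
  assumes "finite I" "\<And>i. i \<in> I \<Longrightarrow> finite (set_pmf (q i))"
  shows "finite (set_pmf (Pi_pmf I dflt q))"
  using assms by (simp add: set_Pi_pmf finite_PiE_dflt)

lemma expectation_Pi_pmf_component:
  fixes f :: "'b \<Rightarrow> real"
  assumes "finite I" "k \<in> I"
  shows "measure_pmf.expectation (Pi_pmf I dflt q) (\<lambda>b. f (b k)) = measure_pmf.expectation (q k) f"
  using assms integral_map_pmf[of "\<lambda>b. b k" "Pi_pmf I dflt q" f] by (simp add: Pi_pmf_component)

lemma expectation_Pi_pmf_mult:
  fixes f g :: "'b \<Rightarrow> real"
  assumes I: "finite I" "k \<in> I" "l \<in> I" "k \<noteq> l" and fin: "\<And>i. i \<in> I \<Longrightarrow> finite (set_pmf (q i))"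
  shows "measure_pmf.expectation (Pi_pmf I dflt q) (\<lambda>b. f (b k) * g (b l)) =
    measure_pmf.expectation (q k) f * measure_pmf.expectation (q l) g"
proof -
  let ?M = "Pi_pmf I dflt q"
  define X where "X = (\<lambda>i (b :: 'a \<Rightarrow> 'b). if i = k then f (b i) else g (b i))"
  have "prob_space.indep_vars (measure_pmf ?M) (\<lambda>_. count_space UNIV) (\<lambda>i b. b i) {k, l}"
    by (rule prob_space.indep_vars_subset[OF measure_pmf.prob_space_axioms indep_vars_Pi_pmf[OF I(1)]]) (use I in auto)
  then have ind: "prob_space.indep_vars (measure_pmf ?M) (\<lambda>_. borel) X {k, l}"
    unfolding X_def by (rule prob_space.indep_vars_compose2[OF measure_pmf.prob_space_axioms]) simp
  have "integrable ?M (X i)" for i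
    by (rule integrable_measure_pmf_finite finite_set_Pi_pmf)+ (use I fin in auto)
  then have "measure_pmf.expectation ?M (\<lambda>b. \<Prod>i\<in>{k, l}. X i b) = (\<Prod>i\<in>{k, l}. measure_pmf.expectation ?M (X i))"
    by (intro prob_space.indep_vars_lebesgue_integral[OF measure_pmf.prob_space_axioms] ind) auto
  moreover have "measure_pmf.expectation ?M (X k) = measure_pmf.expectation (q k) f"
    "measure_pmf.expectation ?M (X l) = measure_pmf.expectation (q l) g"
    using I expectation_Pi_pmf_component[OF I(1,2), of dflt q f] expectation_Pi_pmf_component[OF I(1,3), of dflt q g]
    by (auto simp: X_def)
  ultimately show ?thesis using I by (simp add: X_def)
qed

text \<open>Coefficients that are independent with variance 1 have the identity as covariance, so
  the covariance of the combination is the sum of the rank-one matrices of the \<open>a k\<close>,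
  which is \<open>A\<close>.\<close>

lemma has_mean_cov_lincomb:
  fixes q :: "nat \<Rightarrow> 'b pmf" and g :: "nat \<Rightarrow> 'b \<Rightarrow> real"
  assumes fin: "\<And>k. k < N \<Longrightarrow> finite (set_pmf (q k))"
    and m: "\<And>k. k < N \<Longrightarrow> measure_pmf.expectation (q k) (g k) = m k"
    and var: "\<And>k. k < N \<Longrightarrow> measure_pmf.expectation (q k) (\<lambda>x. (g k x - m k)\<^sup>2) = 1"
    and dec: "\<And>i j. i < d \<Longrightarrow> j < d \<Longrightarrow> A i j = (\<Sum>k<N. a k i * a k j)"
    and P: "P = distr (measure_pmf (Pi_pmf {..<N} dflt q)) (euclid d) (\<lambda>b. lincomb d N a (\<lambda>k. g k (b k)))"
  shows "has_mean d P (lincomb d N a m)" "has_cov d P A"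
proof -
  let ?H = "Pi_pmf {..<N} dflt q"
  let ?X = "\<lambda>b. lincomb d N a (\<lambda>k. g k (b k))"
  note meas = measurable_lincomb_pmf[of d N a "\<lambda>b k. g k (b k)" ?H]
  have int: "integrable ?H f" for f :: "(nat \<Rightarrow> 'b) \<Rightarrow> real"
    by (rule integrable_measure_pmf_finite finite_set_Pi_pmf)+ (use fin in auto)
  have intq: "integrable (q k) f" if "k < N" for f :: "'b \<Rightarrow> real" and k
    by (rule integrable_measure_pmf_finite) (use fin that in auto)
  have intP: "integrable P f" if "f \<in> borel_measurable (euclid d)" for f :: "_ \<Rightarrow> real"
    unfolding P using int by (subst integrable_distr_eq[OF meas that])
  have EP: "(\<integral>x. f x \<partial>P) = (\<integral>b. f (?X b) \<partial>?H)" if "f \<in> borel_measurable (euclid d)" for f :: "_ \<Rightarrow> real"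
    unfolding P using int by (subst integral_distr[OF meas that]) simp
  have mean: "(\<integral>x. x i \<partial>P) = lincomb d N a m i" if i: "i < d" for i
  proof -
    have "(\<integral>x. x i \<partial>P) = (\<integral>b. (\<Sum>k<N. g k (b k) * a k i) \<partial>?H)"
      using i by (subst EP) (auto simp: lincomb_def)
    also have "\<dots> = (\<Sum>k<N. (\<integral>b. g k (b k) \<partial>?H) * a k i)"
      by (subst Bochner_Integration.integral_sum) (auto intro: int)
    also have "\<dots> = (\<Sum>k<N. m k * a k i)"
      by (intro sum.cong refl) (simp add: expectation_Pi_pmf_component m)
    finally show ?thesis using i by (simp add: lincomb_def)
  qed
  then show mn: "has_mean d P (lincomb d N a m)"
    unfolding has_mean_def by (auto intro!: intP)
  have cc: "(\<integral>b. (g k (b k) - m k) * (g l (b l) - m l) \<partial>?H) = (if k = l then 1 else 0)"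
    if kl: "k < N" "l < N" for k l
  proof (cases "k = l")
    case True
    then show ?thesis
      using expectation_Pi_pmf_component[of "{..<N}" k dflt q "\<lambda>x. (g k x - m k)\<^sup>2"] var kl
      by (simp add: power2_eq_square)
  next
    case False
    have "(\<integral>b. (g k (b k) - m k) * (g l (b l) - m l) \<partial>?H)
        = measure_pmf.expectation (q k) (\<lambda>x. g k x - m k) * measure_pmf.expectation (q l) (\<lambda>x. g l x - m l)"
      using kl False fin by (intro expectation_Pi_pmf_mult) auto
    also have "measure_pmf.expectation (q k) (\<lambda>x. g k x - m k) = 0"
      using kl m intq by (simp add: Bochner_Integration.integral_diff)
    finally show ?thesis using False by simp
  qed
  have "(\<integral>x. (x i - lincomb d N a m i) * (x j - lincomb d N a m j) \<partial>P) = A i j" if ij: "i < d" "j < d" for i j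
  proof -
    have "(\<integral>x. (x i - lincomb d N a m i) * (x j - lincomb d N a m j) \<partial>P)
       = (\<integral>b. (\<Sum>k<N. \<Sum>l<N. (g k (b k) - m k) * (g l (b l) - m l) * (a k i * a l j)) \<partial>?H)"
      using ij by (subst EP) (auto simp: lincomb_def sum_subtractf[symmetric] left_diff_distrib[symmetric] sum_product
          intro!: Bochner_Integration.integral_cong sum.cong)
    also have "\<dots> = (\<Sum>k<N. \<Sum>l<N. (\<integral>b. (g k (b k) - m k) * (g l (b l) - m l) \<partial>?H) * (a k i * a l j))"
      by (simp add: Bochner_Integration.integral_sum int)
    also have "\<dots> = (\<Sum>k<N. \<Sum>l<N. if l = k then a k i * a k j else 0)"
      by (intro sum.cong refl) (simp add: cc)
    also have "\<dots> = A i j" using dec[OF ij] by simp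
    finally show ?thesis .
  qed
  then show "has_cov d P A"
    unfolding has_cov_def using mn
    by (intro exI[of _ "lincomb d N a m"]) (auto intro!: intP borel_measurable_times borel_measurable_diff)
qed

lemma contaminated_family_mixtureI:
  assumes "R \<in> prob_measures d" "P \<in> prob_measures d" "Q \<in> prob_measures d"
    "is_mixture \<epsilon> R P Q" "has_mean d P \<theta>" "has_cov d P \<Sigma>"
  shows "(\<Pi>\<^sub>M k\<in>{..<n}. R) \<in> contaminated_family n d \<epsilon> \<Sigma> \<theta>"
  unfolding contaminated_family_def using assms by blast

text \<open>Contaminating \<open>P\<close> with \<open>Q = P\<close> changes nothing, whatever
  \<epsilon> is.\<close>

lemma contaminated_family_pureI:
  assumes "P \<in> prob_measures d" "has_mean d P \<theta>" "has_cov d P \<Sigma>"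
  shows "(\<Pi>\<^sub>M k\<in>{..<n}. P) \<in> contaminated_family n d \<epsilon> \<Sigma> \<theta>"
  by (rule contaminated_family_mixtureI[of P d P P]) (use assms in \<open>auto simp: is_mixture_def algebra_simps\<close>)

text \<open>Used for two centres \<open>x\<close> and \<open>x'\<close> at squared distance at least
  \<open>4 * v\<close>: no estimate \<open>y\<close> can have loss below \<open>v\<close> for
  both.\<close>

lemma sq_loss_parallelogram: "sq_loss d x x' \<le> 2 * (sq_loss d y x + sq_loss d y x')"
proof -
  have "(x i - x' i) * (x i - x' i) \<le> 2 * ((y i - x i) * (y i - x i) + (y i - x' i) * (y i - x' i))" for i
    using zero_le_square[of "(y i - x i) + (y i - x' i)"] by (simp add: algebra_simps)
  then show ?thesis
    unfolding sq_loss_eq dotp_def by (simp add: sum_distrib_left sum.distrib[symmetric] sum_mono)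
qed

text \<open>A sign pattern is encoded by the set \<tau> of its positive coordinates, so that the
  symmetric difference with \<open>S\<close> flips exactly the signs in \<open>S\<close>.\<close>

abbreviation sgn_mem :: "nat \<Rightarrow> nat set \<Rightarrow> real" where
  "sgn_mem k \<tau> \<equiv> (if k \<in> \<tau> then 1 else - 1)"

text \<open>The sample is linear in independent coordinates that are zero with probability \<open>1 - p\<close>, so the
  sign of a coordinate's mean cannot be seen from a sample in which that coordinate is never active.\<close>

locale sparse_model =
  fixes d N n :: nat and A a :: "nat \<Rightarrow> nat \<Rightarrow> real" and p s :: real
  assumes orth: "\<And>k l. k < N \<Longrightarrow> l < N \<Longrightarrow> k \<noteq> l \<Longrightarrow> dotp d (a k) (a l) = 0"
    and dec: "\<And>i j. i < d \<Longrightarrow> j < d \<Longrightarrow> A i j = (\<Sum>k<N. a k i * a k j)"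
    and p: "0 < p" "p < 1"
    and s: "s = 1 / sqrt (p * (1 - p))"
begin

definition center :: "nat set \<Rightarrow> nat \<Rightarrow> real" where
  "center \<tau> = lincomb d N a (\<lambda>k. sgn_mem k \<tau> * (s * p))"

definition active :: "(nat \<Rightarrow> bool) pmf" where
  "active = Pi_pmf {..<N} False (\<lambda>_. bernoulli_pmf p)"

definition point :: "nat set \<Rightarrow> (nat \<Rightarrow> bool) \<Rightarrow> nat \<Rightarrow> real" where
  "point \<tau> b = lincomb d N a (\<lambda>k. if b k then sgn_mem k \<tau> * s else 0)"

text \<open>The law of the activity patterns does not involve \<tau>. It couples the samples of all
  sign patterns: each is a deterministic function of the same pattern.\<close>

definition actives :: "(nat \<Rightarrow> nat \<Rightarrow> bool) pmf" where
  "actives = Pi_pmf {..<n} (\<lambda>_. False) (\<lambda>_. active)"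

definition sample :: "nat set \<Rightarrow> (nat \<Rightarrow> nat \<Rightarrow> bool) \<Rightarrow> nat \<Rightarrow> nat \<Rightarrow> real" where
  "sample \<tau> B = (\<lambda>j\<in>{..<n}. point \<tau> (B j))"

definition law :: "nat set \<Rightarrow> (nat \<Rightarrow> nat \<Rightarrow> real) measure" where
  "law \<tau> = (\<Pi>\<^sub>M k\<in>{..<n}. distr (measure_pmf active) (euclid d) (point \<tau>))"

lemma center_space: "center \<tau> \<in> space (euclid d)"
  by (simp add: center_def)

lemma s_sq: "s\<^sup>2 * (p * (1 - p)) = 1"
  using p by (simp add: s power_divide)

lemma sp_sq_eq: "(s * p)\<^sup>2 = p / (1 - p)"
  using p by (simp add: s power_mult_distrib power_divide power2_eq_square)

lemma sp_sq: "p \<le> (s * p)\<^sup>2"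
  unfolding sp_sq_eq using p by (simp add: le_divide_eq mult_left_le)

lemma two_point_variance:
  "((sgn_mem k \<tau> * s - sgn_mem k \<tau> * (s * p))\<^sup>2) * p + ((0 - sgn_mem k \<tau> * (s * p))\<^sup>2) * (1 - p) = 1"
  using s_sq by (auto simp: power2_eq_square algebra_simps)

lemma law_in_family: "law \<tau> \<in> contaminated_family n d \<epsilon> A (center \<tau>)"
proof -
  define P where "P = distr (measure_pmf active) (euclid d) (point \<tau>)"
  have "has_mean d P (center \<tau>)" "has_cov d P A"
    unfolding center_def
    by (rule has_mean_cov_lincomb[of N "\<lambda>_. bernoulli_pmf p" "\<lambda>k b. if b then sgn_mem k \<tau> * s else 0"
          "\<lambda>k. sgn_mem k \<tau> * (s * p)" d A a P False];
        use p dec two_point_variance in \<open>auto simp: P_def active_def point_def[abs_def] power2_eq_square\<close>)+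
  then show ?thesis
    unfolding law_def using distr_pmf_in_prob_measures[of "point \<tau>" active d]
    by (intro contaminated_family_pureI) (auto simp: P_def point_def)
qed

lemma law_eq: "law \<tau> = distr (measure_pmf actives) (\<Pi>\<^sub>M k\<in>{..<n}. euclid d) (sample \<tau>)"
  unfolding law_def actives_def sample_def by (rule PiM_distr_pmf) (simp add: point_def)

lemma sample_space: "sample \<tau> B \<in> space (\<Pi>\<^sub>M k\<in>{..<n}. euclid d)"
  by (auto simp: sample_def space_PiM point_def)

lemma finite_actives: "finite (set_pmf actives)"
  unfolding actives_def active_def by (intro finite_set_Pi_pmf) auto

lemma integrable_actives: "integrable (measure_pmf actives) (f :: _ \<Rightarrow> real)"
  by (rule integrable_measure_pmf_finite[OF finite_actives])

lemma prob_space_law: "prob_space (law \<tau>)"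
  unfolding law_eq using sample_space by (intro measure_pmf.prob_space_distr) auto

lemma law_event:
  assumes h: "h \<in> (\<Pi>\<^sub>M k\<in>{..<n}. euclid d) \<rightarrow>\<^sub>M euclid d"
  shows "{x \<in> space (\<Pi>\<^sub>M k\<in>{..<n}. euclid d). sq_loss d (h x) \<theta> < v} \<in> sets (law \<tau>)"
    and "measure (law \<tau>) {x \<in> space (\<Pi>\<^sub>M k\<in>{..<n}. euclid d). sq_loss d (h x) \<theta> < v}
      = 1 - measure_pmf.prob actives {B. v \<le> sq_loss d (h (sample \<tau> B)) \<theta>}"
proof -
  let ?E = "{x \<in> space (\<Pi>\<^sub>M k\<in>{..<n}. euclid d). sq_loss d (h x) \<theta> < v}"
  have E: "?E \<in> sets (\<Pi>\<^sub>M k\<in>{..<n}. euclid d)"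
    using measurable_sq_loss[OF h, of \<theta>] by measurable
  then show "?E \<in> sets (law \<tau>)" by (simp add: law_eq)
  have "measure (law \<tau>) ?E = measure_pmf.prob actives (sample \<tau> -` ?E)"
    unfolding law_eq using sample_space E by (subst measure_distr) auto
  also have "sample \<tau> -` ?E = UNIV - {B. v \<le> sq_loss d (h (sample \<tau> B)) \<theta>}"
    using sample_space by auto
  also have "measure_pmf.prob actives \<dots> = 1 - measure_pmf.prob actives {B. v \<le> sq_loss d (h (sample \<tau> B)) \<theta>}"
    using measure_pmf.prob_compl[of "{B. v \<le> sq_loss d (h (sample \<tau> B)) \<theta>}" actives] by simp
  finally show "measure (law \<tau>) ?E = \<dots>" .
qed

lemma sq_loss_flip:
  assumes S: "S \<subseteq> {..<N}"
  shows "sq_loss d (center \<tau>) (center (sym_diff \<tau> S)) = 4 * (s * p)\<^sup>2 * (\<Sum>k\<in>S. dotp d (a k) (a k))"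
proof -
  let ?c = "\<lambda>k. 2 * sgn_mem k \<tau> * (s * p)"
  have "center \<tau> i - center (sym_diff \<tau> S) i = (\<Sum>k\<in>S. ?c k * a k i)" if "i < d" for i
  proof -
    have "center \<tau> i - center (sym_diff \<tau> S) i = (\<Sum>k<N. if k \<in> S then ?c k * a k i else 0)"
      using that by (auto simp: center_def lincomb_def sum_subtractf[symmetric] intro!: sum.cong)
    also have "\<dots> = (\<Sum>k\<in>S. ?c k * a k i)"
      using S by (subst sum.inter_restrict[symmetric]) (auto simp: Int_absorb1)
    finally show ?thesis .
  qed
  then have "sq_loss d (center \<tau>) (center (sym_diff \<tau> S))
     = dotp d (\<lambda>i. \<Sum>k\<in>S. ?c k * a k i) (\<lambda>i. \<Sum>k\<in>S. ?c k * a k i)"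
    unfolding sq_loss_eq by (intro dotp_cong) auto
  also have "\<dots> = (\<Sum>k\<in>S. (?c k)\<^sup>2 * dotp d (a k) (a k))"
    by (rule dotp_orthogonal_sum[OF orth dec S])
  also have "\<dots> = (\<Sum>k\<in>S. 4 * (s * p)\<^sup>2 * dotp d (a k) (a k))"
    by (intro sum.cong refl) (auto simp: power_mult_distrib)
  finally show ?thesis by (simp add: sum_distrib_left)
qed

lemma sample_flip:
  assumes "\<And>k j. k \<in> S \<Longrightarrow> j < n \<Longrightarrow> \<not> B j k"
  shows "sample (sym_diff \<tau> S) B = sample \<tau> B"
  unfolding sample_def point_def lincomb_def using assms
  by (intro restrict_ext sum.cong refl) auto

text \<open>The flip of signs that were never active leaves the sample, hence the estimate,
  unchanged, but moves the centre by a squared distance of at least \<open>4 * v\<close>. The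
  estimate is therefore bad for one of the two sign patterns.\<close>

lemma flip_loss:
  assumes S: "S \<subseteq> {..<N}" "\<And>k j. k \<in> S \<Longrightarrow> j < n \<Longrightarrow> \<not> B j k"
    and v: "v \<le> p * (\<Sum>k\<in>S. dotp d (a k) (a k))"
  shows "v \<le> sq_loss d (h (sample \<tau> B)) (center \<tau>) \<or>
    v \<le> sq_loss d (h (sample (sym_diff \<tau> S) B)) (center (sym_diff \<tau> S))"
proof -
  let ?w = "\<Sum>k\<in>S. dotp d (a k) (a k)"
  have "v \<le> (s * p)\<^sup>2 * ?w"
    using v mult_right_mono[OF sp_sq, of ?w] by (simp add: sum_nonneg)
  then have "4 * v \<le> sq_loss d (center \<tau>) (center (sym_diff \<tau> S))"
    by (simp add: sq_loss_flip[OF S(1)])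
  also have "\<dots> \<le> 2 * (sq_loss d (h (sample \<tau> B)) (center \<tau>) + sq_loss d (h (sample \<tau> B)) (center (sym_diff \<tau> S)))"
    by (rule sq_loss_parallelogram)
  finally show ?thesis using sample_flip[of S B \<tau>] S(2) by (simp, linarith)
qed

lemma prob_active: "j < n \<Longrightarrow> k < N \<Longrightarrow> measure_pmf.prob actives {B. B j k} = p"
proof -
  assume jk: "j < n" "k < N"
  have "map_pmf (\<lambda>B. B j k) actives = map_pmf (\<lambda>b. b k) (map_pmf (\<lambda>B. B j) actives)"
    by (simp add: pmf.map_comp o_def)
  also have "\<dots> = bernoulli_pmf p"
    using jk by (simp add: actives_def active_def Pi_pmf_component)
  finally have "measure_pmf.prob (map_pmf (\<lambda>B. B j k) actives) {True} = p"
    using p by (simp add: measure_pmf_single)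
  then show ?thesis by (simp add: vimage_def)
qed

lemma prob_inactive: "k < N \<Longrightarrow> measure_pmf.prob actives {B. \<forall>j<n. \<not> B j k} = (1 - p) ^ n"
proof -
  assume k: "k < N"
  have "map_pmf (\<lambda>b. b k) active = bernoulli_pmf p"
    using k by (simp add: active_def Pi_pmf_component)
  then have "measure_pmf.prob (map_pmf (\<lambda>b. b k) active) {False} = 1 - p"
    using p by (simp add: measure_pmf_single)
  then have *: "measure_pmf.prob active {b. \<not> b k} = 1 - p" by (simp add: vimage_def)
  have "{B. \<forall>j<n. \<not> B j k} = Pi {..<n} (\<lambda>_. {b. \<not> b k})" by auto
  then show ?thesis using * by (simp add: actives_def measure_Pi_pmf_Pi)
qed

text \<open>Only the sign patterns \<open>{}\<close> and \<open>{k}\<close> are compared. Coordinate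
  \<open>k\<close> is never active with probability \<open>(1 - p) ^ n\<close>, and then one of the
  two fails, so one of them fails with at least half of that probability.\<close>

lemma top_lower_bound:
  assumes h: "h \<in> (\<Pi>\<^sub>M k\<in>{..<n}. euclid d) \<rightarrow>\<^sub>M euclid d"
    and k: "k < N" and v: "v \<le> p * dotp d (a k) (a k)" and \<delta>: "2 * \<delta> < (1 - p) ^ n"
  shows "\<exists>\<tau>. measure (law \<tau>) {x \<in> space (\<Pi>\<^sub>M k\<in>{..<n}. euclid d). sq_loss d (h x) (center \<tau>) < v} < 1 - \<delta>"
proof -
  define bad where "bad = (\<lambda>\<tau>. {B. v \<le> sq_loss d (h (sample \<tau> B)) (center \<tau>)})"
  have "{B. \<forall>j<n. \<not> B j k} \<subseteq> bad {} \<union> bad {k}"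
    using flip_loss[of "{k}" _ v h "{}"] k v by (auto simp: bad_def)
  then have "(1 - p) ^ n \<le> measure_pmf.prob actives (bad {} \<union> bad {k})"
    unfolding prob_inactive[OF k, symmetric] by (intro measure_pmf.finite_measure_mono) auto
  also have "\<dots> \<le> measure_pmf.prob actives (bad {}) + measure_pmf.prob actives (bad {k})"
    by (rule measure_Un_le) auto
  finally have "\<delta> < measure_pmf.prob actives (bad {}) \<or> \<delta> < measure_pmf.prob actives (bad {k})"
    using \<delta> by linarith
  then obtain \<tau> where "\<delta> < measure_pmf.prob actives (bad \<tau>)" by blast
  then have "measure (law \<tau>) {x \<in> space (\<Pi>\<^sub>M k\<in>{..<n}. euclid d). sq_loss d (h x) (center \<tau>) < v} < 1 - \<delta>"
    unfolding law_event(2)[OF h] bad_def by linarith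
  then show ?thesis ..
qed

text \<open>Average over all \<open>2 ^ N\<close> sign patterns. For a fixed activity pattern,
  flipping the set \<open>S\<close> of unseen coordinates pairs up the sign patterns; if
  \<open>S\<close> carries half of the trace, one member of each pair fails. The seen coordinates
  carry at most an eighth of the trace in the mean, so the average failure probability is at least
  \<open>1 / 2 * (1 - 2 / 8) = 3 / 8\<close>.\<close>

lemma trace_lower_bound:
  assumes h: "h \<in> (\<Pi>\<^sub>M k\<in>{..<n}. euclid d) \<rightarrow>\<^sub>M euclid d"
    and v: "v \<le> p * mat_trace d A / 2" and np: "real n * p \<le> 1 / 8" and tr: "0 < mat_trace d A"
  shows "\<exists>\<tau>. measure (law \<tau>) {x \<in> space (\<Pi>\<^sub>M k\<in>{..<n}. euclid d). sq_loss d (h x) (center \<tau>) < v} < 3 / 4"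
proof -
  define bad where "bad = (\<lambda>\<tau>. {B. v \<le> sq_loss d (h (sample \<tau> B)) (center \<tau>)})"
  define w where "w = (\<lambda>k. dotp d (a k) (a k))"
  define T where "T = mat_trace d A"
  define W where "W = (\<lambda>B. \<Sum>k<N. w k * indicator {B. \<exists>j<n. B j k} (B :: nat \<Rightarrow> nat \<Rightarrow> bool))"
  have T: "T = (\<Sum>k<N. w k)" unfolding T_def w_def by (rule mat_trace_decomposition[OF orth dec])
  \<comment> \<open>The left side is affine in the seen weight \<open>W B\<close> and not positive
    once that weight exceeds half of the trace. The bound thus holds in both cases, and taking
    expectations only needs the mean of \<open>W\<close>.\<close>
  have count: "2 ^ N / 2 * (1 - 2 * W B / T) \<le> (\<Sum>\<tau>\<in>Pow {..<N}. indicator (bad \<tau>) B)" for B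
  proof (cases "W B \<le> T / 2")
    case True
    define S where "S = {k\<in>{..<N}. \<forall>j<n. \<not> B j k}"
    have "W B + (\<Sum>k\<in>S. w k) = T"
    proof -
      have "(\<Sum>k\<in>S. w k) = (\<Sum>k<N. if \<forall>j<n. \<not> B j k then w k else 0)"
        unfolding S_def by (rule sum.inter_filter) simp
      then have "W B + (\<Sum>k\<in>S. w k) = (\<Sum>k<N. w k * indicator {B. \<exists>j<n. B j k} B + (if \<forall>j<n. \<not> B j k then w k else 0))"
        unfolding W_def by (simp only: sum.distrib)
      also have "\<dots> = T" unfolding T by (intro sum.cong refl) (auto simp: indicator_def)
      finally show ?thesis .
    qed
    then have "T / 2 \<le> (\<Sum>k\<in>S. w k)" using True by linarith
    then have vS: "v \<le> p * (\<Sum>k\<in>S. dotp d (a k) (a k))"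
    proof -
      have "v \<le> p * (T / 2)" using v by (simp add: T_def)
      also have "\<dots> \<le> p * (\<Sum>k\<in>S. w k)" using \<open>T / 2 \<le> _\<close> p by (intro mult_left_mono) auto
      finally show ?thesis by (simp add: w_def)
    qed
    have "B \<in> bad \<tau> \<or> B \<in> bad (sym_diff \<tau> S)" for \<tau>
      unfolding bad_def mem_Collect_eq by (rule flip_loss[OF _ _ vS]) (auto simp: S_def)
    then have "(\<Sum>\<tau>\<in>Pow {..<N}. 1) \<le> (\<Sum>\<tau>\<in>Pow {..<N}. indicator (bad \<tau>) B + indicator (bad (sym_diff \<tau> S)) B :: real)"
      by (intro sum_mono) (auto simp: indicator_def)
    also have "\<dots> = (\<Sum>\<tau>\<in>Pow {..<N}. indicator (bad \<tau>) B) + (\<Sum>\<tau>\<in>Pow {..<N}. indicator (bad (sym_diff \<tau> S)) B)"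
      by (rule sum.distrib)
    also have "(\<Sum>\<tau>\<in>Pow {..<N}. indicator (bad (sym_diff \<tau> S)) B) = (\<Sum>\<tau>\<in>Pow {..<N}. indicator (bad \<tau>) B :: real)"
      by (rule sum.reindex_bij_witness[of _ "\<lambda>\<tau>. sym_diff \<tau> S" "\<lambda>\<tau>. sym_diff \<tau> S"]) (auto simp: S_def)
    finally have "2 ^ N \<le> 2 * (\<Sum>\<tau>\<in>Pow {..<N}. indicator (bad \<tau>) B :: real)"
      by (simp add: card_Pow)
    moreover have "2 ^ N / 2 * (1 - 2 * W B / T) \<le> 2 ^ N / 2 * (1 :: real)"
      using tr by (intro mult_left_mono) (auto simp: T_def W_def w_def intro!: divide_nonneg_nonneg sum_nonneg mult_nonneg_nonneg)
    ultimately show ?thesis by linarith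
  next
    case False
    then have "1 - 2 * W B / T \<le> 0" using tr by (simp add: T_def field_simps)
    then have "2 ^ N / 2 * (1 - 2 * W B / T) \<le> 0" by (intro mult_nonneg_nonpos) auto
    also have "0 \<le> (\<Sum>\<tau>\<in>Pow {..<N}. indicator (bad \<tau>) B :: real)" by (intro sum_nonneg) auto
    finally show ?thesis .
  qed
  have EW: "measure_pmf.expectation actives W \<le> T / 8"
  proof -
    have "measure_pmf.expectation actives W = (\<Sum>k<N. w k * measure_pmf.prob actives {B. \<exists>j<n. B j k})"
    proof -
      have "measure_pmf.expectation actives W = (\<Sum>k<N. measure_pmf.expectation actives (\<lambda>B. w k * indicator {B. \<exists>j<n. B j k} B))"
        unfolding W_def by (rule Bochner_Integration.integral_sum) (rule integrable_actives)
      then show ?thesis by simp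
    qed
    also have "\<dots> \<le> (\<Sum>k<N. w k * (1 / 8))"
    proof (intro sum_mono mult_left_mono)
      fix k assume k: "k \<in> {..<N}"
      have "measure_pmf.prob actives {B. \<exists>j<n. B j k} = measure_pmf.prob actives (\<Union>j<n. {B. B j k})"
        by (rule arg_cong[where f="measure_pmf.prob actives"]) auto
      also have "\<dots> \<le> (\<Sum>j<n. measure_pmf.prob actives {B. B j k})"
        by (rule measure_pmf.finite_measure_subadditive_finite) auto
      also have "\<dots> = real n * p" using k by (simp add: prob_active)
      finally show "measure_pmf.prob actives {B. \<exists>j<n. B j k} \<le> 1 / 8" using np by linarith
    qed (simp add: w_def)
    finally show ?thesis by (simp add: T sum_divide_distrib)
  qed
  have "2 ^ N * (3 / 8) \<le> 2 ^ N / 2 * (1 - 2 * measure_pmf.expectation actives W / T)"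
    using EW tr by (simp add: T_def field_simps)
  also have "\<dots> = measure_pmf.expectation actives (\<lambda>B. 2 ^ N / 2 * (1 - 2 * W B / T))"
    by (simp add: integrable_actives Bochner_Integration.integral_diff)
  also have "\<dots> \<le> measure_pmf.expectation actives (\<lambda>B. \<Sum>\<tau>\<in>Pow {..<N}. indicator (bad \<tau>) B)"
    by (intro integral_mono integrable_actives count)
  also have "\<dots> = (\<Sum>\<tau>\<in>Pow {..<N}. measure_pmf.prob actives (bad \<tau>))"
    by (subst Bochner_Integration.integral_sum) (simp_all add: integrable_actives)
  finally have sum_ge: "2 ^ N * (3 / 8) \<le> (\<Sum>\<tau>\<in>Pow {..<N}. measure_pmf.prob actives (bad \<tau>))" .
  have "\<exists>\<tau>. 3 / 8 \<le> measure_pmf.prob actives (bad \<tau>)"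
  proof (rule ccontr)
    assume "\<not> ?thesis"
    then have "(\<Sum>\<tau>\<in>Pow {..<N}. measure_pmf.prob actives (bad \<tau>)) < (\<Sum>\<tau>\<in>Pow {..<N}. 3 / 8)"
      by (intro sum_strict_mono) (auto simp: not_le)
    then show False using sum_ge by (simp add: card_Pow)
  qed
  then obtain \<tau> where "3 / 8 \<le> measure_pmf.prob actives (bad \<tau>)" by blast
  then have "measure (law \<tau>) {x \<in> space (\<Pi>\<^sub>M k\<in>{..<n}. euclid d). sq_loss d (h x) (center \<tau>) < v} < 3 / 4"
    unfolding law_event(2)[OF h] bad_def by linarith
  then show ?thesis ..
qed

end

section \<open>A contamination under which two different means share one sample law\<close>

lemma Pi_pmf_upd_bind:
  assumes "finite I" "k \<in> I"
  shows "Pi_pmf I dflt (q(k := bind_pmf M f)) = bind_pmf M (\<lambda>x. Pi_pmf I dflt (q(k := f x)))"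
proof -
  have I: "I = insert k (I - {k})" using assms by auto
  have c: "Pi_pmf (I - {k}) dflt (q(k := r)) = Pi_pmf (I - {k}) dflt q" for r
    by (rule Pi_pmf_cong) auto
  have "Pi_pmf I dflt (q(k := r)) = bind_pmf r (\<lambda>y. bind_pmf (Pi_pmf (I - {k}) dflt q) (\<lambda>g. return_pmf (g(k := y))))" for r
    by (subst I, subst Pi_pmf_insert') (use assms in \<open>auto simp: c\<close>)
  then show ?thesis by (simp add: bind_assoc_pmf)
qed

lemma prob_bind_bernoulli:
  assumes "0 \<le> e" "e \<le> 1"
  shows "measure_pmf.prob (bind_pmf (bernoulli_pmf e) f) S
    = (1 - e) * measure_pmf.prob (f False) S + e * measure_pmf.prob (f True) S"
proof -
  have "ennreal (measure_pmf.prob (bind_pmf (bernoulli_pmf e) f) S)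
     = ennreal (measure_pmf.prob (f True) S) * ennreal e + ennreal (measure_pmf.prob (f False) S) * ennreal (1 - e)"
    using assms by (simp add: measure_pmf.emeasure_eq_measure[symmetric])
  also have "\<dots> = ennreal ((1 - e) * measure_pmf.prob (f False) S + e * measure_pmf.prob (f True) S)"
    using assms by (simp add: ennreal_mult[symmetric] ennreal_plus[symmetric] mult.commute add.commute del: ennreal_plus)
  finally show ?thesis using assms by (subst (asm) ennreal_inj) auto
qed

text \<open>One and the same sample law belongs to the families of two means that are far apart, so
  the bound does not improve with \<open>n\<close>. The events of small loss for the two means are
  disjoint, hence one of them has probability at most 1/2.\<close>

lemma contamination_lower_bound:
  fixes N :: nat
  assumes dec: "\<And>i j. i < d \<Longrightarrow> j < d \<Longrightarrow> A i j = (\<Sum>k<N. a k i * a k j)"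
    and k: "k < N" and \<epsilon>: "0 < \<epsilon>" "\<epsilon> < 1 / 2" and v: "v \<le> \<epsilon> * dotp d (a k) (a k)" and \<delta>: "\<delta> < 1 / 2"
    and h: "h \<in> (\<Pi>\<^sub>M k\<in>{..<n}. euclid d) \<rightarrow>\<^sub>M euclid d"
  shows "\<exists>\<theta>\<in>space (euclid d). \<exists>P\<in>contaminated_family n d \<epsilon> A \<theta>. finite_measure P \<and>
    {x \<in> space (\<Pi>\<^sub>M k\<in>{..<n}. euclid d). sq_loss d (h x) \<theta> < v} \<in> sets P \<and>
    measure P {x \<in> space (\<Pi>\<^sub>M k\<in>{..<n}. euclid d). sq_loss d (h x) \<theta> < v} < 1 - \<delta>"
proof -
  \<comment> \<open>With this \<open>p\<close> the laws for the two signs differ in mass \<open>\<epsilon> / (1 - \<epsilon>)\<close>, so each can be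
    contaminated by the exclusive part of the other to the common law \<open>R\<close>.\<close>
  define p where "p = \<epsilon> / (1 - \<epsilon>)"
  have p: "0 < p" "p < 1" "\<epsilon> \<le> p" "(1 - \<epsilon>) * p = \<epsilon>"
    using \<epsilon> by (auto simp: p_def field_simps)
  define s where "s = 1 / sqrt (p * (1 - p))"
  have s2: "s\<^sup>2 * (p * (1 - p)) = 1" using p by (simp add: s_def power_divide)
  have sp2: "\<epsilon> \<le> (s * p)\<^sup>2"
  proof -
    have "(s * p)\<^sup>2 = p / (1 - p)" using p by (simp add: s_def power_mult_distrib power_divide power2_eq_square)
    also have "p \<le> p / (1 - p)" using p by (simp add: le_divide_eq mult_left_le)
    finally show ?thesis using p by linarith
  qed
  have s0: "s \<noteq> 0" using s2 by auto
  define sg where "sg = (\<lambda>(t::real) j. if j = k then t else 1)"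
  define two where "two = (\<lambda>t. map_pmf (\<lambda>b. if b then t * s else 0) (bernoulli_pmf p))"
  define q where "q = (\<lambda>t j. two (sg t j))"
  define \<theta> where "\<theta> = (\<lambda>t. lincomb d N a (\<lambda>j. sg t j * (s * p)))"
  define D where "D = (\<lambda>H. distr (measure_pmf H) (euclid d) (lincomb d N a))"
  define P where "P = (\<lambda>t. D (Pi_pmf {..<N} 0 (q t)))"
  define r where "r = (\<lambda>t. bind_pmf (bernoulli_pmf \<epsilon>) (\<lambda>c. if c then return_pmf (- t * s) else two t))"
  define Q where "Q = (\<lambda>t. D (Pi_pmf {..<N} 0 ((q t)(k := return_pmf (- t * s)))))"
  define R where "R = D (Pi_pmf {..<N} 0 ((q 1)(k := r 1)))"
  have meas: "lincomb d N a \<in> measure_pmf H \<rightarrow>\<^sub>M euclid d" for H by auto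
  have Dp: "D H \<in> prob_measures d" for H unfolding D_def by (rule distr_pmf_in_prob_measures[OF meas])
  have Dm: "measure (D H) B = measure_pmf.prob H (lincomb d N a -` B)" if "B \<in> sets (euclid d)" for H B
    unfolding D_def using that by (subst measure_distr[OF meas]) auto
  have sD: "sets (D H) = sets (euclid d)" for H by (simp add: D_def)
  \<comment> \<open>Since \<open>(1 - \<epsilon>) * p = \<epsilon>\<close>, the genuine jump
    \<open>t * s\<close> and the contaminating one \<open>- t * s\<close> get the same mass
    \<epsilon>, and the law no longer reveals the sign \<open>t\<close>.\<close>
  have pmf_r: "pmf (r t) x = \<epsilon> * (if x = - t * s then 1 else 0) + (\<epsilon> * (if x = t * s then 1 else 0)
      + (1 - \<epsilon>) * (1 - p) * (if x = 0 then 1 else 0))" for t x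
  proof -
    have "pmf (two t) x = p * (if x = t * s then 1 else 0) + (1 - p) * (if x = 0 then 1 else 0)"
      using p by (simp add: two_def map_pmf_def pmf_bind indicator_def mult.commute)
    then have "pmf (r t) x = \<epsilon> * (if x = - t * s then 1 else 0) + (1 - \<epsilon>) * (p * (if x = t * s then 1 else 0) + (1 - p) * (if x = 0 then 1 else 0))"
      using \<epsilon> by (simp add: r_def pmf_bind indicator_def mult.commute)
    then show ?thesis using p(4) by (simp only: distrib_left mult.assoc[symmetric])
  qed
  have r_eq: "r (- 1) = r 1"
    by (rule pmf_eqI) (simp only: pmf_r, simp)
  have R: "R = D (Pi_pmf {..<N} 0 ((q t)(k := r t)))" if "t \<in> {1, - 1}" for t
  proof -
    have "(q t)(k := r t) = (q 1)(k := r 1)"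
      using that r_eq by (auto simp: q_def sg_def fun_eq_iff)
    then show ?thesis by (simp add: R_def)
  qed
  have mix: "is_mixture \<epsilon> R (P t) (Q t)" if "t \<in> {1, - 1}" for t
  proof -
    have "Pi_pmf {..<N} 0 ((q t)(k := r t)) = bind_pmf (bernoulli_pmf \<epsilon>)
       (\<lambda>c. Pi_pmf {..<N} 0 ((q t)(k := (if c then return_pmf (- t * s) else two t))))"
      unfolding r_def by (rule Pi_pmf_upd_bind) (use k in auto)
    moreover have "(q t)(k := two t) = q t" by (auto simp: q_def sg_def fun_eq_iff)
    ultimately show ?thesis
      unfolding is_mixture_def R[OF that] P_def Q_def using \<epsilon>
      by (auto simp: Dm prob_bind_bernoulli sD)
  qed
  have var: "(u * s - u * (s * p))\<^sup>2 * p + (0 - u * (s * p))\<^sup>2 * (1 - p) = 1" if "u\<^sup>2 = 1" for u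
  proof -
    have "(u * s - u * (s * p))\<^sup>2 * p + (0 - u * (s * p))\<^sup>2 * (1 - p) = u\<^sup>2 * (s\<^sup>2 * (p * (1 - p)))"
      by (simp add: power2_eq_square algebra_simps)
    then show ?thesis using s2 that by simp
  qed
  have fam: "(\<Pi>\<^sub>M k\<in>{..<n}. R) \<in> contaminated_family n d \<epsilon> A (\<theta> t)" if t: "t \<in> {1, - 1}" for t
  proof -
    have m: "measure_pmf.expectation (q t j) (\<lambda>x. x) = sg t j * (s * p)" for j
      using p by (simp add: q_def two_def)
    have vr: "measure_pmf.expectation (q t j) (\<lambda>x. (x - sg t j * (s * p))\<^sup>2) = 1" for j
      using p var[of "sg t j"] t by (auto simp: q_def two_def sg_def)
    have fin: "finite (set_pmf (q t j))" for j by (simp add: q_def two_def)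
    have "has_mean d (P t) (\<theta> t)" "has_cov d (P t) A"
      unfolding \<theta>_def
      by (rule has_mean_cov_lincomb[of N "q t" "\<lambda>_ x. x" "\<lambda>j. sg t j * (s * p)" d A a "P t" 0];
          use fin m vr dec in \<open>simp add: P_def D_def\<close>)+
    then show ?thesis
      using mix[OF t] Dp unfolding P_def Q_def
      by (intro contaminated_family_mixtureI[of R d "P t" "Q t"]) (auto simp: P_def Q_def R_def)
  qed
  let ?X = "\<Pi>\<^sub>M k\<in>{..<n}. euclid d" and ?R = "\<Pi>\<^sub>M k\<in>{..<n}. R"
  have "prob_space R" "sets R = sets (euclid d)"
    using Dp[of "Pi_pmf {..<N} 0 ((q 1)(k := r 1))"] by (auto simp: R_def prob_measures_def space_prob_algebra)
  then have pR: "prob_space ?R" and sR: "sets ?R = sets ?X"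
    by (auto intro!: prob_space_PiM sets_PiM_cong)
  interpret R: prob_space ?R by (rule pR)
  define E where "E = (\<lambda>t. {x \<in> space ?X. sq_loss d (h x) (\<theta> t) < v})"
  have E: "E t \<in> sets ?R" for t
  proof -
    have "E t \<in> sets ?X" unfolding E_def using measurable_sq_loss[OF h, of "\<theta> t"] by measurable
    then show ?thesis using sR by simp
  qed
  have "sq_loss d (\<theta> 1) (\<theta> (- 1)) = 4 * (s * p)\<^sup>2 * dotp d (a k) (a k)"
  proof -
    have "\<theta> 1 i - \<theta> (- 1) i = (2 * (s * p)) * a k i" if "i < d" for i
    proof -
      have "\<theta> 1 i - \<theta> (- 1) i = (\<Sum>j<N. sg 1 j * (s * p) * a j i - sg (- 1) j * (s * p) * a j i)"
        using that by (simp add: \<theta>_def lincomb_def sum_subtractf)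
      also have "\<dots> = (\<Sum>j<N. if j = k then (2 * (s * p)) * a k i else 0)"
        by (intro sum.cong refl) (auto simp: sg_def)
      also have "\<dots> = (2 * (s * p)) * a k i" using k by simp
      finally show ?thesis .
    qed
    then have "sq_loss d (\<theta> 1) (\<theta> (- 1)) = dotp d (\<lambda>i. (2 * (s * p)) * a k i) (\<lambda>i. (2 * (s * p)) * a k i)"
      unfolding sq_loss_eq by (intro dotp_cong) auto
    then show ?thesis by (simp only: dotp_scale_left dotp_scale_right) (simp add: power2_eq_square)
  qed
  moreover have "v \<le> (s * p)\<^sup>2 * dotp d (a k) (a k)"
    using v mult_right_mono[OF sp2 dotp_self_nonneg[of d "a k"]] by linarith
  ultimately have far: "4 * v \<le> sq_loss d (\<theta> 1) (\<theta> (- 1))" by simp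
  have "E 1 \<inter> E (- 1) = {}"
  proof -
    have False if "x \<in> E 1" "x \<in> E (- 1)" for x
      using that sq_loss_parallelogram[of d "\<theta> 1" "\<theta> (- 1)" "h x"] far by (auto simp: E_def)
    then show ?thesis by auto
  qed
  then have "measure ?R (E 1) + measure ?R (E (- 1)) = measure ?R (E 1 \<union> E (- 1))"
    using E by (intro R.finite_measure_Union[symmetric]) auto
  also have "\<dots> \<le> 1" by (rule R.prob_le_1)
  finally have "measure ?R (E 1) < 1 - \<delta> \<or> measure ?R (E (- 1)) < 1 - \<delta>" using \<delta> by linarith
  then obtain t where t: "t \<in> {1, - 1}" "measure ?R (E t) < 1 - \<delta>" by blast
  show ?thesis
  proof (intro bexI conjI)
    show "?R \<in> contaminated_family n d \<epsilon> A (\<theta> t)" by (rule fam[OF t(1)])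
    show "\<theta> t \<in> space (euclid d)" by (simp add: \<theta>_def)
    show "finite_measure ?R" by (rule R.finite_measure_axioms)
  qed (use t E in \<open>auto simp: E_def\<close>)
qed

text \<open>Write \<open>l\<close> for the logarithm and \<open>p = l / (8 * n) \<le> 1 / 2\<close>.
  From \<open>ln (1 - p) \<ge> - 2 * p\<close> the power is at least \<open>exp (- l / 4)\<close>,
  while \<open>2 * \<delta> = exp (ln 2 - l)\<close> and \<open>ln 2 \<le> l / 2\<close> because
  \<delta> \<le> 1/4.\<close>

lemma two_mult_less_power:
  fixes n :: nat
  assumes \<delta>: "0 < \<delta>" "\<delta> \<le> 1 / 4" and n: "1 \<le> n" and L: "ln (1 / \<delta>) \<le> 4 * real n"
  shows "2 * \<delta> < (1 - ln (1 / \<delta>) / (8 * real n)) ^ n"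
proof -
  define l where "l = ln (1 / \<delta>)"
  define p where "p = l / (8 * real n)"
  have l4: "ln 4 \<le> l" unfolding l_def using \<delta> by (subst ln_le_cancel_iff) (auto simp: field_simps)
  have ln4: "ln 4 = 2 * ln (2::real)" using ln_realpow[of 2 2] by simp
  have ln2: "0 < ln (2::real)" by simp
  have l0: "0 \<le> l" using l4 ln2 unfolding ln4 by linarith
  have p: "0 \<le> p" "p \<le> 1 / 2" using L n l0 by (auto simp: p_def l_def[symmetric] field_simps)
  have "2 * p\<^sup>2 \<le> p" using p mult_left_mono[of p "1 / 2" p] by (simp add: power2_eq_square)
  then have lp: "- 2 * p \<le> ln (1 - p)"
    using ln_one_minus_pos_lower_bound[OF p] by linarith
  have d: "\<delta> = exp (- l)" using \<delta> by (simp add: l_def ln_div)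
  have "2 * \<delta> = exp (ln 2 - l)" by (simp add: d exp_diff exp_minus divide_inverse)
  also have "\<dots> < exp (real n * (- 2 * p))"
  proof -
    have "real n * (- 2 * p) = - l / 4" using n by (simp add: p_def)
    then show ?thesis using l4 ln2 unfolding ln4 exp_less_cancel_iff by linarith
  qed
  also have "\<dots> \<le> exp (real n * ln (1 - p))" unfolding exp_le_cancel_iff by (rule mult_left_mono[OF lp]) simp
  also have "\<dots> = (1 - p) ^ n" using p by (simp add: exp_of_nat_mult)
  finally show ?thesis by (simp add: p_def l_def)
qed

lemma minimax_lower_bound:
  assumes n: "1 \<le> n" and d: "1 \<le> d" and \<epsilon>: "0 \<le> \<epsilon>" "\<epsilon> < 1 / 2" and A: "sym_pos_def d A"
    and \<delta>: "0 < \<delta>" "\<delta> \<le> 1 / 4" and L: "ln (1 / \<delta>) \<le> 4 * real n"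
  defines "M \<equiv> minimax_quantile (\<Pi>\<^sub>M k\<in>{..<n}. euclid d) (euclid d) \<delta> (contaminated_family n d \<epsilon> A) (sq_loss d)"
  shows "ennreal (mat_trace d A / (16 * real n)) \<le> M"
    and "ennreal (op_norm d A * \<epsilon>) \<le> M"
    and "ennreal (op_norm d A * ln (1 / \<delta>) / (8 * real n)) \<le> M"
proof -
  obtain N :: nat and a where orth: "\<And>k l. k < N \<Longrightarrow> l < N \<Longrightarrow> k \<noteq> l \<Longrightarrow> dotp d (a k) (a l) = 0"
    and dec: "\<And>i j. i < d \<Longrightarrow> j < d \<Longrightarrow> A i j = (\<Sum>k<N. a k i * a k j)"
    using sym_psd_orthogonal_decomposition[OF sym_pos_def_imp_sym_psd[OF A]] by metis
  have tr: "0 < mat_trace d A" by (rule mat_trace_pos[OF A d])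
  obtain k where k: "k < N" "op_norm d A \<le> dotp d (a k) (a k)"
    by (rule top_component_exists[of N d a A]) (use orth dec tr in auto)
  have n0: "0 < real n" using n by simp
  have l: "0 < ln (1 / \<delta>)" using \<delta> by simp
  show "ennreal (mat_trace d A / (16 * real n)) \<le> M"
    unfolding M_def
  proof (rule minimax_quantile_ge)
    fix h assume h: "h \<in> (\<Pi>\<^sub>M k\<in>{..<n}. euclid d) \<rightarrow>\<^sub>M euclid d"
    \<comment> \<open>The largest \<open>p\<close> with \<open>n * p \<le> 1 / 8\<close>; the bound
      \<open>p * mat_trace d A / 2\<close> then has the denominator \<open>16 * n\<close>.\<close>
    define p where "p = 1 / (8 * real n)"
    interpret sparse_model d N n A a p "1 / sqrt (p * (1 - p))"
      by unfold_locales (use orth dec n0 n in \<open>auto simp: p_def\<close>)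
    obtain \<tau> where "measure (law \<tau>) {x \<in> space (\<Pi>\<^sub>M k\<in>{..<n}. euclid d).
        sq_loss d (h x) (center \<tau>) < mat_trace d A / (16 * real n)} < 3 / 4"
      using trace_lower_bound[OF h _ _ tr, of "mat_trace d A / (16 * real n)"] n0 by (auto simp: p_def)
    then show "\<exists>\<theta>\<in>space (euclid d). \<exists>P\<in>contaminated_family n d \<epsilon> A \<theta>. finite_measure P \<and>
       {x \<in> space (\<Pi>\<^sub>M k\<in>{..<n}. euclid d). sq_loss d (h x) \<theta> < mat_trace d A / (16 * real n)} \<in> sets P \<and>
       measure P {x \<in> space (\<Pi>\<^sub>M k\<in>{..<n}. euclid d). sq_loss d (h x) \<theta> < mat_trace d A / (16 * real n)} < 1 - \<delta>"
      using \<delta> law_event(1)[OF h] law_in_family center_space prob_space.finite_measure[OF prob_space_law]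
      by (intro bexI[of _ "center \<tau>"] bexI[of _ "law \<tau>"] conjI) auto
  qed
  show "ennreal (op_norm d A * \<epsilon>) \<le> M"
  proof (cases "\<epsilon> = 0")
    case False
    then have e: "0 < \<epsilon>" using \<epsilon> by simp
    have v: "op_norm d A * \<epsilon> \<le> \<epsilon> * dotp d (a k) (a k)"
      using k e by (simp add: mult.commute)
    show ?thesis unfolding M_def
      by (rule minimax_quantile_ge, rule contamination_lower_bound[OF dec k(1) e \<epsilon>(2) v]) (use \<delta> in auto)
  qed simp
  show "ennreal (op_norm d A * ln (1 / \<delta>) / (8 * real n)) \<le> M"
    unfolding M_def
  proof (rule minimax_quantile_ge)
    fix h assume h: "h \<in> (\<Pi>\<^sub>M k\<in>{..<n}. euclid d) \<rightarrow>\<^sub>M euclid d"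
    \<comment> \<open>Small enough that the top coordinate stays unseen with probability above
      \<open>2 * \<delta>\<close>.\<close>
    define p where "p = ln (1 / \<delta>) / (8 * real n)"
    let ?v = "op_norm d A * ln (1 / \<delta>) / (8 * real n)"
    have pl: "0 < p" "p < 1" using l L n0 by (auto simp: p_def field_simps)
    interpret sparse_model d N n A a p "1 / sqrt (p * (1 - p))"
      by unfold_locales (use orth dec pl in auto)
    have "?v \<le> p * dotp d (a k) (a k)" using mult_left_mono[OF k(2), of p] pl by (simp add: p_def mult.commute)
    then obtain \<tau> where "measure (law \<tau>) {x \<in> space (\<Pi>\<^sub>M k\<in>{..<n}. euclid d).
        sq_loss d (h x) (center \<tau>) < ?v} < 1 - \<delta>"
      using top_lower_bound[OF h k(1), of ?v \<delta>] two_mult_less_power[OF \<delta> n L] by (auto simp: p_def)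
    then show "\<exists>\<theta>\<in>space (euclid d). \<exists>P\<in>contaminated_family n d \<epsilon> A \<theta>. finite_measure P \<and>
       {x \<in> space (\<Pi>\<^sub>M k\<in>{..<n}. euclid d). sq_loss d (h x) \<theta> < ?v} \<in> sets P \<and>
       measure P {x \<in> space (\<Pi>\<^sub>M k\<in>{..<n}. euclid d). sq_loss d (h x) \<theta> < ?v} < 1 - \<delta>"
      using law_event(1)[OF h] law_in_family center_space prob_space.finite_measure[OF prob_space_law]
      by (intro bexI[of _ "center \<tau>"] bexI[of _ "law \<tau>"] conjI) auto
  qed
qed

section \<open>Gaussian change of measure\<close>

lemma indep_vars_PiM_coordinates:
  assumes N: "prob_space N" and I: "I \<noteq> {}"
  shows "prob_space.indep_vars (\<Pi>\<^sub>M i\<in>I. N) (\<lambda>_. N) (\<lambda>i x. x i) I"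
proof -
  interpret prob_space "\<Pi>\<^sub>M i\<in>I. N" using N by (rule prob_space_PiM)
  have "distr (\<Pi>\<^sub>M i\<in>I. N) (\<Pi>\<^sub>M i\<in>I. N) (\<lambda>x. \<lambda>i\<in>I. x i) = distr (\<Pi>\<^sub>M i\<in>I. N) (\<Pi>\<^sub>M i\<in>I. N) (\<lambda>x. x)"
    by (rule distr_cong) (auto simp: space_PiM PiE_restrict)
  also have "\<dots> = (\<Pi>\<^sub>M i\<in>I. N)" by (rule distr_id)
  also have "\<dots> = (\<Pi>\<^sub>M i\<in>I. distr (\<Pi>\<^sub>M i\<in>I. N) N (\<lambda>x. x i))"
    by (intro PiM_cong refl distr_PiM_component[symmetric]) (use N in auto)
  finally show ?thesis by (subst indep_vars_iff_distr_eq_PiM'[OF I]) auto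
qed

lemma PiM_component_integral:
  fixes f :: "'a \<Rightarrow> real"
  assumes N: "prob_space N" and i: "i \<in> I" and f: "integrable N f"
  shows "integrable (\<Pi>\<^sub>M i\<in>I. N) (\<lambda>x. f (x i))" "(\<integral>x. f (x i) \<partial>(\<Pi>\<^sub>M i\<in>I. N)) = integral\<^sup>L N f"
proof -
  have d: "distr (\<Pi>\<^sub>M i\<in>I. N) N (\<lambda>x. x i) = N" using N i by (intro distr_PiM_component) auto
  have m: "(\<lambda>x. x i) \<in> (\<Pi>\<^sub>M i\<in>I. N) \<rightarrow>\<^sub>M N" using i by measurable
  show "integrable (\<Pi>\<^sub>M i\<in>I. N) (\<lambda>x. f (x i))"
    using f integrable_distr[OF m, of f] d by simp
  show "(\<integral>x. f (x i) \<partial>(\<Pi>\<^sub>M i\<in>I. N)) = integral\<^sup>L N f"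
    using integral_distr[OF m, of f] f d by (simp add: borel_measurable_integrable)
qed

lemma PiM_two_components_integral:
  fixes f g :: "'a \<Rightarrow> real"
  assumes N: "prob_space N" and ij: "i \<in> I" "j \<in> I" "i \<noteq> j" and f: "integrable N f" and g: "integrable N g"
  shows "integrable (\<Pi>\<^sub>M i\<in>I. N) (\<lambda>x. f (x i) * g (x j))"
    "(\<integral>x. f (x i) * g (x j) \<partial>(\<Pi>\<^sub>M i\<in>I. N)) = integral\<^sup>L N f * integral\<^sup>L N g"
proof -
  interpret prob_space "\<Pi>\<^sub>M i\<in>I. N" using N by (rule prob_space_PiM)
  define X where "X = (\<lambda>k (x :: 'b \<Rightarrow> 'a). if k = i then f (x k) else g (x k))"
  have "indep_vars (\<lambda>_. N) (\<lambda>i x. x i) {i, j}"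
    by (rule indep_vars_subset[OF indep_vars_PiM_coordinates[OF N]]) (use ij in auto)
  then have ind: "indep_vars (\<lambda>_. borel) X {i, j}"
    unfolding X_def by (rule indep_vars_compose2) (use f g in \<open>auto simp: borel_measurable_integrable\<close>)
  have "integrable (\<Pi>\<^sub>M i\<in>I. N) (X k)" if "k \<in> {i, j}" for k
    using that ij PiM_component_integral(1)[OF N ij(1) f] PiM_component_integral(1)[OF N ij(2) g]
    by (auto simp: X_def)
  note ind_int = indep_vars_lebesgue_integral[OF _ ind this] indep_vars_integrable[OF _ ind this]
  show "integrable (\<Pi>\<^sub>M i\<in>I. N) (\<lambda>x. f (x i) * g (x j))"
    using ind_int(2) ij by (simp add: X_def)
  show "(\<integral>x. f (x i) * g (x j) \<partial>(\<Pi>\<^sub>M i\<in>I. N)) = integral\<^sup>L N f * integral\<^sup>L N g"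
    using ind_int(1) ij PiM_component_integral(2)[OF N ij(1) f] PiM_component_integral(2)[OF N ij(2) g]
    by (simp add: X_def)
qed

text \<open>A weighted change of variables in each factor carries over to the finite product, one
  coordinate at a time by Tonelli's theorem. It is applied to translations, weighted by likelihood
  ratios, and to the reflection, with weight 1.\<close>

lemma nn_integral_PiM_transform:
  fixes N :: "'a measure" and T :: "'i \<Rightarrow> 'a \<Rightarrow> 'a" and w :: "'i \<Rightarrow> 'a \<Rightarrow> ennreal"
  assumes N: "prob_space N" and I: "finite I"
    and T: "\<And>i. i \<in> I \<Longrightarrow> T i \<in> N \<rightarrow>\<^sub>M N" and w: "\<And>i. i \<in> I \<Longrightarrow> w i \<in> borel_measurable N"
    and tr: "\<And>i g. i \<in> I \<Longrightarrow> g \<in> borel_measurable N \<Longrightarrow> (\<integral>\<^sup>+x. g x \<partial>N) = (\<integral>\<^sup>+x. g (T i x) * w i x \<partial>N)"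
    and g: "g \<in> borel_measurable (\<Pi>\<^sub>M i\<in>I. N)"
  shows "(\<integral>\<^sup>+x. g x \<partial>(\<Pi>\<^sub>M i\<in>I. N)) = (\<integral>\<^sup>+x. g (\<lambda>i\<in>I. T i (x i)) * (\<Prod>i\<in>I. w i (x i)) \<partial>(\<Pi>\<^sub>M i\<in>I. N))"
  using I T w tr g
proof (induction I arbitrary: g)
  case empty
  then show ?case by (simp add: PiM_empty nn_integral_count_space_finite restrict_def)
next
  case (insert i I)
  interpret N: prob_space N by (rule N)
  interpret product_sigma_finite "\<lambda>_::'i. N" by standard
  define G where "G = (\<lambda>x. \<integral>\<^sup>+y. g (x(i := T i y)) * w i y \<partial>N)"
  note g[measurable] = insert.prems(4)
  have Ti[measurable]: "T i \<in> N \<rightarrow>\<^sub>M N" and wi[measurable]: "w i \<in> borel_measurable N"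
    using insert.prems by auto
  have upd: "(\<lambda>(x, y). x(i := T i y)) \<in> (\<Pi>\<^sub>M i\<in>I. N) \<Otimes>\<^sub>M N \<rightarrow>\<^sub>M (\<Pi>\<^sub>M i\<in>insert i I. N)"
    by measurable
  have Gm: "G \<in> borel_measurable (\<Pi>\<^sub>M i\<in>I. N)"
    unfolding G_def
    by (intro N.borel_measurable_nn_integral) (use upd in measurable)
  have "(\<integral>\<^sup>+x. g x \<partial>(\<Pi>\<^sub>M i\<in>insert i I. N)) = (\<integral>\<^sup>+x. \<integral>\<^sup>+y. g (x(i := y)) \<partial>N \<partial>(\<Pi>\<^sub>M i\<in>I. N))"
    by (rule product_nn_integral_insert) (use insert in auto)
  also have "\<dots> = (\<integral>\<^sup>+x. G x \<partial>(\<Pi>\<^sub>M i\<in>I. N))"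
    unfolding G_def
  proof (rule nn_integral_cong)
    fix x assume x: "x \<in> space (\<Pi>\<^sub>M i\<in>I. N)"
    have "(\<lambda>y. x(i := y)) \<in> N \<rightarrow>\<^sub>M (\<Pi>\<^sub>M i\<in>insert i I. N)"
      using measurable_component_update[OF x insert.hyps(2)] .
    then show "(\<integral>\<^sup>+y. g (x(i := y)) \<partial>N) = (\<integral>\<^sup>+y. g (x(i := T i y)) * w i y \<partial>N)"
      by (intro insert.prems(3)) (use g in auto)
  qed
  also have "\<dots> = (\<integral>\<^sup>+x. G (\<lambda>i\<in>I. T i (x i)) * (\<Prod>i\<in>I. w i (x i)) \<partial>(\<Pi>\<^sub>M i\<in>I. N))"
    by (rule insert.IH) (use insert.prems Gm in auto)
  also have "\<dots> = (\<integral>\<^sup>+x. \<integral>\<^sup>+y. g (\<lambda>j\<in>insert i I. T j ((x(i := y)) j)) * (\<Prod>j\<in>insert i I. w j ((x(i := y)) j)) \<partial>N \<partial>(\<Pi>\<^sub>M i\<in>I. N))"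
  proof (rule nn_integral_cong)
    fix x assume x: "x \<in> space (\<Pi>\<^sub>M i\<in>I. N)"
    define x' where "x' = (\<lambda>i\<in>I. T i (x i))"
    have x': "x' \<in> space (\<Pi>\<^sub>M i\<in>I. N)"
      using x insert.prems(1) by (auto simp: x'_def space_PiM PiE_iff measurable_def)
    have m: "(\<lambda>y. x'(i := y)) \<in> N \<rightarrow>\<^sub>M (\<Pi>\<^sub>M i\<in>insert i I. N)"
      using measurable_component_update[OF x' insert.hyps(2)] .
    have "(\<lambda>y. g (x'(i := T i y)) * w i y) \<in> borel_measurable N"
      using measurable_compose[OF measurable_compose[OF Ti m] g] wi by measurable
    then have "G x' * (\<Prod>i\<in>I. w i (x i)) = (\<integral>\<^sup>+y. (g (x'(i := T i y)) * w i y) * (\<Prod>i\<in>I. w i (x i)) \<partial>N)"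
      unfolding G_def by (rule nn_integral_multc[symmetric])
    also have "\<dots> = (\<integral>\<^sup>+y. g (\<lambda>j\<in>insert i I. T j ((x(i := y)) j)) * (\<Prod>j\<in>insert i I. w j ((x(i := y)) j)) \<partial>N)"
    proof (rule nn_integral_cong)
      fix y
      have "x'(i := T i y) = (\<lambda>j\<in>insert i I. T j ((x(i := y)) j))"
        using insert.hyps by (auto simp: x'_def fun_eq_iff)
      moreover have "(\<Prod>j\<in>insert i I. w j ((x(i := y)) j)) = w i y * (\<Prod>i\<in>I. w i (x i))"
      proof -
        have "(\<Prod>j\<in>I. w j ((x(i := y)) j)) = (\<Prod>i\<in>I. w i (x i))"
          using insert.hyps by (intro prod.cong) auto
        then show ?thesis using insert.hyps by simp
      qed
      ultimately show "(g (x'(i := T i y)) * w i y) * (\<Prod>i\<in>I. w i (x i)) =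
        g (\<lambda>j\<in>insert i I. T j ((x(i := y)) j)) * (\<Prod>j\<in>insert i I. w j ((x(i := y)) j))"
        by (simp add: mult.assoc)
    qed
    finally show "G (\<lambda>i\<in>I. T i (x i)) * (\<Prod>i\<in>I. w i (x i)) =
      (\<integral>\<^sup>+y. g (\<lambda>j\<in>insert i I. T j ((x(i := y)) j)) * (\<Prod>j\<in>insert i I. w j ((x(i := y)) j)) \<partial>N)"
      by (simp add: x'_def)
  qed
  also have "\<dots> = (\<integral>\<^sup>+x. g (\<lambda>j\<in>insert i I. T j (x j)) * (\<Prod>j\<in>insert i I. w j (x j)) \<partial>(\<Pi>\<^sub>M i\<in>insert i I. N))"
  proof (rule product_nn_integral_insert[symmetric])
    have c: "(\<lambda>x. x j) \<in> (\<Pi>\<^sub>M i\<in>insert i I. N) \<rightarrow>\<^sub>M N" if "j \<in> insert i I" for j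
      using that by (rule measurable_component_singleton)
    have "(\<lambda>x. \<lambda>j\<in>insert i I. T j (x j)) \<in> (\<Pi>\<^sub>M i\<in>insert i I. N) \<rightarrow>\<^sub>M (\<Pi>\<^sub>M i\<in>insert i I. N)"
      by (intro measurable_restrict) (rule measurable_compose[OF c insert.prems(1)])
    moreover have "(\<lambda>x. \<Prod>j\<in>insert i I. w j (x j)) \<in> borel_measurable (\<Pi>\<^sub>M i\<in>insert i I. N)"
      by (intro borel_measurable_prod_ennreal) (rule measurable_compose[OF c insert.prems(2)])
    ultimately show "(\<lambda>x. g (\<lambda>j\<in>insert i I. T j (x j)) * (\<Prod>j\<in>insert i I. w j (x j))) \<in> borel_measurable (\<Pi>\<^sub>M i\<in>insert i I. N)"
      using measurable_compose[OF _ g] by (intro borel_measurable_times_ennreal) auto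
  qed (use insert in auto)
  finally show ?case .
qed

definition normal0 :: "real \<Rightarrow> real measure" where
  "normal0 \<sigma> = density lborel (normal_density 0 \<sigma>)"

lemma prob_space_normal0: "0 < \<sigma> \<Longrightarrow> prob_space (normal0 \<sigma>)"
  unfolding normal0_def by (rule prob_space_normal_density)

lemma sets_normal0 [simp, measurable_cong]: "sets (normal0 \<sigma>) = sets borel"
  by (simp add: normal0_def)

text \<open>The weight is the ratio of the normal densities at \<open>x + t\<close> and at
  \<open>x\<close>.\<close>

lemma nn_integral_normal0_shift:
  assumes \<sigma>: "0 < \<sigma>" and g: "g \<in> borel_measurable (normal0 \<sigma>)"
  shows "(\<integral>\<^sup>+x. g x \<partial>normal0 \<sigma>) = (\<integral>\<^sup>+x. g (x + t) * ennreal (exp (- (2 * (x * t) + t * t) / (2 * \<sigma>\<^sup>2))) \<partial>normal0 \<sigma>)"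
proof -
  have [measurable]: "g \<in> borel_measurable borel" using g by simp
  have nd: "normal_density 0 \<sigma> (t + x) = normal_density 0 \<sigma> x * exp (- (2 * (x * t) + t * t) / (2 * \<sigma>\<^sup>2))" for x
  proof -
    have "- (t + x)\<^sup>2 / (2 * \<sigma>\<^sup>2) = - x\<^sup>2 / (2 * \<sigma>\<^sup>2) + - (2 * (x * t) + t * t) / (2 * \<sigma>\<^sup>2)"
      by (simp add: add_divide_distrib[symmetric] power2_eq_square algebra_simps)
    then show ?thesis unfolding normal_density_def diff_0_right by (simp only: exp_add mult.assoc)
  qed
  have "(\<integral>\<^sup>+x. g x \<partial>normal0 \<sigma>) = (\<integral>\<^sup>+x. ennreal (normal_density 0 \<sigma> x) * g x \<partial>lborel)"
    unfolding normal0_def by (rule nn_integral_density) auto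
  also have "\<dots> = (\<integral>\<^sup>+x. ennreal (normal_density 0 \<sigma> (t + 1 * x)) * g (t + 1 * x) \<partial>lborel)"
    using nn_integral_real_affine[of "\<lambda>x. ennreal (normal_density 0 \<sigma> x) * g x" 1 t] by simp
  also have "\<dots> = (\<integral>\<^sup>+x. ennreal (normal_density 0 \<sigma> x) * (g (x + t) * ennreal (exp (- (2 * (x * t) + t * t) / (2 * \<sigma>\<^sup>2)))) \<partial>lborel)"
  proof (intro nn_integral_cong)
    fix x
    have "ennreal (normal_density 0 \<sigma> (t + x)) = ennreal (normal_density 0 \<sigma> x) * ennreal (exp (- (2 * (x * t) + t * t) / (2 * \<sigma>\<^sup>2)))"
      unfolding nd by (rule ennreal_mult') simp
    then show "ennreal (normal_density 0 \<sigma> (t + 1 * x)) * g (t + 1 * x) =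
        ennreal (normal_density 0 \<sigma> x) * (g (x + t) * ennreal (exp (- (2 * (x * t) + t * t) / (2 * \<sigma>\<^sup>2))))"
      by (simp only: mult_1 add.commute[of x t] mult.assoc mult.commute[of "g _"])
  qed
  also have "\<dots> = (\<integral>\<^sup>+x. g (x + t) * ennreal (exp (- (2 * (x * t) + t * t) / (2 * \<sigma>\<^sup>2))) \<partial>normal0 \<sigma>)"
    unfolding normal0_def by (rule nn_integral_density[symmetric]) auto
  finally show ?thesis .
qed

lemma nn_integral_normal0_minus:
  assumes g: "g \<in> borel_measurable (normal0 \<sigma>)"
  shows "(\<integral>\<^sup>+x. g x \<partial>normal0 \<sigma>) = (\<integral>\<^sup>+x. g (- x) \<partial>normal0 \<sigma>)"
proof -
  have [measurable]: "g \<in> borel_measurable borel" using g by simp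
  have "(\<integral>\<^sup>+x. g x \<partial>normal0 \<sigma>) = (\<integral>\<^sup>+x. ennreal (normal_density 0 \<sigma> x) * g x \<partial>lborel)"
    unfolding normal0_def by (rule nn_integral_density) auto
  also have "\<dots> = (\<integral>\<^sup>+x. ennreal (normal_density 0 \<sigma> (0 + (-1) * x)) * g (0 + (-1) * x) \<partial>lborel)"
    using nn_integral_real_affine[of "\<lambda>x. ennreal (normal_density 0 \<sigma> x) * g x" "-1" 0] by simp
  also have "\<dots> = (\<integral>\<^sup>+x. ennreal (normal_density 0 \<sigma> x) * g (- x) \<partial>lborel)"
    by (simp add: normal_density_def)
  also have "\<dots> = (\<integral>\<^sup>+x. g (- x) \<partial>normal0 \<sigma>)"
    unfolding normal0_def by (rule nn_integral_density[symmetric]) auto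
  finally show ?thesis .
qed

lemma normal0_moments:
  assumes \<sigma>: "0 < \<sigma>"
  shows "integrable (normal0 \<sigma>) (\<lambda>x. x)" "(\<integral>x. x \<partial>normal0 \<sigma>) = 0"
    "integrable (normal0 \<sigma>) (\<lambda>x. x * x)" "(\<integral>x. x * x \<partial>normal0 \<sigma>) = \<sigma>\<^sup>2"
proof -
  have 1: "has_bochner_integral lborel (\<lambda>x. normal_density 0 \<sigma> x * x) 0"
    using normal_moment_odd[OF \<sigma>, of 0 0] by simp
  have 2: "has_bochner_integral lborel (\<lambda>x. normal_density 0 \<sigma> x * (x * x)) (\<sigma>\<^sup>2)"
    using normal_moment_even[OF \<sigma>, of 0 1] by (simp add: power2_eq_square)
  show "integrable (normal0 \<sigma>) (\<lambda>x. x)" "integrable (normal0 \<sigma>) (\<lambda>x. x * x)"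
    unfolding normal0_def using 1 2 by (auto simp: integrable_density has_bochner_integral_iff)
  show "(\<integral>x. x \<partial>normal0 \<sigma>) = 0" "(\<integral>x. x * x \<partial>normal0 \<sigma>) = \<sigma>\<^sup>2"
    unfolding normal0_def using 1 2 by (auto simp: integral_density has_bochner_integral_iff)
qed

definition gauss :: "nat \<Rightarrow> real \<Rightarrow> (nat \<Rightarrow> real) measure" where
  "gauss d \<sigma> = (\<Pi>\<^sub>M i\<in>{..<d}. normal0 \<sigma>)"

definition vadd :: "nat \<Rightarrow> (nat \<Rightarrow> real) \<Rightarrow> (nat \<Rightarrow> real) \<Rightarrow> nat \<Rightarrow> real" where
  "vadd d u v = (\<lambda>i\<in>{..<d}. u i + v i)"

lemma sets_gauss [simp, measurable_cong]: "sets (gauss d \<sigma>) = sets (euclid d)"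
  unfolding gauss_def euclid_def by (rule sets_PiM_cong) auto

lemma space_gauss: "space (gauss d \<sigma>) = space (euclid d)"
  by (rule sets_eq_imp_space_eq) simp

lemma prob_space_gauss: "0 < \<sigma> \<Longrightarrow> prob_space (gauss d \<sigma>)"
  unfolding gauss_def by (intro prob_space_PiM prob_space_normal0)

lemma dotp_vadd: "dotp d w (vadd d u v) = dotp d w u + dotp d w v"
proof -
  have "dotp d w (vadd d u v) = dotp d w (\<lambda>i. u i + v i)" by (rule dotp_cong) (auto simp: vadd_def)
  then show ?thesis by (simp add: dotp_add_right)
qed

lemma measurable_vadd: "(\<lambda>u. vadd d u v) \<in> euclid d \<rightarrow>\<^sub>M euclid d"
  unfolding vadd_def euclid_def by measurable

lemma nn_integral_gauss_shift:
  assumes \<sigma>: "0 < \<sigma>" and g: "g \<in> borel_measurable (euclid d)"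
  shows "(\<integral>\<^sup>+u. g u \<partial>gauss d \<sigma>) = (\<integral>\<^sup>+u. g (vadd d u v) * ennreal (exp (- (2 * dotp d u v + dotp d v v) / (2 * \<sigma>\<^sup>2))) \<partial>gauss d \<sigma>)"
proof -
  have g': "g \<in> borel_measurable (\<Pi>\<^sub>M i\<in>{..<d}. normal0 \<sigma>)" using g sets_gauss[of d \<sigma>] by (simp add: gauss_def cong: measurable_cong_sets)
  have "(\<integral>\<^sup>+u. g u \<partial>gauss d \<sigma>) = (\<integral>\<^sup>+u. g (\<lambda>i\<in>{..<d}. u i + v i) *
      (\<Prod>i<d. ennreal (exp (- (2 * (u i * v i) + v i * v i) / (2 * \<sigma>\<^sup>2)))) \<partial>gauss d \<sigma>)"
    unfolding gauss_def
  proof (rule nn_integral_PiM_transform[OF prob_space_normal0[OF \<sigma>]])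
    show "(\<integral>\<^sup>+x. g x \<partial>normal0 \<sigma>) = (\<integral>\<^sup>+x. g (x + v i) * ennreal (exp (- (2 * (x * v i) + v i * v i) / (2 * \<sigma>\<^sup>2))) \<partial>normal0 \<sigma>)"
      if "g \<in> borel_measurable (normal0 \<sigma>)" for g :: "real \<Rightarrow> ennreal" and i
      by (rule nn_integral_normal0_shift[OF \<sigma> that])
  qed (use g' in \<open>simp_all add: measurable_cong_sets[OF sets_normal0 refl]\<close>)
  also have "\<dots> = (\<integral>\<^sup>+u. g (vadd d u v) * ennreal (exp (- (2 * dotp d u v + dotp d v v) / (2 * \<sigma>\<^sup>2))) \<partial>gauss d \<sigma>)"
  proof (rule nn_integral_cong)
    fix u
    have "(\<Prod>i<d. ennreal (exp (- (2 * (u i * v i) + v i * v i) / (2 * \<sigma>\<^sup>2))))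
       = ennreal (exp (\<Sum>i<d. - (2 * (u i * v i) + v i * v i) / (2 * \<sigma>\<^sup>2)))"
      by (simp add: prod_ennreal exp_sum)
    also have "(\<Sum>i<d. - (2 * (u i * v i) + v i * v i) / (2 * \<sigma>\<^sup>2)) = - (2 * dotp d u v + dotp d v v) / (2 * \<sigma>\<^sup>2)"
      unfolding dotp_def by (simp only: sum_divide_distrib[symmetric] sum_negf sum.distrib sum_distrib_left)
    finally show "g (\<lambda>i\<in>{..<d}. u i + v i) * (\<Prod>i<d. ennreal (exp (- (2 * (u i * v i) + v i * v i) / (2 * \<sigma>\<^sup>2))))
      = g (vadd d u v) * ennreal (exp (- (2 * dotp d u v + dotp d v v) / (2 * \<sigma>\<^sup>2)))"
      by (simp add: vadd_def)
  qed
  finally show ?thesis .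
qed

lemma nn_integral_gauss_minus:
  assumes \<sigma>: "0 < \<sigma>" and g: "g \<in> borel_measurable (euclid d)"
  shows "(\<integral>\<^sup>+u. g u \<partial>gauss d \<sigma>) = (\<integral>\<^sup>+u. g (\<lambda>i\<in>{..<d}. - u i) \<partial>gauss d \<sigma>)"
proof -
  have g': "g \<in> borel_measurable (\<Pi>\<^sub>M i\<in>{..<d}. normal0 \<sigma>)" using g sets_gauss[of d \<sigma>] by (simp add: gauss_def cong: measurable_cong_sets)
  have "(\<integral>\<^sup>+u. g u \<partial>gauss d \<sigma>) = (\<integral>\<^sup>+u. g (\<lambda>i\<in>{..<d}. - u i) * (\<Prod>i<d. 1) \<partial>gauss d \<sigma>)"
    unfolding gauss_def
  proof (rule nn_integral_PiM_transform[OF prob_space_normal0[OF \<sigma>]])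
    show "(\<integral>\<^sup>+x. g x \<partial>normal0 \<sigma>) = (\<integral>\<^sup>+x. g (- x) * 1 \<partial>normal0 \<sigma>)"
      if "g \<in> borel_measurable (normal0 \<sigma>)" for g :: "real \<Rightarrow> ennreal"
      using nn_integral_normal0_minus[OF that] by simp
  qed (use g' in \<open>simp_all add: measurable_cong_sets[OF sets_normal0 refl]\<close>)
  then show ?thesis by simp
qed

lemma gauss_moments:
  assumes \<sigma>: "0 < \<sigma>" and ij: "i < d" "j < d"
  shows "integrable (gauss d \<sigma>) (\<lambda>u. u i)" "(\<integral>u. u i \<partial>gauss d \<sigma>) = 0"
    "integrable (gauss d \<sigma>) (\<lambda>u. u i * u j)" "(\<integral>u. u i * u j \<partial>gauss d \<sigma>) = (if i = j then \<sigma>\<^sup>2 else 0)"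
proof -
  note N = prob_space_normal0[OF \<sigma>]
  note 1 = PiM_component_integral[OF N, of i "{..<d}" "\<lambda>x. x", folded gauss_def]
  show "integrable (gauss d \<sigma>) (\<lambda>u. u i)" "(\<integral>u. u i \<partial>gauss d \<sigma>) = 0"
    using 1 normal0_moments[OF \<sigma>] ij by auto
  have "integrable (gauss d \<sigma>) (\<lambda>u. u i * u j) \<and> (\<integral>u. u i * u j \<partial>gauss d \<sigma>) = (if i = j then \<sigma>\<^sup>2 else 0)"
  proof (cases "i = j")
    case True
    then show ?thesis
      using PiM_component_integral[OF N, of i "{..<d}" "\<lambda>x. x * x", folded gauss_def] normal0_moments[OF \<sigma>] ij by auto
  next
    case False
    then show ?thesis
      using PiM_two_components_integral[OF N, of i "{..<d}" j "\<lambda>x. x" "\<lambda>x. x", folded gauss_def] normal0_moments[OF \<sigma>] ij by auto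
  qed
  then show "integrable (gauss d \<sigma>) (\<lambda>u. u i * u j)" "(\<integral>u. u i * u j \<partial>gauss d \<sigma>) = (if i = j then \<sigma>\<^sup>2 else 0)"
    by auto
qed

lemma gauss_dotp:
  assumes \<sigma>: "0 < \<sigma>"
  shows "integrable (gauss d \<sigma>) (\<lambda>u. dotp d u v)" "(\<integral>u. dotp d u v \<partial>gauss d \<sigma>) = 0"
  unfolding dotp_def using gauss_moments(1,2)[OF \<sigma>]
  by (auto intro!: Bochner_Integration.integrable_sum simp: Bochner_Integration.integral_sum)

lemma qform_expand: "qform d A x = (\<Sum>i<d. \<Sum>j<d. A i j * (x i * x j))"
  unfolding qform_def dotp_def mat_vec_def by (simp add: sum_distrib_left ac_simps)

text \<open>Terms linear in the noise have mean 0, and its coordinates are uncorrelated with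
  variance \<open>\<sigma>\<^sup>2\<close>; only the trace is added.\<close>

lemma gauss_qform:
  assumes \<sigma>: "0 < \<sigma>"
  shows "integrable (gauss d \<sigma>) (\<lambda>u. qform d A (vadd d u v))"
    "(\<integral>u. qform d A (vadd d u v) \<partial>gauss d \<sigma>) = qform d A v + \<sigma>\<^sup>2 * mat_trace d A"
proof -
  interpret prob_space "gauss d \<sigma>" by (rule prob_space_gauss[OF \<sigma>])
  have q: "qform d A (vadd d u v) = (\<Sum>i<d. \<Sum>j<d. A i j * (u i * u j + v j * u i + v i * u j + v i * v j))" for u
    unfolding qform_expand vadd_def by (intro sum.cong refl) (simp add: algebra_simps)
  have int: "integrable (gauss d \<sigma>) (\<lambda>u. A i j * (u i * u j + v j * u i + v i * u j + v i * v j))"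
    if "i < d" "j < d" for i j
    using gauss_moments[OF \<sigma> that] gauss_moments(1)[OF \<sigma> that(2,1)] by (intro integrable_mult_right Bochner_Integration.integrable_add) auto
  show "integrable (gauss d \<sigma>) (\<lambda>u. qform d A (vadd d u v))"
    unfolding q by (intro Bochner_Integration.integrable_sum int) auto
  have e: "(\<integral>u. A i j * (u i * u j + v j * u i + v i * u j + v i * v j) \<partial>gauss d \<sigma>) = A i j * (v i * v j) + (if j = i then \<sigma>\<^sup>2 * A i i else 0)"
    if "i < d" "j < d" for i j
    using gauss_moments[OF \<sigma> that] gauss_moments[OF \<sigma> that(2,1)]
    by (simp add: prob_space) (simp add: algebra_simps)
  have "(\<integral>u. qform d A (vadd d u v) \<partial>gauss d \<sigma>) = (\<Sum>i<d. \<Sum>j<d. (\<integral>u. A i j * (u i * u j + v j * u i + v i * u j + v i * v j) \<partial>gauss d \<sigma>))"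
    unfolding q by (subst Bochner_Integration.integral_sum; (intro sum.cong refl Bochner_Integration.integral_sum Bochner_Integration.integrable_sum int)?) (auto intro: int)
  also have "\<dots> = (\<Sum>i<d. \<Sum>j<d. A i j * (v i * v j) + (if j = i then \<sigma>\<^sup>2 * A i i else 0))"
    by (intro sum.cong refl e) auto
  also have "\<dots> = qform d A v + \<sigma>\<^sup>2 * mat_trace d A"
    by (simp add: qform_expand sum.distrib mat_trace_def sum_distrib_left)
  finally show "(\<integral>u. qform d A (vadd d u v) \<partial>gauss d \<sigma>) = qform d A v + \<sigma>\<^sup>2 * mat_trace d A" .
qed

text \<open>The Donsker--Varadhan inequality for a centred Gaussian and its translate by \<open>v\<close>, whose relative
  entropy is \<open>\<parallel>v\<parallel>\<^sup>2 / (2 \<sigma>\<^sup>2)\<close>.\<close>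

lemma gauss_change_of_measure:
  assumes \<sigma>: "0 < \<sigma>" and h[measurable]: "h \<in> borel_measurable (euclid d)"
    and int: "integrable (gauss d \<sigma>) (\<lambda>u. h (vadd d u v))"
    and C: "0 < C" "(\<integral>\<^sup>+u. ennreal (exp (h u)) \<partial>gauss d \<sigma>) \<le> ennreal C"
  shows "(\<integral>u. h (vadd d u v) \<partial>gauss d \<sigma>) \<le> dotp d v v / (2 * \<sigma>\<^sup>2) + ln C"
proof -
  interpret prob_space "gauss d \<sigma>" by (rule prob_space_gauss[OF \<sigma>])
  define c where "c = 1 / (2 * \<sigma>\<^sup>2)"
  \<comment> \<open>The translated exponent plus the logarithm of the likelihood ratio. The part
    linear in \<open>u\<close> has mean 0, so the mean of \<open>Y\<close> is the mean of the
    translated \<open>h\<close> minus the relative entropy.\<close>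
  define Y where "Y = (\<lambda>u. h (vadd d u v) - c * (2 * dotp d u v + dotp d v v))"
  have intY: "integrable (gauss d \<sigma>) Y"
    unfolding Y_def using int gauss_dotp(1)[OF \<sigma>]
    by (intro Bochner_Integration.integrable_diff integrable_mult_right Bochner_Integration.integrable_add) auto
  define a where "a = (\<integral>u. Y u \<partial>gauss d \<sigma>)"
  have a: "a = (\<integral>u. h (vadd d u v) \<partial>gauss d \<sigma>) - dotp d v v / (2 * \<sigma>\<^sup>2)"
    unfolding a_def Y_def using int gauss_dotp[OF \<sigma>, of d v]
    by (simp add: prob_space c_def)
  have "(\<integral>\<^sup>+u. ennreal (exp (h u)) \<partial>gauss d \<sigma>) = (\<integral>\<^sup>+u. ennreal (exp (h (vadd d u v))) * ennreal (exp (- (2 * dotp d u v + dotp d v v) / (2 * \<sigma>\<^sup>2))) \<partial>gauss d \<sigma>)"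
    by (rule nn_integral_gauss_shift[OF \<sigma>]) measurable
  also have "\<dots> = (\<integral>\<^sup>+u. ennreal (exp (Y u)) \<partial>gauss d \<sigma>)"
    by (intro nn_integral_cong) (simp add: ennreal_mult'[symmetric] exp_add[symmetric] Y_def c_def add_divide_distrib diff_divide_distrib)
  finally have le: "(\<integral>\<^sup>+u. ennreal (exp (Y u)) \<partial>gauss d \<sigma>) \<le> ennreal C" using C by simp
  have "Y \<in> borel_measurable (gauss d \<sigma>)" using intY by (rule borel_measurable_integrable)
  then have intE: "integrable (gauss d \<sigma>) (\<lambda>u. exp (Y u))"
    using le by (intro integrableI_nonneg) (auto simp: less_top[symmetric] top_unique dest: order_trans)
  \<comment> \<open>Jensen's inequality for \<open>exp\<close>, through its tangent at the mean
    \<open>a\<close> of \<open>Y\<close>.\<close>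
  have "exp a = (\<integral>u. exp a * (1 + (Y u - a)) \<partial>gauss d \<sigma>)"
    using intY by (simp add: prob_space a_def[symmetric])
  also have "\<dots> \<le> (\<integral>u. exp (Y u) \<partial>gauss d \<sigma>)"
  proof (rule integral_mono)
    fix u
    have "exp a * (1 + (Y u - a)) \<le> exp a * exp (Y u - a)" by (intro mult_left_mono exp_ge_add_one_self) auto
    also have "\<dots> = exp (Y u)" by (simp add: exp_add[symmetric])
    finally show "exp a * (1 + (Y u - a)) \<le> exp (Y u)" .
  qed (use intY intE in auto)
  also have "\<dots> \<le> C"
    using le C intE by (simp add: nn_integral_eq_integral)
  finally have "a \<le> ln C" using C by (simp add: ln_ge_iff)
  then show ?thesis using a by linarith
qed

section \<open>PAC-Bayes bound for block counts\<close>

lemma measurable_qform: "qform d A \<in> borel_measurable (euclid d)"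
  unfolding qform_expand[abs_def] by (intro borel_measurable_sum borel_measurable_times measurable_euclid_component borel_measurable_const) auto

text \<open>By Tonelli's theorem the Gaussian average \<open>G\<close> of
  \<open>exp (f - b)\<close>, with \<open>b\<close> the exponent allowed by \<open>mgf\<close>, has
  expectation at most 1, so by Markov's inequality it is at most \<open>1 / \<delta>\<close> on an
  event of probability \<open>1 - \<delta>\<close>. There the change of measure applies to every
  translate at once, which is why one event serves all \<open>v\<close>.\<close>

lemma pac_bayes_event:
  fixes f :: "(nat \<Rightarrow> real) \<Rightarrow> 'a \<Rightarrow> real"
  assumes \<sigma>: "0 < \<sigma>" and M: "prob_space M"
    and f: "case_prod f \<in> borel_measurable (euclid d \<Otimes>\<^sub>M M)"
    and bnd: "\<And>u \<omega>. \<bar>f u \<omega>\<bar> \<le> B"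
    and mgf: "\<And>u. u \<in> space (euclid d) \<Longrightarrow> (\<integral>\<^sup>+\<omega>. ennreal (exp (f u \<omega>)) \<partial>M) \<le> ennreal (exp (c0 + c1 * qform d A u))"
    and \<delta>: "0 < \<delta>"
  shows "\<exists>E\<in>sets M. 1 - \<delta> \<le> measure M E \<and> (\<forall>\<omega>\<in>E. \<forall>v. (\<integral>u. f (vadd d u v) \<omega> \<partial>gauss d \<sigma>)
    \<le> dotp d v v / (2 * \<sigma>\<^sup>2) + ln (1 / \<delta>) + c0 + c1 * (qform d A v + \<sigma>\<^sup>2 * mat_trace d A))"
proof -
  interpret M: prob_space M by (rule M)
  interpret \<mu>: prob_space "gauss d \<sigma>" by (rule prob_space_gauss[OF \<sigma>])
  interpret pair_prob_space M "gauss d \<sigma>" ..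
  note [measurable] = f measurable_qform
  define b where "b = (\<lambda>u. c0 + c1 * qform d A u)"
  have bm[measurable]: "b \<in> borel_measurable (euclid d)" unfolding b_def by measurable
  define h where "h = (\<lambda>\<omega> u. f u \<omega> - b u)"
  have fm[measurable]: "(\<lambda>(\<omega>, u). f u \<omega>) \<in> borel_measurable (M \<Otimes>\<^sub>M euclid d)"
    using measurable_compose[OF measurable_pair_swap' f] by (simp add: case_prod_beta')
  have hm[measurable]: "(\<lambda>(\<omega>, u). h \<omega> u) \<in> borel_measurable (M \<Otimes>\<^sub>M euclid d)"
    unfolding h_def by measurable
  have hm': "(\<lambda>(\<omega>, u). ennreal (exp (h \<omega> u))) \<in> borel_measurable (M \<Otimes>\<^sub>M gauss d \<sigma>)"
    by measurable
  define G where "G = (\<lambda>\<omega>. \<integral>\<^sup>+u. ennreal (exp (h \<omega> u)) \<partial>gauss d \<sigma>)"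
  have Gm[measurable]: "G \<in> borel_measurable M"
    unfolding G_def using hm' by (intro \<mu>.borel_measurable_nn_integral) (simp add: case_prod_beta')
  have "(\<integral>\<^sup>+\<omega>. G \<omega> \<partial>M) = (\<integral>\<^sup>+u. (\<integral>\<^sup>+\<omega>. ennreal (exp (h \<omega> u)) \<partial>M) \<partial>gauss d \<sigma>)"
    unfolding G_def by (rule Fubini'[OF hm', symmetric])
  also have "\<dots> \<le> (\<integral>\<^sup>+u. 1 \<partial>gauss d \<sigma>)"
  proof (rule nn_integral_mono)
    fix u assume "u \<in> space (gauss d \<sigma>)"
    then have u: "u \<in> space (euclid d)" by (simp add: space_gauss)
    have fu: "f u \<in> borel_measurable M" using measurable_Pair2[OF f u] by simp
    have "(\<integral>\<^sup>+\<omega>. ennreal (exp (h \<omega> u)) \<partial>M) = (\<integral>\<^sup>+\<omega>. ennreal (exp (f u \<omega>)) * ennreal (exp (- b u)) \<partial>M)"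
      by (intro nn_integral_cong) (simp add: h_def ennreal_mult'[symmetric] exp_add[symmetric])
    also have "\<dots> = (\<integral>\<^sup>+\<omega>. ennreal (exp (f u \<omega>)) \<partial>M) * ennreal (exp (- b u))"
      using measurable_compose[OF fu borel_measurable_exp] by (intro nn_integral_multc) simp
    also have "\<dots> \<le> ennreal (exp (b u)) * ennreal (exp (- b u))"
      using mgf[OF u] by (intro mult_right_mono) (auto simp: b_def)
    also have "\<dots> = 1" by (simp add: ennreal_mult'[symmetric] exp_add[symmetric])
    finally show "(\<integral>\<^sup>+\<omega>. ennreal (exp (h \<omega> u)) \<partial>M) \<le> 1" .
  qed
  also have "\<dots> = 1" by (simp add: \<mu>.emeasure_space_1)
  finally have G1: "(\<integral>\<^sup>+\<omega>. G \<omega> \<partial>M) \<le> 1" .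
  define E where "E = {\<omega> \<in> space M. \<not> 1 \<le> ennreal \<delta> * G \<omega>}"
  have Em: "E \<in> sets M" unfolding E_def by measurable
  have "emeasure M {\<omega> \<in> space M. 1 \<le> ennreal \<delta> * G \<omega>} \<le> ennreal \<delta> * (\<integral>\<^sup>+\<omega>. G \<omega> * indicator (space M) \<omega> \<partial>M)"
    by (rule nn_integral_Markov_inequality) auto
  also have "(\<integral>\<^sup>+\<omega>. G \<omega> * indicator (space M) \<omega> \<partial>M) = (\<integral>\<^sup>+\<omega>. G \<omega> \<partial>M)"
    by (intro nn_integral_cong) auto
  also have "ennreal \<delta> * (\<integral>\<^sup>+\<omega>. G \<omega> \<partial>M) \<le> ennreal \<delta> * 1" by (intro mult_left_mono G1) simp
  finally have "measure M {\<omega> \<in> space M. 1 \<le> ennreal \<delta> * G \<omega>} \<le> \<delta>"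
    using \<delta> by (simp add: M.emeasure_eq_measure)
  moreover have "measure M E = 1 - measure M {\<omega> \<in> space M. 1 \<le> ennreal \<delta> * G \<omega>}"
    unfolding E_def by (rule M.prob_neg) measurable
  ultimately have PE: "1 - \<delta> \<le> measure M E" by simp
  show ?thesis
  proof (intro bexI[OF _ Em] conjI PE ballI allI)
    fix \<omega> v assume \<omega>: "\<omega> \<in> E"
    then have \<omega>M: "\<omega> \<in> space M" and "\<not> 1 \<le> ennreal \<delta> * G \<omega>" by (auto simp: E_def)
    then have "ennreal \<delta> * G \<omega> \<le> 1" by auto
    then have "G \<omega> \<le> ennreal (1 / \<delta>)"
    proof -
      assume a: "ennreal \<delta> * G \<omega> \<le> 1"
      have "G \<omega> = ennreal (1 / \<delta>) * (ennreal \<delta> * G \<omega>)"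
        using \<delta> by (simp add: mult.assoc[symmetric] ennreal_mult'[symmetric])
      also have "\<dots> \<le> ennreal (1 / \<delta>) * 1" by (intro mult_left_mono a) simp
      finally show ?thesis by simp
    qed
    moreover have h\<omega>[measurable]: "h \<omega> \<in> borel_measurable (euclid d)"
      using measurable_Pair2[OF hm \<omega>M] by simp
    moreover have f\<omega>: "(\<lambda>u. f (vadd d u v) \<omega>) \<in> borel_measurable (euclid d)"
      using measurable_compose[OF measurable_vadd measurable_Pair2[OF fm \<omega>M]] by simp
    then have intf: "integrable (gauss d \<sigma>) (\<lambda>u. f (vadd d u v) \<omega>)"
      using bnd by (intro \<mu>.integrable_const_bound[of _ B]) auto
    have intb: "integrable (gauss d \<sigma>) (\<lambda>u. b (vadd d u v))"
      unfolding b_def using gauss_qform(1)[OF \<sigma>] by (intro Bochner_Integration.integrable_add integrable_mult_right) auto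
    have "integrable (gauss d \<sigma>) (\<lambda>u. h \<omega> (vadd d u v))"
      unfolding h_def by (intro Bochner_Integration.integrable_diff intf intb)
    ultimately have "(\<integral>u. h \<omega> (vadd d u v) \<partial>gauss d \<sigma>) \<le> dotp d v v / (2 * \<sigma>\<^sup>2) + ln (1 / \<delta>)"
      using \<delta> by (intro gauss_change_of_measure[OF \<sigma>]) (auto simp: G_def)
    moreover have "(\<integral>u. h \<omega> (vadd d u v) \<partial>gauss d \<sigma>) = (\<integral>u. f (vadd d u v) \<omega> \<partial>gauss d \<sigma>) - (\<integral>u. b (vadd d u v) \<partial>gauss d \<sigma>)"
      unfolding h_def by (rule Bochner_Integration.integral_diff[OF intf intb])
    moreover have "(\<integral>u. b (vadd d u v) \<partial>gauss d \<sigma>) = c0 + c1 * (qform d A v + \<sigma>\<^sup>2 * mat_trace d A)"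
      unfolding b_def using gauss_qform[OF \<sigma>, of d A v] by (simp add: \<mu>.prob_space)
    ultimately show "(\<integral>u. f (vadd d u v) \<omega> \<partial>gauss d \<sigma>)
      \<le> dotp d v v / (2 * \<sigma>\<^sup>2) + ln (1 / \<delta>) + c0 + c1 * (qform d A v + \<sigma>\<^sup>2 * mat_trace d A)" by linarith
  qed
qed

lemma measurable_dotp_const: "(\<lambda>u. dotp d w u) \<in> borel_measurable (euclid d)"
  by (intro measurable_dotp borel_measurable_const measurable_euclid_component)

text \<open>The reflection \<open>u \<mapsto> - u\<close> preserves the Gaussian and exchanges the
  two closed half-spaces, which together cover everything.\<close>

lemma gauss_halfspace:
  assumes \<sigma>: "0 < \<sigma>"
  shows "1 / 2 \<le> measure (gauss d \<sigma>) {u \<in> space (euclid d). 0 \<le> dotp d w u}"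
proof -
  interpret \<mu>: prob_space "gauss d \<sigma>" by (rule prob_space_gauss[OF \<sigma>])
  note [measurable] = measurable_dotp_const
  let ?P = "{u \<in> space (euclid d). 0 \<le> dotp d w u}" and ?N = "{u \<in> space (euclid d). dotp d w u \<le> 0}"
  have m: "?P \<in> sets (euclid d)" "?N \<in> sets (euclid d)" by measurable
  have "emeasure (gauss d \<sigma>) ?P = (\<integral>\<^sup>+u. indicator ?P u \<partial>gauss d \<sigma>)" using m by simp
  also have "\<dots> = (\<integral>\<^sup>+u. indicator ?P (\<lambda>i\<in>{..<d}. - u i) \<partial>gauss d \<sigma>)"
    using m by (intro nn_integral_gauss_minus[OF \<sigma>]) simp
  also have "\<dots> = (\<integral>\<^sup>+u. indicator ?N u \<partial>gauss d \<sigma>)"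
  proof (rule nn_integral_cong)
    fix u assume u: "u \<in> space (gauss d \<sigma>)"
    have "dotp d w (\<lambda>i\<in>{..<d}. - u i) = dotp d w (\<lambda>i. (- 1) * u i)" by (rule dotp_cong) auto
    then have "dotp d w (\<lambda>i\<in>{..<d}. - u i) = - dotp d w u" by (simp only: dotp_scale_right)
    then show "indicator ?P (\<lambda>i\<in>{..<d}. - u i) = (indicator ?N u :: ennreal)"
      using u by (auto simp: indicator_def space_gauss space_euclid)
  qed
  also have "\<dots> = emeasure (gauss d \<sigma>) ?N" using m by simp
  finally have eq: "measure (gauss d \<sigma>) ?P = measure (gauss d \<sigma>) ?N" by (simp add: \<mu>.emeasure_eq_measure)
  have "?P \<union> ?N = space (gauss d \<sigma>)" by (auto simp: space_gauss)
  then have "1 = measure (gauss d \<sigma>) (?P \<union> ?N)" using \<mu>.prob_space by simp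
  also have "\<dots> \<le> measure (gauss d \<sigma>) ?P + measure (gauss d \<sigma>) ?N"
    using m by (intro measure_Un_le) simp_all
  finally show ?thesis using eq by simp
qed

text \<open>Smoothing costs a factor \<open>2\<close>: with probability \<open>1/2\<close> the Gaussian perturbation moves further out.\<close>

lemma indicator_le_smoothed:
  assumes \<sigma>: "0 < \<sigma>"
  shows "(indicator {x. t < \<bar>x\<bar>} (dotp d w v) :: real) \<le> 2 * (\<integral>u. indicator {x. t < \<bar>x\<bar>} (dotp d w (vadd d u v)) \<partial>gauss d \<sigma>)"
proof (cases "t < \<bar>dotp d w v\<bar>")
  case True
  interpret \<mu>: prob_space "gauss d \<sigma>" by (rule prob_space_gauss[OF \<sigma>])
  \<comment> \<open>With this sign, noise having a nonnegative product with \<open>w'\<close> can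
    only increase the absolute value of the product of \<open>w\<close> and
    \<open>v\<close>.\<close>
  define w' where "w' = (\<lambda>i. sgn (dotp d w v) * w i)"
  let ?E = "{u \<in> space (euclid d). t < \<bar>dotp d w (vadd d u v)\<bar>}"
  note [measurable] = measurable_dotp_const measurable_vadd
  have Em: "?E \<in> sets (euclid d)" unfolding dotp_vadd by measurable
  have w': "dotp d w' u = sgn (dotp d w v) * dotp d w u" for u
    unfolding w'_def by (rule dotp_scale_left)
  have "{u \<in> space (euclid d). 0 \<le> dotp d w' u} \<subseteq> ?E"
    using True by (auto simp: w' dotp_vadd sgn_if zero_le_mult_iff split: if_splits)
  then have "1 / 2 \<le> measure (gauss d \<sigma>) ?E"
    using gauss_halfspace[OF \<sigma>, of d w'] \<mu>.finite_measure_mono[of "{u \<in> space (euclid d). 0 \<le> dotp d w' u}" ?E] Em by simp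
  also have "\<dots> = (\<integral>u. indicator ?E u \<partial>gauss d \<sigma>)"
    using Em sets.sets_into_space[OF Em] by (simp add: space_gauss Int_absorb2 Int_absorb1)
  also have "\<dots> = (\<integral>u. indicator {x. t < \<bar>x\<bar>} (dotp d w (vadd d u v)) \<partial>gauss d \<sigma>)"
    by (intro Bochner_Integration.integral_cong) (auto simp: indicator_def space_gauss)
  finally show ?thesis by (simp add: indicator_def)
next
  case False
  then show ?thesis by simp
qed

text \<open>The count in direction \<open>v\<close> is at most twice its Gaussian average around
  \<open>v\<close>, and that average is what the PAC-Bayes bound controls. The threshold
  \<open>t\<close> is not scaled with the direction; the perturbed directions need no
  normalisation.\<close>

lemma uniform_count_event:
  fixes W :: "nat \<Rightarrow> 'a \<Rightarrow> nat \<Rightarrow> real" and K :: nat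
  assumes \<sigma>: "0 < \<sigma>" and M: "prob_space M"
    and W: "\<And>k i. k < K \<Longrightarrow> i < d \<Longrightarrow> (\<lambda>\<omega>. W k \<omega> i) \<in> borel_measurable M"
    and mgf: "\<And>u. u \<in> space (euclid d) \<Longrightarrow> (\<integral>\<^sup>+\<omega>. ennreal (exp (\<Sum>k<K. indicator {x. t < \<bar>x\<bar>} (dotp d (W k \<omega>) u))) \<partial>M)
      \<le> ennreal (exp (c0 + c1 * qform d A u))"
    and \<delta>: "0 < \<delta>"
  shows "\<exists>E\<in>sets M. 1 - \<delta> \<le> measure M E \<and> (\<forall>\<omega>\<in>E. \<forall>v. real (card {k\<in>{..<K}. t < \<bar>dotp d (W k \<omega>) v\<bar>})
    \<le> 2 * (dotp d v v / (2 * \<sigma>\<^sup>2) + ln (1 / \<delta>) + c0 + c1 * (qform d A v + \<sigma>\<^sup>2 * mat_trace d A)))"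
proof -
  interpret \<mu>: prob_space "gauss d \<sigma>" by (rule prob_space_gauss[OF \<sigma>])
  define I where "I = (indicator {x. t < \<bar>x\<bar>} :: real \<Rightarrow> real)"
  have Im[measurable]: "I \<in> borel_measurable borel" unfolding I_def by measurable
  define f where "f = (\<lambda>u \<omega>. \<Sum>k<K. I (dotp d (W k \<omega>) u))"
  have fm: "case_prod f \<in> borel_measurable (euclid d \<Otimes>\<^sub>M M)"
    unfolding f_def case_prod_beta'
    by (intro borel_measurable_sum measurable_compose[OF _ Im] measurable_dotp
        measurable_compose[OF measurable_snd W] measurable_compose[OF measurable_fst measurable_euclid_component]) auto
  have "\<bar>f u \<omega>\<bar> \<le> real K" for u \<omega>
  proof -
    have "\<bar>f u \<omega>\<bar> \<le> (\<Sum>k<K. \<bar>I (dotp d (W k \<omega>) u)\<bar>)" unfolding f_def by (rule sum_abs)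
    also have "\<dots> \<le> (\<Sum>k<K. 1)" by (intro sum_mono) (simp add: I_def indicator_def)
    finally show ?thesis by simp
  qed
  from pac_bayes_event[OF \<sigma> M fm this, of c0 c1 A \<delta>] mgf \<delta>
  obtain E where E: "E \<in> sets M" "1 - \<delta> \<le> measure M E"
    and bound: "\<And>\<omega> v. \<omega> \<in> E \<Longrightarrow> (\<integral>u. f (vadd d u v) \<omega> \<partial>gauss d \<sigma>)
      \<le> dotp d v v / (2 * \<sigma>\<^sup>2) + ln (1 / \<delta>) + c0 + c1 * (qform d A v + \<sigma>\<^sup>2 * mat_trace d A)"
    unfolding f_def I_def by blast
  show ?thesis
  proof (intro bexI[OF _ E(1)] conjI E(2) ballI allI)
    fix \<omega> v assume \<omega>: "\<omega> \<in> E"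
    have int: "integrable (gauss d \<sigma>) (\<lambda>u. I (dotp d (W k \<omega>) (vadd d u v)))" for k
    proof (rule \<mu>.integrable_const_bound[of _ 1])
      show "(\<lambda>u. I (dotp d (W k \<omega>) (vadd d u v))) \<in> borel_measurable (gauss d \<sigma>)"
        using measurable_compose[OF measurable_compose[OF measurable_vadd measurable_dotp_const] Im] by simp
    qed (simp add: I_def indicator_def)
    have "real (card {k\<in>{..<K}. t < \<bar>dotp d (W k \<omega>) v\<bar>}) = (\<Sum>k<K. I (dotp d (W k \<omega>) v))"
      by (simp add: I_def indicator_def sum.If_cases Int_def)
    also have "\<dots> \<le> (\<Sum>k<K. 2 * (\<integral>u. I (dotp d (W k \<omega>) (vadd d u v)) \<partial>gauss d \<sigma>))"
      unfolding I_def by (intro sum_mono indicator_le_smoothed[OF \<sigma>])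
    also have "\<dots> = 2 * (\<integral>u. f (vadd d u v) \<omega> \<partial>gauss d \<sigma>)"
      unfolding f_def by (subst Bochner_Integration.integral_sum) (auto simp: int sum_distrib_left)
    also have "\<dots> \<le> 2 * (dotp d v v / (2 * \<sigma>\<^sup>2) + ln (1 / \<delta>) + c0 + c1 * (qform d A v + \<sigma>\<^sup>2 * mat_trace d A))"
      using bound[OF \<omega>, of v] by simp
    finally show "real (card {k\<in>{..<K}. t < \<bar>dotp d (W k \<omega>) v\<bar>})
      \<le> 2 * (dotp d v v / (2 * \<sigma>\<^sup>2) + ln (1 / \<delta>) + c0 + c1 * (qform d A v + \<sigma>\<^sup>2 * mat_trace d A))" .
  qed
qed

section \<open>Contaminated block sums\<close>

text \<open>The exponent takes only the values 0 and 1, and \<open>exp 1 \<le> 3\<close>; hence the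
  mean is at most \<open>1 + 2 * q \<le> exp (2 * q)\<close>.\<close>

lemma nn_integral_exp_indicator_le:
  assumes M: "prob_space M" and A: "A \<in> sets M" and q: "measure M A \<le> q"
  shows "(\<integral>\<^sup>+\<omega>. ennreal (exp (indicator A \<omega>)) \<partial>M) \<le> ennreal (exp (2 * q))"
proof -
  interpret prob_space M by (rule M)
  have "(\<integral>\<^sup>+\<omega>. ennreal (exp (indicator A \<omega>)) \<partial>M) \<le> (\<integral>\<^sup>+\<omega>. 1 + 2 * indicator A \<omega> \<partial>M)"
  proof (rule nn_integral_mono)
    have "ennreal (exp 1) \<le> 1 + 2" using ennreal_leI[OF exp_le] by simp
    then show "ennreal (exp (indicator A \<omega>)) \<le> 1 + 2 * indicator A \<omega>" for \<omega>
      by (simp add: indicator_def)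
  qed
  also have "\<dots> = 1 + 2 * emeasure M A"
    using A by (simp add: nn_integral_add nn_integral_cmult emeasure_space_1)
  also have "\<dots> = ennreal (1 + 2 * measure M A)"
    by (simp add: emeasure_eq_measure ennreal_mult)
  also have "\<dots> \<le> ennreal (exp (2 * q))"
    using q exp_ge_add_one_self[of "2 * q"] by (intro ennreal_leI) linarith
  finally show ?thesis .
qed

lemma mgf_independent_indicators:
  fixes X :: "nat \<Rightarrow> 'a \<Rightarrow> real"
  assumes M: "prob_space M" and ind: "prob_space.indep_vars M (\<lambda>_. borel) X {..<K}"
    and q: "\<And>k. k < K \<Longrightarrow> measure M {\<omega> \<in> space M. t < \<bar>X k \<omega>\<bar>} \<le> q"
  shows "(\<integral>\<^sup>+\<omega>. ennreal (exp (\<Sum>k<K. indicator {x. t < \<bar>x\<bar>} (X k \<omega>))) \<partial>M) \<le> ennreal (exp (real K * (2 * q)))"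
proof -
  interpret prob_space M by (rule M)
  define Y where "Y = (\<lambda>k \<omega>. ennreal (exp (indicator {x. t < \<bar>x\<bar>} (X k \<omega>))))"
  have "indep_vars (\<lambda>_. borel) Y {..<K}"
    unfolding Y_def by (rule indep_vars_compose2[OF ind]) measurable
  then have "(\<integral>\<^sup>+\<omega>. (\<Prod>k<K. Y k \<omega>) \<partial>M) = (\<Prod>k<K. \<integral>\<^sup>+\<omega>. Y k \<omega> \<partial>M)"
    by (intro indep_vars_nn_integral) auto
  also have "\<dots> \<le> (\<Prod>k<K. ennreal (exp (2 * q)))"
  proof (intro prod_mono_ennreal)
    fix k assume k: "k \<in> {..<K}"
    have [measurable]: "X k \<in> borel_measurable M" using ind k by (auto simp: indep_vars_def)
    have "(\<integral>\<^sup>+\<omega>. Y k \<omega> \<partial>M) = (\<integral>\<^sup>+\<omega>. ennreal (exp (indicator {\<omega> \<in> space M. t < \<bar>X k \<omega>\<bar>} \<omega>)) \<partial>M)"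
      unfolding Y_def by (intro nn_integral_cong) (simp add: indicator_def)
    also have "\<dots> \<le> ennreal (exp (2 * q))"
      using q k by (intro nn_integral_exp_indicator_le[OF M]) auto
    finally show "(\<integral>\<^sup>+\<omega>. Y k \<omega> \<partial>M) \<le> ennreal (exp (2 * q))" .
  qed
  also have "\<dots> = ennreal (exp (real K * (2 * q)))"
    by (simp add: ennreal_power exp_of_nat_mult)
  finally show ?thesis by (simp add: Y_def exp_sum prod_ennreal)
qed

section \<open>Tails of sums of contaminated observations\<close>

lemma nn_integral_mixture:
  assumes P: "prob_space P" "sets P = sets R" and Q: "prob_space Q" "sets Q = sets R" and R: "prob_space R"
    and \<epsilon>: "0 \<le> \<epsilon>" "\<epsilon> \<le> 1" and mix: "is_mixture \<epsilon> R P Q" and g: "g \<in> borel_measurable R"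
  shows "(\<integral>\<^sup>+x. g x \<partial>R) = ennreal (1 - \<epsilon>) * (\<integral>\<^sup>+x. g x \<partial>P) + ennreal \<epsilon> * (\<integral>\<^sup>+x. g x \<partial>Q)"
proof -
  interpret P: prob_space P by (rule P)
  interpret Q: prob_space Q by (rule Q)
  interpret R: prob_space R by (rule R)
  note cs = measurable_cong_sets[OF P(2) refl] measurable_cong_sets[OF Q(2) refl]
  have sp: "space P = space R" "space Q = space R"
    using P(2) Q(2) by (auto dest: sets_eq_imp_space_eq)
  show ?thesis
    using g
  proof (induction rule: borel_measurable_induct)
    case (cong f g)
    have "(\<integral>\<^sup>+x. f x \<partial>M) = (\<integral>\<^sup>+x. g x \<partial>M)" if "space M = space R" for M
      using cong(3) that by (intro nn_integral_cong) auto
    then show ?case using cong(4) sp by simp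
  next
    case (set A)
    have "ennreal (measure R A) = ennreal ((1 - \<epsilon>) * measure P A) + ennreal (\<epsilon> * measure Q A)"
      using mix set \<epsilon> by (simp add: is_mixture_def)
    then show ?case
      using set P(2) Q(2) \<epsilon> by (simp add: P.emeasure_eq_measure Q.emeasure_eq_measure R.emeasure_eq_measure ennreal_mult)
  next
    case (mult u c)
    then show ?case by (simp add: nn_integral_cmult cs distrib_left ac_simps)
  next
    case (add u v)
    then show ?case by (simp add: nn_integral_add cs distrib_left ac_simps)
  next
    case (seq U)
    have inc: "incseq (\<lambda>i. \<integral>\<^sup>+x. U i x \<partial>M)" for M
      using seq(3) by (intro incseq_SucI nn_integral_mono) (auto simp: incseq_Suc_iff le_fun_def)
    have S: "(\<integral>\<^sup>+x. (SUP i. U i) x \<partial>M) = (SUP i. \<integral>\<^sup>+x. U i x \<partial>M)" if "sets M = sets R" for M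
      using seq(1,3) that unfolding SUP_apply
      by (intro nn_integral_monotone_convergence_SUP) (auto simp: measurable_cong_sets[OF that refl])
    have "(SUP i. ennreal (1 - \<epsilon>) * (\<integral>\<^sup>+x. U i x \<partial>P) + ennreal \<epsilon> * (\<integral>\<^sup>+x. U i x \<partial>Q))
       = (SUP i. ennreal (1 - \<epsilon>) * (\<integral>\<^sup>+x. U i x \<partial>P)) + (SUP i. ennreal \<epsilon> * (\<integral>\<^sup>+x. U i x \<partial>Q))"
      using inc by (intro ennreal_SUP_add) (auto intro!: mult_left_mono simp: incseq_def)
    then show ?case
      unfolding seq(5) S[OF refl] S[OF P(2)] S[OF Q(2)] by (simp add: seq.IH SUP_mult_left_ennreal)
  qed
qed

text \<open>The factors \<open>R\<close> are replaced by \<open>P\<close> one at a time. Each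
  replacement costs at most \<epsilon>, since the contaminating part has weight \<epsilon> and the
  integrand is at most 1. No hidden labels of contaminated observations have to be modelled.\<close>

lemma nn_integral_PiM_contaminated_le:
  fixes P Q R :: "'a measure" and J :: "'i set"
  assumes P: "prob_space P" "sets P = sets R" and Q: "prob_space Q" "sets Q = sets R" and R: "prob_space R"
    and \<epsilon>: "0 \<le> \<epsilon>" "\<epsilon> \<le> 1" and mix: "is_mixture \<epsilon> R P Q" and J: "finite J"
    and g: "g \<in> borel_measurable (\<Pi>\<^sub>M j\<in>J. R)" and g1: "\<And>x. g x \<le> 1"
  shows "(\<integral>\<^sup>+x. g x \<partial>(\<Pi>\<^sub>M j\<in>J. R)) \<le> (\<integral>\<^sup>+x. g x \<partial>(\<Pi>\<^sub>M j\<in>J. P)) + ennreal (real (card J) * \<epsilon>)"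
  using J g g1
proof (induction J arbitrary: g)
  case empty
  show ?case by (simp add: PiM_empty)
next
  case (insert i J)
  interpret P: prob_space P by (rule P)
  interpret Q: prob_space Q by (rule Q)
  interpret R: prob_space R by (rule R)
  interpret PP: product_sigma_finite "\<lambda>_::'i. P" by standard
  interpret RR: product_sigma_finite "\<lambda>_::'i. R" by standard
  interpret RJ: prob_space "\<Pi>\<^sub>M j\<in>J. R" by (intro prob_space_PiM R)
  note [measurable] = insert.prems(1)
  have sPR: "sets (\<Pi>\<^sub>M j\<in>J. P) = sets (\<Pi>\<^sub>M j\<in>J. R)" for J :: "'i set"
    using P(2) by (intro sets_PiM_cong) auto
  define G where "G = (\<lambda>x. \<integral>\<^sup>+y. g (x(i := y)) \<partial>P)"
  have gP: "g \<in> borel_measurable (\<Pi>\<^sub>M j\<in>insert i J. P)"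
    using insert.prems(1) by (simp add: measurable_cong_sets[OF sPR refl])
  have "(\<lambda>(x, y). x(i := y)) \<in> (\<Pi>\<^sub>M j\<in>J. P) \<Otimes>\<^sub>M P \<rightarrow>\<^sub>M (\<Pi>\<^sub>M j\<in>insert i J. P)" by measurable
  from measurable_compose[OF this gP]
  have "G \<in> borel_measurable (\<Pi>\<^sub>M j\<in>J. P)"
    unfolding G_def by (intro P.borel_measurable_nn_integral) (simp add: case_prod_beta')
  then have Gm: "G \<in> borel_measurable (\<Pi>\<^sub>M j\<in>J. R)" by (simp add: measurable_cong_sets[OF sPR refl])
  have G1: "G x \<le> 1" for x
  proof -
    have "G x \<le> (\<integral>\<^sup>+y. 1 \<partial>P)" unfolding G_def by (intro nn_integral_mono insert.prems)
    then show ?thesis by (simp add: P.emeasure_space_1)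
  qed
  have "(\<integral>\<^sup>+x. g x \<partial>(\<Pi>\<^sub>M j\<in>insert i J. R)) = (\<integral>\<^sup>+x. \<integral>\<^sup>+y. g (x(i := y)) \<partial>R \<partial>(\<Pi>\<^sub>M j\<in>J. R))"
    by (rule RR.product_nn_integral_insert) (use insert in auto)
  also have "\<dots> \<le> (\<integral>\<^sup>+x. G x + ennreal \<epsilon> \<partial>(\<Pi>\<^sub>M j\<in>J. R))"
  proof (rule nn_integral_mono)
    fix x assume x: "x \<in> space (\<Pi>\<^sub>M j\<in>J. R)"
    have "(\<lambda>y. x(i := y)) \<in> R \<rightarrow>\<^sub>M (\<Pi>\<^sub>M j\<in>insert i J. R)"
      using measurable_component_update[OF x insert.hyps(2)] .
    from measurable_compose[OF this insert.prems(1)]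
    have "(\<integral>\<^sup>+y. g (x(i := y)) \<partial>R) = ennreal (1 - \<epsilon>) * G x + ennreal \<epsilon> * (\<integral>\<^sup>+y. g (x(i := y)) \<partial>Q)"
      unfolding G_def by (rule nn_integral_mixture[OF P Q R \<epsilon> mix])
    also have "\<dots> \<le> 1 * G x + ennreal \<epsilon> * (\<integral>\<^sup>+y. 1 \<partial>Q)"
      using \<epsilon> insert.prems(2) by (intro add_mono mult_mono nn_integral_mono) auto
    finally show "(\<integral>\<^sup>+y. g (x(i := y)) \<partial>R) \<le> G x + ennreal \<epsilon>" by (simp add: Q.emeasure_space_1)
  qed
  also have "\<dots> = (\<integral>\<^sup>+x. G x \<partial>(\<Pi>\<^sub>M j\<in>J. R)) + ennreal \<epsilon>"
    using Gm by (simp add: nn_integral_add RJ.emeasure_space_1)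
  also have "\<dots> \<le> ((\<integral>\<^sup>+x. G x \<partial>(\<Pi>\<^sub>M j\<in>J. P)) + ennreal (real (card J) * \<epsilon>)) + ennreal \<epsilon>"
    by (intro add_right_mono insert.IH Gm G1)
  also have "(\<integral>\<^sup>+x. G x \<partial>(\<Pi>\<^sub>M j\<in>J. P)) = (\<integral>\<^sup>+x. g x \<partial>(\<Pi>\<^sub>M j\<in>insert i J. P))"
    unfolding G_def by (rule PP.product_nn_integral_insert[symmetric]) (use insert gP in auto)
  also have "(\<integral>\<^sup>+x. g x \<partial>(\<Pi>\<^sub>M j\<in>insert i J. P)) + ennreal (real (card J) * \<epsilon>) + ennreal \<epsilon>
    = (\<integral>\<^sup>+x. g x \<partial>(\<Pi>\<^sub>M j\<in>insert i J. P)) + ennreal (real (card J) * \<epsilon> + \<epsilon>)"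
    using \<epsilon> by (simp add: add.assoc)
  also have "real (card J) * \<epsilon> + \<epsilon> = real (card (insert i J)) * \<epsilon>"
    using insert.hyps by (simp add: algebra_simps)
  finally show ?case .
qed

lemma iid_sum_second_moment:
  fixes \<phi> :: "'a \<Rightarrow> real" and J :: "'i set"
  assumes P: "prob_space P" and J: "finite J" and int: "integrable P \<phi>" "integrable P (\<lambda>x. \<phi> x * \<phi> x)"
    and mean: "integral\<^sup>L P \<phi> = 0"
  shows "integrable (\<Pi>\<^sub>M j\<in>J. P) (\<lambda>x. (\<Sum>j\<in>J. \<phi> (x j))\<^sup>2)"
    "(\<integral>x. (\<Sum>j\<in>J. \<phi> (x j))\<^sup>2 \<partial>(\<Pi>\<^sub>M j\<in>J. P)) = real (card J) * (\<integral>x. \<phi> x * \<phi> x \<partial>P)"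
proof -
  let ?M = "\<Pi>\<^sub>M j\<in>J. P"
  have sq: "(\<Sum>j\<in>J. \<phi> (x j))\<^sup>2 = (\<Sum>i\<in>J. \<Sum>j\<in>J. \<phi> (x i) * \<phi> (x j))" for x
    by (simp add: power2_eq_square sum_product)
  have e: "integrable ?M (\<lambda>x. \<phi> (x i) * \<phi> (x j))"
    "(\<integral>x. \<phi> (x i) * \<phi> (x j) \<partial>?M) = (if j = i then (\<integral>x. \<phi> x * \<phi> x \<partial>P) else 0)" if "i \<in> J" "j \<in> J" for i j
  proof -
    have "integrable ?M (\<lambda>x. \<phi> (x i) * \<phi> (x j)) \<and>
      (\<integral>x. \<phi> (x i) * \<phi> (x j) \<partial>?M) = (if j = i then (\<integral>x. \<phi> x * \<phi> x \<partial>P) else 0)"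
    proof (cases "i = j")
      case True
      then show ?thesis using PiM_component_integral[OF P that(1) int(2)] by simp
    next
      case False
      then show ?thesis using PiM_two_components_integral[OF P that False int(1) int(1)] mean by auto
    qed
    then show "integrable ?M (\<lambda>x. \<phi> (x i) * \<phi> (x j))"
      "(\<integral>x. \<phi> (x i) * \<phi> (x j) \<partial>?M) = (if j = i then (\<integral>x. \<phi> x * \<phi> x \<partial>P) else 0)" by auto
  qed
  show "integrable ?M (\<lambda>x. (\<Sum>j\<in>J. \<phi> (x j))\<^sup>2)"
    unfolding sq by (intro Bochner_Integration.integrable_sum e)
  have "(\<integral>x. (\<Sum>j\<in>J. \<phi> (x j))\<^sup>2 \<partial>?M) = (\<Sum>i\<in>J. (\<integral>x. (\<Sum>j\<in>J. \<phi> (x i) * \<phi> (x j)) \<partial>?M))"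
    unfolding sq by (intro Bochner_Integration.integral_sum Bochner_Integration.integrable_sum e)
  also have "\<dots> = (\<Sum>i\<in>J. \<Sum>j\<in>J. (\<integral>x. \<phi> (x i) * \<phi> (x j) \<partial>?M))"
    by (intro sum.cong refl Bochner_Integration.integral_sum e)
  also have "\<dots> = (\<Sum>i\<in>J. \<Sum>j\<in>J. if j = i then (\<integral>x. \<phi> x * \<phi> x \<partial>P) else 0)"
    by (intro sum.cong refl e)
  also have "\<dots> = real (card J) * (\<integral>x. \<phi> x * \<phi> x \<partial>P)" using J by simp
  finally show "(\<integral>x. (\<Sum>j\<in>J. \<phi> (x j))\<^sup>2 \<partial>?M) = real (card J) * (\<integral>x. \<phi> x * \<phi> x \<partial>P)" .
qed

lemma iid_sum_tail:
  fixes \<phi> :: "'a \<Rightarrow> real" and J :: "'i set"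
  assumes P: "prob_space P" and J: "finite J" and int: "integrable P \<phi>" "integrable P (\<lambda>x. \<phi> x * \<phi> x)"
    and mean: "integral\<^sup>L P \<phi> = 0" and t: "0 < t"
  shows "measure (\<Pi>\<^sub>M j\<in>J. P) {x \<in> space (\<Pi>\<^sub>M j\<in>J. P). t < \<bar>\<Sum>j\<in>J. \<phi> (x j)\<bar>}
    \<le> real (card J) * (\<integral>x. \<phi> x * \<phi> x \<partial>P) / t\<^sup>2"
proof -
  let ?M = "\<Pi>\<^sub>M j\<in>J. P"
  interpret prob_space ?M by (intro prob_space_PiM P)
  note sm = iid_sum_second_moment[OF P J int mean]
  have [measurable]: "(\<lambda>x. (\<Sum>j\<in>J. \<phi> (x j))\<^sup>2) \<in> borel_measurable ?M" using sm(1) by (rule borel_measurable_integrable)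
  have "measure ?M {x \<in> space ?M. t < \<bar>\<Sum>j\<in>J. \<phi> (x j)\<bar>} \<le> measure ?M {x \<in> space ?M. t\<^sup>2 \<le> (\<Sum>j\<in>J. \<phi> (x j))\<^sup>2}"
  proof (rule finite_measure_mono)
    show "{x \<in> space ?M. t < \<bar>\<Sum>j\<in>J. \<phi> (x j)\<bar>} \<subseteq> {x \<in> space ?M. t\<^sup>2 \<le> (\<Sum>j\<in>J. \<phi> (x j))\<^sup>2}"
      using t by (auto simp: abs_le_square_iff[symmetric])
  qed measurable
  also have "\<dots> \<le> (\<integral>x. (\<Sum>j\<in>J. \<phi> (x j))\<^sup>2 \<partial>?M) / t\<^sup>2"
    by (rule integral_Markov_inequality_measure[OF sm(1), of "{}"]) (use t in auto)
  finally show ?thesis by (simp add: sm(2))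
qed

lemma contaminated_iid_sum_tail:
  fixes \<phi> :: "'a \<Rightarrow> real" and J :: "'i set"
  assumes P: "prob_space P" "sets P = sets R" and Q: "prob_space Q" "sets Q = sets R" and R: "prob_space R"
    and \<epsilon>: "0 \<le> \<epsilon>" "\<epsilon> \<le> 1" and mix: "is_mixture \<epsilon> R P Q" and J: "finite J"
    and int: "integrable P \<phi>" "integrable P (\<lambda>x. \<phi> x * \<phi> x)" and mean: "integral\<^sup>L P \<phi> = 0" and t: "0 < t"
  shows "measure (\<Pi>\<^sub>M j\<in>J. R) {x \<in> space (\<Pi>\<^sub>M j\<in>J. R). t < \<bar>\<Sum>j\<in>J. \<phi> (x j)\<bar>}
    \<le> real (card J) * (\<integral>x. \<phi> x * \<phi> x \<partial>P) / t\<^sup>2 + real (card J) * \<epsilon>"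
proof -
  interpret PJ: prob_space "\<Pi>\<^sub>M j\<in>J. P" by (intro prob_space_PiM P)
  interpret RJ: prob_space "\<Pi>\<^sub>M j\<in>J. R" by (intro prob_space_PiM R)
  have sPR: "sets (\<Pi>\<^sub>M j\<in>J. P) = sets (\<Pi>\<^sub>M j\<in>J. R)" using P(2) by (intro sets_PiM_cong) auto
  have sp: "space (\<Pi>\<^sub>M j\<in>J. P) = space (\<Pi>\<^sub>M j\<in>J. R)" by (rule sets_eq_imp_space_eq[OF sPR])
  let ?E = "{x \<in> space (\<Pi>\<^sub>M j\<in>J. R). t < \<bar>\<Sum>j\<in>J. \<phi> (x j)\<bar>}"
  have "\<phi> \<in> borel_measurable R"
    using borel_measurable_integrable[OF int(1)] by (simp add: measurable_cong_sets[OF P(2) refl])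
  then have E: "?E \<in> sets (\<Pi>\<^sub>M j\<in>J. R)" by measurable
  have "ennreal (measure (\<Pi>\<^sub>M j\<in>J. R) ?E) = (\<integral>\<^sup>+x. indicator ?E x \<partial>(\<Pi>\<^sub>M j\<in>J. R))"
    using E by (simp add: RJ.emeasure_eq_measure)
  also have "\<dots> \<le> (\<integral>\<^sup>+x. indicator ?E x \<partial>(\<Pi>\<^sub>M j\<in>J. P)) + ennreal (real (card J) * \<epsilon>)"
    using E by (intro nn_integral_PiM_contaminated_le[OF P Q R \<epsilon> mix J]) (auto simp: indicator_def)
  also have "(\<integral>\<^sup>+x. indicator ?E x \<partial>(\<Pi>\<^sub>M j\<in>J. P)) = ennreal (measure (\<Pi>\<^sub>M j\<in>J. P) ?E)"
    using E sPR by (simp add: PJ.emeasure_eq_measure)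
  finally have "measure (\<Pi>\<^sub>M j\<in>J. R) ?E \<le> measure (\<Pi>\<^sub>M j\<in>J. P) ?E + real (card J) * \<epsilon>"
    using \<epsilon> by (simp add: ennreal_plus[symmetric] del: ennreal_plus)
  also have "measure (\<Pi>\<^sub>M j\<in>J. P) ?E \<le> real (card J) * (\<integral>x. \<phi> x * \<phi> x \<partial>P) / t\<^sup>2"
    using iid_sum_tail[OF P(1) J int mean t] sp by simp
  finally show ?thesis by simp
qed

section \<open>Disjoint blocks of observations and the uniform bound for their sums\<close>

definition block :: "nat \<Rightarrow> nat \<Rightarrow> nat set" where
  "block m k = {k * m..<Suc k * m}"

lemma card_block [simp]: "card (block m k) = m" by (simp add: block_def)

lemma finite_block [simp]: "finite (block m k)" by (simp add: block_def)

lemma block_subset: "k < K \<Longrightarrow> K * m \<le> n \<Longrightarrow> block m k \<subseteq> {..<n}"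
proof -
  assume "k < K" "K * m \<le> n"
  then have "Suc k * m \<le> n" using mult_le_mono1[of "Suc k" K m] by linarith
  then show ?thesis by (auto simp: block_def)
qed

lemma disjoint_blocks: "disjoint_family_on (block m) S"
proof -
  have "block m k \<inter> block m l = {}" if "k < l" for k l
  proof -
    have "Suc k * m \<le> l * m" using that by (intro mult_le_mono1) simp
    then show ?thesis by (auto simp: block_def)
  qed
  then show ?thesis unfolding disjoint_family_on_def by (metis inf_commute nat_neq_iff)
qed

lemma indep_block_sums:
  fixes \<phi> :: "'a \<Rightarrow> real"
  assumes R: "prob_space R" and Km: "K * m \<le> n" and n: "1 \<le> n" and \<phi>: "\<phi> \<in> borel_measurable R"
  shows "prob_space.indep_vars (\<Pi>\<^sub>M j\<in>{..<n}. R) (\<lambda>_. borel) (\<lambda>k \<omega>. \<Sum>j\<in>block m k. \<phi> (\<omega> j)) {..<K}"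
proof -
  interpret prob_space "\<Pi>\<^sub>M j\<in>{..<n}. R" by (intro prob_space_PiM R)
  have "{..<n} \<noteq> {}" using n by (auto simp: lessThan_empty_iff)
  from indep_vars_restrict[OF indep_vars_PiM_coordinates[OF R this], of "{..<K}" "block m"]
  have "indep_vars (\<lambda>k. \<Pi>\<^sub>M j\<in>block m k. R) (\<lambda>k \<omega>. restrict (\<lambda>j. \<omega> j) (block m k)) {..<K}"
    using block_subset[OF _ Km] disjoint_blocks by auto
  from indep_vars_compose2[OF this, of "\<lambda>k x. \<Sum>j\<in>block m k. \<phi> (x j)" "\<lambda>_. borel"] \<phi>
  have "indep_vars (\<lambda>_. borel) (\<lambda>k \<omega>. \<Sum>j\<in>block m k. \<phi> (restrict (\<lambda>j. \<omega> j) (block m k) j)) {..<K}"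
    by simp
  then show ?thesis by simp
qed

lemma block_sum_tail:
  fixes \<phi> :: "'a \<Rightarrow> real"
  assumes R: "prob_space R" and B: "B \<subseteq> {..<n::nat}" and \<phi>: "\<phi> \<in> borel_measurable R"
  shows "measure (\<Pi>\<^sub>M j\<in>{..<n}. R) {\<omega> \<in> space (\<Pi>\<^sub>M j\<in>{..<n}. R). t < \<bar>\<Sum>j\<in>B. \<phi> (\<omega> j)\<bar>}
    = measure (\<Pi>\<^sub>M j\<in>B. R) {\<omega> \<in> space (\<Pi>\<^sub>M j\<in>B. R). t < \<bar>\<Sum>j\<in>B. \<phi> (\<omega> j)\<bar>}"
proof -
  interpret R: prob_space R by (rule R)
  interpret product_prob_space "\<lambda>_::nat. R" "{..<n}" by standard
  note \<phi>[measurable]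
  let ?E = "{\<omega> \<in> space (\<Pi>\<^sub>M j\<in>B. R). t < \<bar>\<Sum>j\<in>B. \<phi> (\<omega> j)\<bar>}"
  have E: "?E \<in> sets (\<Pi>\<^sub>M j\<in>B. R)" by measurable
  have "measure (\<Pi>\<^sub>M j\<in>B. R) ?E = measure (distr (\<Pi>\<^sub>M j\<in>{..<n}. R) (\<Pi>\<^sub>M j\<in>B. R) (\<lambda>f. restrict f B)) ?E"
    using distr_restrict[OF B] by simp
  also have "\<dots> = measure (\<Pi>\<^sub>M j\<in>{..<n}. R) ((\<lambda>f. restrict f B) -` ?E \<inter> space (\<Pi>\<^sub>M j\<in>{..<n}. R))"
    by (rule measure_distr[OF measurable_restrict_subset[OF B] E])
  also have "(\<lambda>f. restrict f B) -` ?E \<inter> space (\<Pi>\<^sub>M j\<in>{..<n}. R) = {\<omega> \<in> space (\<Pi>\<^sub>M j\<in>{..<n}. R). t < \<bar>\<Sum>j\<in>B. \<phi> (\<omega> j)\<bar>}"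
    using B by (auto simp: space_PiM)
  finally show ?thesis by simp
qed

lemma has_cov_qform:
  assumes P: "prob_space P" and mean: "has_mean d P \<theta>" and cov: "has_cov d P A"
  defines "\<phi> \<equiv> \<lambda>u x. dotp d (\<lambda>i. x i - \<theta> i) u"
  shows "integrable P (\<phi> u)" "integral\<^sup>L P (\<phi> u) = 0" "integrable P (\<lambda>x. \<phi> u x * \<phi> u x)"
    "(\<integral>x. \<phi> u x * \<phi> u x \<partial>P) = qform d A u"
proof -
  interpret prob_space P by (rule P)
  obtain m where m: "has_mean d P m" "\<And>i j. i < d \<Longrightarrow> j < d \<Longrightarrow> integrable P (\<lambda>x. (x i - m i) * (x j - m j))"
    "\<And>i j. i < d \<Longrightarrow> j < d \<Longrightarrow> (\<integral>x. (x i - m i) * (x j - m j) \<partial>P) = A i j"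
    using cov unfolding has_cov_def by blast
  \<comment> \<open>\<open>has_cov\<close> brings its own mean; both means are given by the same
    integrals.\<close>
  have "m i = \<theta> i" if "i < d" for i using m(1) mean that by (auto simp: has_mean_def)
  then have c: "integrable P (\<lambda>x. (x i - \<theta> i) * (x j - \<theta> j))" "(\<integral>x. (x i - \<theta> i) * (x j - \<theta> j) \<partial>P) = A i j"
    if "i < d" "j < d" for i j using m(2,3)[OF that] that by auto
  have i1: "integrable P (\<lambda>x. x i - \<theta> i)" "(\<integral>x. x i - \<theta> i \<partial>P) = 0" if "i < d" for i
    using mean that by (auto simp: has_mean_def prob_space)
  have int1: "integrable P (\<lambda>x. (x i - \<theta> i) * u i)" if "i < d" for i using i1 that by simp
  show "integrable P (\<phi> u)"
    unfolding \<phi>_def dotp_def using int1 by (intro Bochner_Integration.integrable_sum) auto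
  have "integral\<^sup>L P (\<phi> u) = (\<Sum>i<d. (\<integral>x. (x i - \<theta> i) * u i \<partial>P))"
    unfolding \<phi>_def dotp_def using int1 by (intro Bochner_Integration.integral_sum) auto
  also have "\<dots> = (\<Sum>i<d. (\<integral>x. x i - \<theta> i \<partial>P) * u i)"
    by (intro sum.cong refl integral_mult_left_zero)
  also have "\<dots> = 0" by (intro sum.neutral) (simp add: i1)
  finally show "integral\<^sup>L P (\<phi> u) = 0" .
  have sq: "\<phi> u x * \<phi> u x = (\<Sum>i<d. \<Sum>j<d. (x i - \<theta> i) * (x j - \<theta> j) * (u i * u j))" for x
    unfolding \<phi>_def dotp_def sum_product by (intro sum.cong refl) (simp add: ac_simps)
  have int2: "integrable P (\<lambda>x. (x i - \<theta> i) * (x j - \<theta> j) * (u i * u j))" if "i < d" "j < d" for i j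
    using c(1)[OF that] by (rule integrable_mult_left)
  show "integrable P (\<lambda>x. \<phi> u x * \<phi> u x)"
    unfolding sq using int2 by (intro Bochner_Integration.integrable_sum) auto
  have "(\<integral>x. \<phi> u x * \<phi> u x \<partial>P) = (\<Sum>i<d. (\<integral>x. (\<Sum>j<d. (x i - \<theta> i) * (x j - \<theta> j) * (u i * u j)) \<partial>P))"
    unfolding sq using int2 by (intro Bochner_Integration.integral_sum Bochner_Integration.integrable_sum) auto
  also have "\<dots> = (\<Sum>i<d. \<Sum>j<d. (\<integral>x. (x i - \<theta> i) * (x j - \<theta> j) * (u i * u j) \<partial>P))"
    using int2 by (intro sum.cong refl Bochner_Integration.integral_sum) auto
  also have "\<dots> = (\<Sum>i<d. \<Sum>j<d. A i j * (u i * u j))"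
    by (intro sum.cong refl) (simp add: c)
  finally show "(\<integral>x. \<phi> u x * \<phi> u x \<partial>P) = qform d A u" by (simp add: qform_expand)
qed

text \<open>For a fixed direction \<open>u\<close>, a block sum exceeds \<open>t\<close> with
  probability at most \<open>m * qform d A u / t\<^sup>2 + m * \<epsilon>\<close>. Doubled and
  multiplied by the number of blocks, this is the exponent required by the PAC-Bayes argument: a
  constant plus a multiple of the quadratic form.\<close>

lemma contaminated_block_event:
  assumes P: "P \<in> prob_measures d" and Q: "Q \<in> prob_measures d" and R: "R \<in> prob_measures d"
    and \<epsilon>: "0 \<le> \<epsilon>" "\<epsilon> \<le> 1" and mix: "is_mixture \<epsilon> R P Q"
    and mean: "has_mean d P \<theta>" and cov: "has_cov d P A"
    and Km: "K * m \<le> n" and n: "1 \<le> n" and t: "0 < t" and \<delta>: "0 < \<delta>" and \<sigma>: "0 < \<sigma>"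
  shows "\<exists>E\<in>sets (\<Pi>\<^sub>M j\<in>{..<n}. R). 1 - \<delta> \<le> measure (\<Pi>\<^sub>M j\<in>{..<n}. R) E \<and>
    (\<forall>\<omega>\<in>E. \<forall>v. real (card {k\<in>{..<K}. t < \<bar>\<Sum>j\<in>block m k. dotp d (\<lambda>i. \<omega> j i - \<theta> i) v\<bar>})
      \<le> 2 * (dotp d v v / (2 * \<sigma>\<^sup>2) + ln (1 / \<delta>) + 2 * real K * real m * \<epsilon>
             + 2 * real K * real m / t\<^sup>2 * (qform d A v + \<sigma>\<^sup>2 * mat_trace d A)))"
proof -
  have pP: "prob_space P" and pQ: "prob_space Q" and pR: "prob_space R"
    and sP: "sets P = sets (euclid d)" and sQ: "sets Q = sets (euclid d)" and sR: "sets R = sets (euclid d)"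
    using P Q R by (auto simp: prob_measures_def space_prob_algebra)
  define M where "M = (\<Pi>\<^sub>M j\<in>{..<n}. R)"
  have M: "prob_space M" unfolding M_def by (intro prob_space_PiM pR)
  define W where "W = (\<lambda>k (\<omega> :: nat \<Rightarrow> nat \<Rightarrow> real) i. \<Sum>j\<in>block m k. (\<omega> j i - \<theta> i))"
  have W: "dotp d (W k \<omega>) v = (\<Sum>j\<in>block m k. dotp d (\<lambda>i. \<omega> j i - \<theta> i) v)" for k \<omega> v
    unfolding W_def by (rule dotp_sum_left)
  have Wm: "(\<lambda>\<omega>. W k \<omega> i) \<in> borel_measurable M" if "k < K" "i < d" for k i
  proof -
    have "(\<lambda>\<omega>. \<omega> j i) \<in> borel_measurable M" if j: "j \<in> block m k" for j
    proof -
      have "(\<lambda>\<omega>. \<omega> j) \<in> M \<rightarrow>\<^sub>M R"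
        unfolding M_def using block_subset[OF \<open>k < K\<close> Km] j by (intro measurable_component_singleton) auto
      moreover have "(\<lambda>x. x i) \<in> borel_measurable R"
        using measurable_euclid_component[OF \<open>i < d\<close>] by (simp add: measurable_cong_sets[OF sR refl])
      ultimately show ?thesis by (rule measurable_compose)
    qed
    then show ?thesis unfolding W_def by (intro borel_measurable_sum borel_measurable_diff) auto
  qed
  have mgf: "(\<integral>\<^sup>+\<omega>. ennreal (exp (\<Sum>k<K. indicator {x. t < \<bar>x\<bar>} (dotp d (W k \<omega>) u))) \<partial>M)
      \<le> ennreal (exp (2 * real K * real m * \<epsilon> + 2 * real K * real m / t\<^sup>2 * qform d A u))" for u
  proof -
    define \<phi> where "\<phi> = (\<lambda>x. dotp d (\<lambda>i. x i - \<theta> i) u)"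
    have \<phi>: "integrable P \<phi>" "integral\<^sup>L P \<phi> = 0" "integrable P (\<lambda>x. \<phi> x * \<phi> x)"
      "(\<integral>x. \<phi> x * \<phi> x \<partial>P) = qform d A u"
      unfolding \<phi>_def by (rule has_cov_qform[OF pP mean cov])+
    have \<phi>m: "\<phi> \<in> borel_measurable R"
      using borel_measurable_integrable[OF \<phi>(1)] by (simp add: measurable_cong_sets[OF sR refl] measurable_cong_sets[OF sP refl])
    have tail: "measure M {\<omega> \<in> space M. t < \<bar>\<Sum>j\<in>block m k. \<phi> (\<omega> j)\<bar>} \<le> real m * qform d A u / t\<^sup>2 + real m * \<epsilon>"
      if "k < K" for k
      using contaminated_iid_sum_tail[OF pP _ pQ _ pR \<epsilon> mix finite_block \<phi>(1) \<phi>(3) \<phi>(2) t, of m k] sP sQ sR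
        block_sum_tail[OF pR block_subset[OF that Km] \<phi>m, of t] \<phi>(4)
      by (simp add: M_def)
    have "(\<integral>\<^sup>+\<omega>. ennreal (exp (\<Sum>k<K. indicator {x. t < \<bar>x\<bar>} (\<Sum>j\<in>block m k. \<phi> (\<omega> j)))) \<partial>M)
      \<le> ennreal (exp (real K * (2 * (real m * qform d A u / t\<^sup>2 + real m * \<epsilon>))))"
      by (rule mgf_independent_indicators[OF M]) (use indep_block_sums[OF pR Km n \<phi>m] tail in \<open>auto simp: M_def\<close>)
    also have "real K * (2 * (real m * qform d A u / t\<^sup>2 + real m * \<epsilon>))
      = 2 * real K * real m * \<epsilon> + 2 * real K * real m / t\<^sup>2 * qform d A u" by (simp add: algebra_simps)
    finally show ?thesis by (simp add: W \<phi>_def)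
  qed
  from uniform_count_event[where W = W, OF \<sigma> M Wm mgf \<delta>] show ?thesis
    unfolding W M_def by blast
qed

section \<open>Median-of-means estimator\<close>

definition rat_vecs :: "nat \<Rightarrow> (nat \<Rightarrow> real) set" where
  "rat_vecs d = ({..<d} \<rightarrow>\<^sub>E \<rat>)"

definition block_stat :: "nat \<Rightarrow> nat \<Rightarrow> (nat \<Rightarrow> nat \<Rightarrow> real) \<Rightarrow> nat \<Rightarrow> (nat \<Rightarrow> real) \<Rightarrow> (nat \<Rightarrow> real) \<Rightarrow> real" where
  "block_stat d m x k y v = (\<Sum>j\<in>block m k. dotp d (\<lambda>i. x j i - y i) v)"

text \<open>\<open>block_stat\<close> is \<open>m\<close> times the deviation of a block mean from
  \<open>y\<close> along \<open>v\<close>. The threshold is twice the deviation \<open>t\<close>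
  expected around the true mean, because that mean need not be rational and a nearby candidate has
  to pass.\<close>

definition accepts :: "nat \<Rightarrow> nat \<Rightarrow> nat \<Rightarrow> real \<Rightarrow> (nat \<Rightarrow> nat \<Rightarrow> real) \<Rightarrow> (nat \<Rightarrow> real) \<Rightarrow> bool" where
  "accepts d K m t x y \<longleftrightarrow>
     (\<forall>v\<in>rat_vecs d. 2 * card {k\<in>{..<K}. 2 * t * l2norm d v < \<bar>block_stat d m x k y v\<bar>} < K)"

text \<open>Rational directions and candidates make acceptance and the choice of a candidate measurable.\<close>

definition estimator :: "nat \<Rightarrow> nat \<Rightarrow> nat \<Rightarrow> real \<Rightarrow> (nat \<Rightarrow> nat \<Rightarrow> real) \<Rightarrow> nat \<Rightarrow> real" where
  "estimator d K m t x = from_nat_into (rat_vecs d) (LEAST l. accepts d K m t x (from_nat_into (rat_vecs d) l))"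

lemma countable_rat_vecs: "countable (rat_vecs d)"
  unfolding rat_vecs_def by (intro countable_PiE countable_rat) auto

lemma rat_vecs_nonempty: "rat_vecs d \<noteq> {}"
  unfolding rat_vecs_def by (simp add: PiE_eq_empty_iff) (metis Rats_0 empty_iff)

lemma rat_vecs_subset_space: "rat_vecs d \<subseteq> space (euclid d)"
  by (auto simp: rat_vecs_def space_euclid)

lemma measurable_block_stat:
  assumes "k < K" "K * m \<le> n"
  shows "(\<lambda>x. block_stat d m x k y v) \<in> borel_measurable (\<Pi>\<^sub>M j\<in>{..<n}. euclid d)"
  unfolding block_stat_def
proof (intro borel_measurable_sum measurable_dotp borel_measurable_diff borel_measurable_const)
  fix j i assume "j \<in> block m k" "i < d"
  then have j: "j \<in> {..<n}" using block_subset[OF assms] by auto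
  show "(\<lambda>x. x j i) \<in> borel_measurable (\<Pi>\<^sub>M j\<in>{..<n}. euclid d)"
    by (rule measurable_compose[OF measurable_component_singleton[OF j] measurable_euclid_component[OF \<open>i < d\<close>]])
qed

lemma measurable_accepts:
  assumes "K * m \<le> n"
  shows "Measurable.pred (\<Pi>\<^sub>M j\<in>{..<n}. euclid d) (\<lambda>x. accepts d K m t x y)"
proof -
  have "Measurable.pred (\<Pi>\<^sub>M j\<in>{..<n}. euclid d) (\<lambda>x. 2 * card {k\<in>{..<K}. 2 * t * l2norm d v < \<bar>block_stat d m x k y v\<bar>} < K)" for v
  proof -
    have [measurable]: "(\<lambda>x. indicator {s. 2 * t * l2norm d v < \<bar>s\<bar>} (block_stat d m x k y v) :: real) \<in> borel_measurable (\<Pi>\<^sub>M j\<in>{..<n}. euclid d)"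
      if "k < K" for k
      by (rule measurable_compose[OF measurable_block_stat[OF that assms]]) measurable
    have "(\<lambda>x. \<Sum>k<K. indicator {s. 2 * t * l2norm d v < \<bar>s\<bar>} (block_stat d m x k y v) :: real) \<in> borel_measurable (\<Pi>\<^sub>M j\<in>{..<n}. euclid d)"
      by (intro borel_measurable_sum) simp
    then have "Measurable.pred (\<Pi>\<^sub>M j\<in>{..<n}. euclid d)
       (\<lambda>x. 2 * (\<Sum>k<K. indicator {s. 2 * t * l2norm d v < \<bar>s\<bar>} (block_stat d m x k y v)) < real K)"
      by measurable
    moreover have "2 * (\<Sum>k<K. indicator {s. 2 * t * l2norm d v < \<bar>s\<bar>} (block_stat d m x k y v)) < real K
      \<longleftrightarrow> 2 * card {k\<in>{..<K}. 2 * t * l2norm d v < \<bar>block_stat d m x k y v\<bar>} < K" for x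
    proof -
      have "(\<Sum>k<K. indicator {s. 2 * t * l2norm d v < \<bar>s\<bar>} (block_stat d m x k y v))
        = real (card {k\<in>{..<K}. 2 * t * l2norm d v < \<bar>block_stat d m x k y v\<bar>})"
        by (simp add: indicator_def sum.If_cases Int_def)
      then show ?thesis by linarith
    qed
    ultimately show ?thesis by (simp only:)
  qed
  then have "Measurable.pred (\<Pi>\<^sub>M j\<in>{..<n}. euclid d)
    (\<lambda>x. \<forall>l. 2 * card {k\<in>{..<K}. 2 * t * l2norm d (from_nat_into (rat_vecs d) l)
      < \<bar>block_stat d m x k y (from_nat_into (rat_vecs d) l)\<bar>} < K)"
    by (intro pred_intros_countable)
  moreover have "(\<forall>v\<in>rat_vecs d. Q v) \<longleftrightarrow> (\<forall>l. Q (from_nat_into (rat_vecs d) l))" for Q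
    by (subst range_from_nat_into[OF rat_vecs_nonempty countable_rat_vecs, symmetric]) simp
  ultimately show ?thesis unfolding accepts_def by (simp only:)
qed

lemma measurable_estimator:
  assumes "K * m \<le> n"
  shows "estimator d K m t \<in> (\<Pi>\<^sub>M j\<in>{..<n}. euclid d) \<rightarrow>\<^sub>M euclid d"
proof -
  have "(\<lambda>x. LEAST l. accepts d K m t x (from_nat_into (rat_vecs d) l)) \<in> (\<Pi>\<^sub>M j\<in>{..<n}. euclid d) \<rightarrow>\<^sub>M count_space UNIV"
    by (intro measurable_Least measurable_accepts[OF assms])
  moreover have "from_nat_into (rat_vecs d) \<in> count_space UNIV \<rightarrow>\<^sub>M euclid d"
    using from_nat_into[OF rat_vecs_nonempty] rat_vecs_subset_space by auto
  ultimately show ?thesis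
    unfolding estimator_def[abs_def] by (rule measurable_compose)
qed

lemma rat_vec_approx:
  assumes r: "0 < r"
  obtains y where "y \<in> rat_vecs d" "l2norm d (\<lambda>i. y i - x i) \<le> r"
proof -
  define e where "e = r / (real d + 1)"
  have e: "0 < e" using r by (simp add: e_def)
  have "\<exists>q\<in>\<rat>. \<bar>q - x i\<bar> \<le> e" for i
    using Rats_dense_in_real[of "x i" "x i + e"] e by force
  then obtain q where q: "\<And>i. q i \<in> \<rat>" "\<And>i. \<bar>q i - x i\<bar> \<le> e" by metis
  define y where "y = restrict q {..<d}"
  have "l2norm d (\<lambda>i. y i - x i) \<le> (\<Sum>i<d. \<bar>y i - x i\<bar>)"
    unfolding l2norm_def by (rule L2_set_le_sum_abs)
  also have "\<dots> \<le> (\<Sum>i<d. e)" by (intro sum_mono) (simp add: y_def q)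
  also have "\<dots> \<le> r" using r by (simp add: e_def field_simps)
  finally show thesis using that[of y] q by (auto simp: y_def rat_vecs_def)
qed

lemma block_stat_diff:
  "block_stat d m x k y v = block_stat d m x k z v + real m * dotp d (\<lambda>i. z i - y i) v"
proof -
  have "dotp d (\<lambda>i. x j i - y i) v = dotp d (\<lambda>i. x j i - z i) v + dotp d (\<lambda>i. z i - y i) v" for j
    by (simp add: dotp_add_left[symmetric])
  then show ?thesis by (simp add: block_stat_def sum.distrib)
qed

lemma block_stat_scale: "block_stat d m x k y (\<lambda>i. c * v i) = c * block_stat d m x k y v"
  unfolding block_stat_def dotp_scale_right by (simp add: sum_distrib_left)

text \<open>Replacing \<theta> by \<open>y\<close> shifts each block statistic by at most
  \<open>t * l2norm d v\<close>, so a block beyond \<open>2 * t\<close> around \<open>y\<close> is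
  beyond \<open>t\<close> around \<theta>. The condition is homogeneous in \<open>v\<close>, and
  unit directions suffice.\<close>

lemma accepts_near_center:
  assumes K: "0 < K" and t: "0 < t"
    and ok: "\<And>v. dotp d v v = 1 \<Longrightarrow> 2 * card {k\<in>{..<K}. t < \<bar>block_stat d m x k \<theta> v\<bar>} < K"
    and y: "real m * l2norm d (\<lambda>i. \<theta> i - y i) \<le> t"
  shows "accepts d K m t x y"
  unfolding accepts_def
proof
  fix v assume "v \<in> rat_vecs d"
  show "2 * card {k\<in>{..<K}. 2 * t * l2norm d v < \<bar>block_stat d m x k y v\<bar>} < K"
  proof (cases "l2norm d v = 0")
    case True
    then have "dotp d v v = 0" using l2norm_sq[of d v] by simp
    then have "v i = 0" if "i < d" for i using that by (rule dotp_self_eq_0)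
    then have "dotp d w v = 0" for w by (simp add: dotp_def)
    then show ?thesis using K True by (simp add: block_stat_def)
  next
    case False
    then have l: "0 < l2norm d v" using l2norm_nonneg[of d v] by linarith
    define v' where "v' = (\<lambda>i. (1 / l2norm d v) * v i)"
    have "dotp d v' v' = 1"
      unfolding v'_def dotp_scale_left dotp_scale_right l2norm_sq[symmetric]
      using l by (simp add: power2_eq_square)
    moreover have "{k\<in>{..<K}. 2 * t * l2norm d v < \<bar>block_stat d m x k y v\<bar>} \<subseteq> {k\<in>{..<K}. t < \<bar>block_stat d m x k \<theta> v'\<bar>}"
    proof safe
      fix k assume a: "2 * t * l2norm d v < \<bar>block_stat d m x k y v\<bar>"
      have "\<bar>real m * dotp d (\<lambda>i. \<theta> i - y i) v\<bar> \<le> real m * (l2norm d (\<lambda>i. \<theta> i - y i) * l2norm d v)"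
        by (simp add: abs_mult dotp_le_l2norm mult_left_mono)
      also have "\<dots> \<le> t * l2norm d v"
        using mult_right_mono[OF y, of "l2norm d v"] by (simp add: mult.assoc)
      finally have "t * l2norm d v < \<bar>block_stat d m x k \<theta> v\<bar>"
        using a block_stat_diff[of d m x k y v \<theta>] by linarith
      then show "t < \<bar>block_stat d m x k \<theta> v'\<bar>"
        unfolding v'_def block_stat_scale using l by (simp add: abs_mult field_simps)
    qed
    ultimately show ?thesis
      using ok[of v'] card_mono[of "{k\<in>{..<K}. t < \<bar>block_stat d m x k \<theta> v'\<bar>}" "{k\<in>{..<K}. 2 * t * l2norm d v < \<bar>block_stat d m x k y v\<bar>}"]
      by simp
  qed
qed

text \<open>Test both candidates in the direction \<open>v\<close> of their difference. Each loses
  fewer than half of the blocks, so some block is good for both; there the two statistics differ by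
  \<open>m\<close> times the squared length of \<open>v\<close>, and by at most \<open>4 * t\<close>
  times its length.\<close>

lemma accepted_close:
  assumes t: "0 < t"
    and y: "y \<in> rat_vecs d" "accepts d K m t x y" and z: "z \<in> rat_vecs d" "accepts d K m t x z"
  shows "real m * l2norm d (\<lambda>i. y i - z i) \<le> 4 * t"
proof -
  define v where "v = (\<lambda>i\<in>{..<d}. y i - z i)"
  have v: "v \<in> rat_vecs d" using y(1) z(1) unfolding v_def rat_vecs_def by (auto simp: PiE_iff)
  have dv: "dotp d w (\<lambda>i. y i - z i) = dotp d w v" for w by (rule dotp_cong) (auto simp: v_def)
  have lv: "l2norm d v = l2norm d (\<lambda>i. y i - z i)" by (simp add: l2norm_def v_def L2_set_def)
  define Y where "Y = {k\<in>{..<K}. 2 * t * l2norm d v < \<bar>block_stat d m x k y v\<bar>}"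
  define Z where "Z = {k\<in>{..<K}. 2 * t * l2norm d v < \<bar>block_stat d m x k z v\<bar>}"
  have "2 * card Y < K" "2 * card Z < K" using y z v unfolding accepts_def Y_def Z_def by auto
  then have "card (Y \<union> Z) < K" using card_Un_le[of Y Z] by linarith
  moreover have "Y \<union> Z \<subseteq> {..<K}" by (auto simp: Y_def Z_def)
  ultimately obtain k where k: "k < K" "k \<notin> Y" "k \<notin> Z"
    by (metis Un_iff card_lessThan lessThan_iff nat_neq_iff subsetI subset_antisym)
  have "dotp d (\<lambda>i. y i - z i) v = (l2norm d v)\<^sup>2"
    unfolding l2norm_sq using dv[of v] by (simp add: dotp_commute)
  then have le: "(real m * l2norm d v) * l2norm d v \<le> (4 * t) * l2norm d v"
    using k block_stat_diff[of d m x k z v y] by (simp add: Y_def Z_def power2_eq_square)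
  show ?thesis
    unfolding lv[symmetric]
  proof (cases "l2norm d v = 0")
    case False
    then have "0 < l2norm d v" using l2norm_nonneg[of d v] by linarith
    with le show "real m * l2norm d v \<le> 4 * t" by (rule mult_right_le_imp_le)
  qed (use t in simp)
qed

text \<open>A rational vector within \<open>t / m\<close> of \<theta> is accepted. Hence the least
  accepted index exists, and its candidate is within \<open>4 * t / m\<close> of that vector; the
  distances add up to \<open>5 * t / m\<close>.\<close>

lemma estimator_close:
  assumes K: "0 < K" and m: "0 < m" and t: "0 < t"
    and ok: "\<And>v. dotp d v v = 1 \<Longrightarrow> 2 * card {k\<in>{..<K}. t < \<bar>block_stat d m x k \<theta> v\<bar>} < K"
  shows "sq_loss d (estimator d K m t x) \<theta> \<le> (5 * t / real m)\<^sup>2"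
proof -
  have "0 < t / real m" using t m by simp
  then obtain y where y: "y \<in> rat_vecs d" "l2norm d (\<lambda>i. y i - \<theta> i) \<le> t / real m"
    by (rule rat_vec_approx)
  have sym: "l2norm d (\<lambda>i. \<theta> i - y i) = l2norm d (\<lambda>i. y i - \<theta> i)"
    using l2norm_scale[of d "-1" "\<lambda>i. y i - \<theta> i"] by simp
  have acc: "accepts d K m t x y"
    by (rule accepts_near_center[OF K t ok]) (use y m sym in \<open>auto simp: field_simps\<close>)
  obtain l where "from_nat_into (rat_vecs d) l = y"
    using y(1) countable_rat_vecs by (metis from_nat_into_surj)
  then have "accepts d K m t x (from_nat_into (rat_vecs d) l)" using acc by simp
  then have "accepts d K m t x (estimator d K m t x)"
    unfolding estimator_def by (rule LeastI)
  moreover have "estimator d K m t x \<in> rat_vecs d"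
    unfolding estimator_def by (rule from_nat_into[OF rat_vecs_nonempty])
  ultimately have "real m * l2norm d (\<lambda>i. estimator d K m t x i - y i) \<le> 4 * t"
    using y acc by (intro accepted_close[OF t])
  then have "l2norm d (\<lambda>i. estimator d K m t x i - y i) \<le> 4 * t / real m" using m by (simp add: field_simps)
  moreover have "l2norm d (\<lambda>i. estimator d K m t x i - \<theta> i)
    \<le> l2norm d (\<lambda>i. estimator d K m t x i - y i) + l2norm d (\<lambda>i. y i - \<theta> i)"
    using l2norm_triangle[of d "\<lambda>i. estimator d K m t x i - y i" "\<lambda>i. y i - \<theta> i"] by simp
  ultimately have "l2norm d (\<lambda>i. estimator d K m t x i - \<theta> i) \<le> 5 * t / real m"
    using y(2) add_divide_distrib[of "4 * t" t "real m"] by simp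
  then show ?thesis unfolding sq_loss_def by (intro power_mono) auto
qed

section \<open>Choice of the parameters, and the two-sided rate\<close>

lemma minimax_upper_bound:
  assumes d: "1 \<le> d" and \<epsilon>: "0 \<le> \<epsilon>" "\<epsilon> \<le> 1" and A: "sym_pos_def d A" and \<delta>: "0 < \<delta>"
    and K: "1 \<le> K" "K \<le> n" and KL: "20 * ln (1 / \<delta>) \<le> real K" and K\<epsilon>: "100 * \<epsilon> * real n \<le> real K"
  shows "minimax_quantile (\<Pi>\<^sub>M k\<in>{..<n}. euclid d) (euclid d) \<delta> (contaminated_family n d \<epsilon> A) (sq_loss d)
    \<le> ennreal (10000 * (op_norm d A * real K / real n + mat_trace d A / real n))"
proof -
  define m where "m = n div K"
  have m: "1 \<le> m" unfolding m_def using K by (simp add: Suc_le_eq div_greater_zero_iff)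
  have Km: "K * m \<le> n" unfolding m_def by simp
  have "n < K * m + K" unfolding m_def using K mod_less_divisor[of K n] mult_div_mod_eq[of K n] by linarith
  also have "\<dots> \<le> 2 * (K * m)" using m by simp
  \<comment> \<open>Rounding in \<open>n div K\<close> loses at most a factor 2.\<close>
  finally have n2: "real n \<le> 2 * (real K * real m)"
    by (metis less_imp_le of_nat_le_iff of_nat_mult of_nat_numeral)
  have pos: "0 < real m" "0 < real K" "0 < real n" using m K by auto
  have tr: "0 < mat_trace d A" by (rule mat_trace_pos[OF A d])
  have op: "0 \<le> op_norm d A" by (rule op_norm_nonneg)
  \<comment> \<open>The target radius up to a constant: the deviation of a block mean allowed in a
    unit direction. The factor 200 brings the variance term of the count down to
    \<open>K / 10\<close>.\<close>
  define r where "r = sqrt (200 * (op_norm d A / real m + mat_trace d A / (real m * real K)))"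
  have r2: "r\<^sup>2 = 200 * (op_norm d A / real m + mat_trace d A / (real m * real K))"
    unfolding r_def using op tr pos by (intro real_sqrt_pow2) (simp add: add_nonneg_nonneg)
  have r2pos: "0 < r\<^sup>2" unfolding r2 using op tr pos by (simp add: add_nonneg_pos)
  have r: "0 < r" unfolding r_def using op tr pos by (simp add: add_nonneg_pos)
  define t where "t = real m * r"
  have t: "0 < t" using r pos by (simp add: t_def)
  \<comment> \<open>The relative entropy for a unit direction becomes \<open>K / 20\<close>.\<close>
  define \<sigma> where "\<sigma> = sqrt (10 / real K)"
  have \<sigma>: "0 < \<sigma>" "\<sigma>\<^sup>2 = 10 / real K" using pos by (auto simp: \<sigma>_def)
  let ?X = "\<Pi>\<^sub>M k\<in>{..<n}. euclid d"
  have good: "1 - \<delta> \<le> measure S {x \<in> space ?X. sq_loss d (estimator d K m t x) \<theta> \<le> 25 * r\<^sup>2}"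
    if S: "S \<in> contaminated_family n d \<epsilon> A \<theta>" for \<theta> S
  proof -
    obtain P Q R where SR: "S = (\<Pi>\<^sub>M k\<in>{..<n}. R)" and PQR: "P \<in> prob_measures d" "Q \<in> prob_measures d" "R \<in> prob_measures d"
      and mix: "is_mixture \<epsilon> R P Q" and mc: "has_mean d P \<theta>" "has_cov d P A"
      using S unfolding contaminated_family_def by blast
    have "1 \<le> n" using K by linarith
    from contaminated_block_event[OF PQR \<epsilon> mix mc Km this t \<delta> \<sigma>(1)] obtain E where
      E: "E \<in> sets S" "1 - \<delta> \<le> measure S E" and
      count: "\<And>x v. x \<in> E \<Longrightarrow> real (card {k\<in>{..<K}. t < \<bar>block_stat d m x k \<theta> v\<bar>})
        \<le> 2 * (dotp d v v / (2 * \<sigma>\<^sup>2) + ln (1 / \<delta>) + 2 * real K * real m * \<epsilon>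
             + 2 * real K * real m / t\<^sup>2 * (qform d A v + \<sigma>\<^sup>2 * mat_trace d A))"
      unfolding SR block_stat_def by blast
    have pR: "prob_space R" and sR: "sets R = sets (euclid d)"
      using PQR by (auto simp: prob_measures_def space_prob_algebra)
    interpret S: prob_space S unfolding SR by (intro prob_space_PiM pR)
    have sS: "sets S = sets ?X" unfolding SR using sR by (intro sets_PiM_cong) auto
    then have spS: "space S = space ?X" by (rule sets_eq_imp_space_eq)
    have "E \<subseteq> {x \<in> space ?X. sq_loss d (estimator d K m t x) \<theta> \<le> 25 * r\<^sup>2}"
    proof
      fix x assume x: "x \<in> E"
      have "2 * card {k\<in>{..<K}. t < \<bar>block_stat d m x k \<theta> v\<bar>} < K" if v: "dotp d v v = 1" for v
      proof -
        have "l2norm d v \<le> 1" using v l2norm_sq[of d v] by (simp add: abs_square_eq_1)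
        then have q: "qform d A v \<le> op_norm d A" by (rule qform_le_op_norm)
        have "2 * real K * real m / t\<^sup>2 * (qform d A v + \<sigma>\<^sup>2 * mat_trace d A)
          \<le> 2 * real K * real m / t\<^sup>2 * (op_norm d A + 10 / real K * mat_trace d A)"
          using q pos unfolding \<sigma>(2) by (intro mult_left_mono add_right_mono) auto
        also have "\<dots> \<le> 2 * real K * real m / t\<^sup>2 * (10 * (op_norm d A + mat_trace d A / real K))"
          using op pos by (intro mult_left_mono) (auto simp: algebra_simps)
        also have "op_norm d A + mat_trace d A / real K = real m * r\<^sup>2 / 200"
          using pos unfolding r2 by (simp add: field_simps)
        also have "2 * real K * real m / t\<^sup>2 * (10 * (real m * r\<^sup>2 / 200)) = real K / 10"
          using pos r by (simp add: t_def power_mult_distrib power2_eq_square field_simps)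
        finally have 1: "2 * real K * real m / t\<^sup>2 * (qform d A v + \<sigma>\<^sup>2 * mat_trace d A) \<le> real K / 10" .
        have "real (K * m) * \<epsilon> \<le> real n * \<epsilon>"
          by (intro mult_right_mono of_nat_mono Km \<epsilon>)
        moreover have "2 * real K * real m * \<epsilon> = 2 * (real (K * m) * \<epsilon>)" "100 * \<epsilon> * real n = 100 * (real n * \<epsilon>)" by auto
        ultimately have 2: "2 * real K * real m * \<epsilon> \<le> real K / 50" using K\<epsilon> by linarith
        have 3: "dotp d v v / (2 * \<sigma>\<^sup>2) = real K / 20" using v pos unfolding \<sigma>(2) by simp
        have 4: "ln (1 / \<delta>) \<le> real K / 20" using KL by linarith
        note count[OF x, of v]
        \<comment> \<open>Entropy, confidence, contamination and variance. The sum is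
          \<open>0.22 * K\<close>, so at most \<open>0.44 * K\<close> blocks are bad, fewer than
          half.\<close>
        also have "2 * (dotp d v v / (2 * \<sigma>\<^sup>2) + ln (1 / \<delta>) + 2 * real K * real m * \<epsilon>
             + 2 * real K * real m / t\<^sup>2 * (qform d A v + \<sigma>\<^sup>2 * mat_trace d A))
          \<le> 2 * (real K / 20 + real K / 20 + real K / 50 + real K / 10)"
          by (intro mult_left_mono add_mono eq_refl[OF 3] 1 2 4) simp
        finally have "real (card {k\<in>{..<K}. t < \<bar>block_stat d m x k \<theta> v\<bar>}) \<le> 2 * (real K / 20 + real K / 20 + real K / 50 + real K / 10)" .
        then have "real (2 * card {k\<in>{..<K}. t < \<bar>block_stat d m x k \<theta> v\<bar>}) < real K" using pos by simp
        then show ?thesis by (simp only: of_nat_less_iff)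
      qed
      then have "sq_loss d (estimator d K m t x) \<theta> \<le> (5 * t / real m)\<^sup>2"
        by (intro estimator_close) (use K m t in auto)
      also have "\<dots> = 25 * r\<^sup>2" using pos by (simp add: t_def power_mult_distrib)
      finally show "x \<in> {x \<in> space ?X. sq_loss d (estimator d K m t x) \<theta> \<le> 25 * r\<^sup>2}"
        using sets.sets_into_space[OF E(1)] x spS by auto
    qed
    then have "measure S E \<le> measure S {x \<in> space ?X. sq_loss d (estimator d K m t x) \<theta> \<le> 25 * r\<^sup>2}"
    proof (rule S.finite_measure_mono)
      show "{x \<in> space ?X. sq_loss d (estimator d K m t x) \<theta> \<le> 25 * r\<^sup>2} \<in> sets S"
        unfolding sS using measurable_sq_loss[OF measurable_estimator[OF Km], of d t \<theta>] by measurable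
    qed
    then show ?thesis using E(2) by linarith
  qed
  have "minimax_quantile ?X (euclid d) \<delta> (contaminated_family n d \<epsilon> A) (sq_loss d) \<le> ennreal (25 * r\<^sup>2)"
    by (rule minimax_quantile_le[OF measurable_estimator[OF Km]]) (use good in auto)
  \<comment> \<open>The constant is \<open>25 * 200 * 2\<close>, the last factor from rounding the
    block length.\<close>
  also have "25 * r\<^sup>2 \<le> 10000 * (op_norm d A * real K / real n + mat_trace d A / real n)"
  proof -
    have i: "1 / (real m * real K) \<le> 2 / real n" using n2 pos by (simp add: field_simps)
    have "op_norm d A / real m + mat_trace d A / (real m * real K)
      = (op_norm d A * real K + mat_trace d A) * (1 / (real m * real K))"
      using pos by (simp add: field_simps)
    also have "\<dots> \<le> (op_norm d A * real K + mat_trace d A) * (2 / real n)"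
      using i op tr pos by (intro mult_left_mono) (auto intro!: add_nonneg_nonneg)
    finally show ?thesis unfolding r2 using pos by (simp add: field_simps)
  qed
  finally show ?thesis by (simp add: ennreal_leI)
qed

theorem corollary11:
  "\<exists>c>0. \<exists>c1>0. \<exists>c2>0.
     \<forall>(n::nat) (d::nat) (\<epsilon>::real) (\<delta>::real) (\<Sigma>::nat \<Rightarrow> nat \<Rightarrow> real).
       n \<ge> 1 \<longrightarrow> d \<ge> 1 \<longrightarrow> 0 \<le> \<epsilon> \<longrightarrow> \<epsilon> < 1 \<longrightarrow> sym_pos_def d \<Sigma> \<longrightarrow>
       exp (- c * real n * (1 - 300 * \<epsilon>)) \<le> \<delta> \<longrightarrow> \<delta> \<le> 1 / 4 \<longrightarrow>
       (let rate = mat_trace d \<Sigma> / real n + op_norm d \<Sigma> * \<epsilon>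
                     + op_norm d \<Sigma> * ln (1 / \<delta>) / real n;
            M = minimax_quantile (\<Pi>\<^sub>M k\<in>{..<n}. euclid d) (euclid d) \<delta>
                  (contaminated_family n d \<epsilon> \<Sigma>) (sq_loss d)
        in ennreal (c1 * rate) \<le> M \<and> M \<le> ennreal (c2 * rate))"
proof (intro exI conjI allI impI)
  \<comment> \<open>The value 1/100 leaves room for the required blocks among the \<open>n\<close>
    observations. The lower constant is a third of 1/16, the smallest of the three separate ones;
    the upper one is 10000 times a crude 100.\<close>
  show "0 < (1 / 100 :: real)" "0 < (1 / 48 :: real)" "0 < (1000000 :: real)" by auto
  fix n d :: nat and \<epsilon> \<delta> :: real and \<Sigma> :: "nat \<Rightarrow> nat \<Rightarrow> real"
  assume n: "1 \<le> n" and d: "1 \<le> d" and \<epsilon>: "0 \<le> \<epsilon>" "\<epsilon> < 1" and A: "sym_pos_def d \<Sigma>"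
    and \<delta>l: "exp (- (1 / 100) * real n * (1 - 300 * \<epsilon>)) \<le> \<delta>" and \<delta>u: "\<delta> \<le> 1 / 4"
  define M where "M = minimax_quantile (\<Pi>\<^sub>M k\<in>{..<n}. euclid d) (euclid d) \<delta> (contaminated_family n d \<epsilon> \<Sigma>) (sq_loss d)"
  define L where "L = ln (1 / \<delta>)"
  define a where "a = mat_trace d \<Sigma> / real n"
  define b where "b = op_norm d \<Sigma> * \<epsilon>"
  define e where "e = op_norm d \<Sigma> * L / real n"
  have n0: "0 < real n" using n by simp
  have \<delta>: "0 < \<delta>" using \<delta>l by (rule less_le_trans[OF exp_gt_zero])
  have "ln (exp (- (1 / 100) * real n * (1 - 300 * \<epsilon>))) \<le> ln \<delta>"
    using \<delta>l \<delta> by (subst ln_le_cancel_iff) auto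
  then have L: "L \<le> real n * (1 - 300 * \<epsilon>) / 100" using \<delta> by (simp add: L_def ln_div)
  have "ln 4 \<le> L" unfolding L_def using \<delta> \<delta>u by (subst ln_le_cancel_iff) (auto simp: field_simps)
  moreover have "1 \<le> ln (4::real)" using exp_le by (subst ln_ge_iff) auto
  ultimately have L1: "1 \<le> L" by linarith
  \<comment> \<open>As \<delta> \<le> 1/4 makes \<open>L\<close> at least 1, the admissible range of
    \<delta> is empty unless \<epsilon> < 1/300.\<close>
  have "0 < real n * (1 - 300 * \<epsilon>)" using L L1 by linarith
  then have \<epsilon>s: "\<epsilon> < 1 / 300" using n0 by (simp add: zero_less_mult_iff)
  have "real n * (1 - 300 * \<epsilon>) \<le> real n * 1" using \<epsilon> by (intro mult_left_mono) auto
  then have Ln: "100 * L \<le> real n" using L by simp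
  have op: "0 \<le> op_norm d \<Sigma>" by (rule op_norm_nonneg)
  have abe: "0 \<le> a" "0 \<le> b" "0 \<le> e"
    using mat_trace_pos[OF A d] op \<epsilon> L1 n0 by (auto simp: a_def b_def e_def)
  have low: "ennreal (a / 16) \<le> M" "ennreal b \<le> M" "ennreal (e / 8) \<le> M"
    using minimax_lower_bound[OF n d \<epsilon>(1) _ A \<delta> \<delta>u] \<epsilon>s Ln L1 n0
    by (simp_all add: M_def a_def b_def e_def L_def mult.commute)
  \<comment> \<open>The minimax quantile is bounded below by each term separately, and the largest
    of three terms is at least a third of their sum.\<close>
  have "1 / 48 * (a + b + e) \<le> a / 16 \<or> 1 / 48 * (a + b + e) \<le> b \<or> 1 / 48 * (a + b + e) \<le> e / 8"
  proof (rule ccontr)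
    assume "\<not> ?thesis"
    then have "3 * a < a + b + e" "48 * b < a + b + e" "6 * e < a + b + e"
      by (simp_all add: not_le)
    then show False using abe by linarith
  qed
  then have lower: "ennreal (1 / 48 * (a + b + e)) \<le> M"
    using low by (elim disjE) (drule ennreal_leI, erule order_trans, assumption)+
  \<comment> \<open>The coefficient 20 pays for the confidence level and 100 for the contamination
    in the count of bad blocks. The ceiling adds less than 1, which is absorbed by
    \<open>L \<ge> 1\<close>.\<close>
  define K where "K = nat \<lceil>20 * L + 100 * \<epsilon> * real n\<rceil>"
  have en: "0 \<le> \<epsilon> * real n" using \<epsilon> n0 by simp
  have Kr: "20 * L + 100 * \<epsilon> * real n \<le> real K" "real K < 20 * L + 100 * \<epsilon> * real n + 1"
    unfolding K_def using L1 en by (auto simp: ceiling_correct of_nat_nat) linarith+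
  have "\<epsilon> * real n \<le> 1 / 300 * real n" using \<epsilon>s n0 by (intro mult_right_mono) auto
  \<comment> \<open>The summands of \<open>K\<close> are at most \<open>n / 5\<close>,
    \<open>n / 3\<close> and, for the rounding, \<open>n / 100\<close>.\<close>
  then have "real K \<le> real n" using Kr Ln L1 by linarith
  moreover have "0 < real K" using Kr L1 en by linarith
  ultimately have K: "1 \<le> K" "K \<le> n" by auto
  have "20 * ln (1 / \<delta>) \<le> real K" "100 * \<epsilon> * real n \<le> real K"
    using Kr(1) L1 en unfolding L_def[symmetric] by linarith+
  then have "M \<le> ennreal (10000 * (op_norm d \<Sigma> * real K / real n + mat_trace d \<Sigma> / real n))"
    unfolding M_def
    using \<epsilon> by (intro minimax_upper_bound[OF d _ _ A \<delta> K]) auto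
  also have "10000 * (op_norm d \<Sigma> * real K / real n + mat_trace d \<Sigma> / real n) \<le> 1000000 * (a + b + e)"
  proof -
    have "op_norm d \<Sigma> * real K \<le> op_norm d \<Sigma> * (21 * L + 100 * \<epsilon> * real n)"
      using Kr L1 op by (intro mult_left_mono) auto
    then have "op_norm d \<Sigma> * real K / real n \<le> op_norm d \<Sigma> * (21 * L + 100 * \<epsilon> * real n) / real n"
      using n0 by (intro divide_right_mono) auto
    also have "\<dots> = 21 * e + 100 * b" using n0 by (simp add: e_def b_def field_simps)
    finally show ?thesis using abe by (simp add: a_def)
  qed
  finally have upper: "M \<le> ennreal (1000000 * (a + b + e))" by (simp add: ennreal_leI)
  show "let rate = mat_trace d \<Sigma> / real n + op_norm d \<Sigma> * \<epsilon> + op_norm d \<Sigma> * ln (1 / \<delta>) / real n;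
            M = minimax_quantile (\<Pi>\<^sub>M k\<in>{..<n}. euclid d) (euclid d) \<delta> (contaminated_family n d \<epsilon> \<Sigma>) (sq_loss d)
        in ennreal (1 / 48 * rate) \<le> M \<and> M \<le> ennreal (1000000 * rate)"
    using lower upper unfolding Let_def M_def a_def b_def e_def L_def by blast
qed

end
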